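(* Let $G$ be a finite group with exponent $n_1=2^mp_1^{m_1}\cdots p_r^{m_r}$. Let $C(i),C(1),C(-1)\subseteq G\setminus\{1\}$ be unions of conjugacy classes such that $C(i),C(i)^{-1},C(1),C(-1)$ are pairwise disjoint and $C(1)=C(1)^{-1}$, $C(-1)=C(-1)^{-1}$, and let $M=iA_{C(i)}-iA_{C(i)^{-1}}+A_{C(1)}-A_{C(-1)}$ (the Hermitian matrix of the mixed normal Cayley graph $X(G,C(i),C(1),C(-1))$). Then the continuous quantum walk $\exp(itM)$ is periodic if and only if there is a positive square-free integer $D$ such that: if $-D$ is an admissible value then $C(i)$ is a union of $\sim_{-D}$ equivalence classes, and otherwise $C(i)=\emptyset$; and if $D$ is an admissible value then $C(1)$ and $C(-1)$ are unions of $\sim_D$ equivalence classes and, when $D\ne1$, $C(1)=C(-1)^k$ for some $k\in\mathbb{Z}_{n_1}^*\setminus H_D$, and otherwise $C(1)=C(-1)=\emptyset$.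
   Context: $G$ is written multiplicatively; $A_g$ is the permutation matrix with $(A_g)_{a,b}=1$ iff $ba^{-1}=g$; $A_C=\sum_{g\in C}A_g$; $C^{-1}=\{g^{-1}:g\in C\}$ and $C^k=\{g^k:g\in C\}$. The exponent $n_1$ is the least positive integer with $g^{n_1}=1$ for all $g$, and $p_1,\ldots,p_r$ are distinct odd primes. An integer $\Delta$ is admissible if $\Delta=2^{w_0}(-1)^w\prod_{k=1}^r\big((-1)^{(p_k-1)/2}p_k\big)^{w_k}$ with $w,w_0,\ldots,w_r\in\{0,1\}$, $w_0=0$ if $m<3$, $w=0$ if $m<2$. For such $\Delta$, $H_\Delta=\{k\in\mathbb{Z}_{n_1}^*:\chi(k)^{w_0}\left(\frac k4\right)^w\prod_j\left(\frac k{p_j}\right)^{w_j}=1\}$, where $\left(\frac kp\right)$ is the Legendre symbol, $\left(\frac k4\right)=\pm1$ according as $k\equiv\pm1\pmod4$, and $\chi(k)=1$ if $k\equiv\pm1\pmod 8$, $-1$ if $k\equiv\pm3\pmod8$; and $g\sim_\Delta h$ iff $g$ is conjugate to $h^k$ for some $k\in H_\Delta$. The walk $\exp(itM)$ is periodic if there exists $t\neq0$ with $\exp(itM)=\gamma I$ for some scalar $\gamma$ (equivalently, periodic at some vertex $a$: $\exp(itM)e_a=\alpha e_a$). *)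

theory Defs
  imports Complex_Main "HOL-Algebra.Group" "HOL-Number_Theory.Number_Theory"
    "HOL-Computational_Algebra.Squarefree"
begin

definition mat_mult :: "'a set \<Rightarrow> ('a \<Rightarrow> 'a \<Rightarrow> complex) \<Rightarrow> ('a \<Rightarrow> 'a \<Rightarrow> complex) \<Rightarrow> ('a \<Rightarrow> 'a \<Rightarrow> complex)"
  where "mat_mult S A B = (\<lambda>a b. \<Sum>c\<in>S. A a c * B c b)"

fun mat_pow :: "'a set \<Rightarrow> ('a \<Rightarrow> 'a \<Rightarrow> complex) \<Rightarrow> nat \<Rightarrow> ('a \<Rightarrow> 'a \<Rightarrow> complex)" where
  "mat_pow S A 0 = (\<lambda>a b. if a = b then 1 else 0)"
| "mat_pow S A (Suc k) = mat_mult S (mat_pow S A k) A"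

definition mat_exp :: "'a set \<Rightarrow> ('a \<Rightarrow> 'a \<Rightarrow> complex) \<Rightarrow> ('a \<Rightarrow> 'a \<Rightarrow> complex)"
  where "mat_exp S A = (\<lambda>a b. \<Sum>k. mat_pow S A k a b / of_nat (fact k))"

definition adj_mat :: "('g, 'b) monoid_scheme \<Rightarrow> 'g set \<Rightarrow> ('g \<Rightarrow> 'g \<Rightarrow> complex)"
  where "adj_mat G C = (\<lambda>a b. if b \<otimes>\<^bsub>G\<^esub> inv\<^bsub>G\<^esub> a \<in> C then 1 else 0)"

definition inv_set :: "('g, 'b) monoid_scheme \<Rightarrow> 'g set \<Rightarrow> 'g set"
  where "inv_set G C = (\<lambda>g. inv\<^bsub>G\<^esub> g) ` C"

definition pow_set :: "('g, 'b) monoid_scheme \<Rightarrow> 'g set \<Rightarrow> nat \<Rightarrow> 'g set"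
  where "pow_set G C k = (\<lambda>g. g [^]\<^bsub>G\<^esub> k) ` C"

definition mixed_cayley_mat :: "('g, 'b) monoid_scheme \<Rightarrow> 'g set \<Rightarrow> 'g set \<Rightarrow> 'g set \<Rightarrow> ('g \<Rightarrow> 'g \<Rightarrow> complex)"
  where "mixed_cayley_mat G Ci C1 Cm1 = (\<lambda>a b.
      \<i> * adj_mat G Ci a b - \<i> * adj_mat G (inv_set G Ci) a b
      + adj_mat G C1 a b - adj_mat G Cm1 a b)"

definition periodic_walk :: "'a set \<Rightarrow> ('a \<Rightarrow> 'a \<Rightarrow> complex) \<Rightarrow> bool"
  where "periodic_walk S M = (\<exists>t::real. t \<noteq> 0 \<and> (\<exists>\<gamma>::complex.
      \<forall>a\<in>S. \<forall>b\<in>S. mat_exp S (\<lambda>x y. \<i> * of_real t * M x y) a b = (if a = b then \<gamma> else 0)))"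

definition grp_exponent :: "('g, 'b) monoid_scheme \<Rightarrow> nat"
  where "grp_exponent G = (LEAST n::nat. 0 < n \<and> (\<forall>g\<in>carrier G. g [^]\<^bsub>G\<^esub> n = \<one>\<^bsub>G\<^esub>))"

definition conj_closed :: "('g, 'b) monoid_scheme \<Rightarrow> 'g set \<Rightarrow> bool"
  where "conj_closed G C = (\<forall>g\<in>C. \<forall>x\<in>carrier G. x \<otimes>\<^bsub>G\<^esub> g \<otimes>\<^bsub>G\<^esub> inv\<^bsub>G\<^esub> x \<in> C)"

definition conjugate :: "('g, 'b) monoid_scheme \<Rightarrow> 'g \<Rightarrow> 'g \<Rightarrow> bool"
  where "conjugate G g h = (\<exists>x\<in>carrier G. g = x \<otimes>\<^bsub>G\<^esub> h \<otimes>\<^bsub>G\<^esub> inv\<^bsub>G\<^esub> x)"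

definition units_mod :: "nat \<Rightarrow> nat set"
  where "units_mod n = {k. k < n \<and> coprime k n}"

definition odd_prime_divs :: "nat \<Rightarrow> nat set"
  where "odd_prime_divs n = {p. prime p \<and> odd p \<and> p dvd n}"

definition pstar :: "nat \<Rightarrow> int"
  where "pstar p = (-1) ^ ((p - 1) div 2) * int p"

text \<open>Delta = 2^w0 (-1)^w prod_{p in S} (p*); S = primes p_k with w_k = 1;
  w0 only if m \<ge> 3, w only if m \<ge> 2, where m = 2-adic valuation of n1\<close>
definition admissible_rep :: "nat \<Rightarrow> int \<Rightarrow> bool \<Rightarrow> bool \<Rightarrow> nat set \<Rightarrow> bool"
  where "admissible_rep n1 \<Delta> w0 w S =
    (S \<subseteq> odd_prime_divs n1
     \<and> (w0 \<longrightarrow> multiplicity 2 n1 \<ge> 3)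
     \<and> (w \<longrightarrow> multiplicity 2 n1 \<ge> 2)
     \<and> \<Delta> = (if w0 then 2 else 1) * (if w then -1 else 1) * (\<Prod>p\<in>S. pstar p))"

definition admissible :: "nat \<Rightarrow> int \<Rightarrow> bool"
  where "admissible n1 \<Delta> = (\<exists>w0 w S. admissible_rep n1 \<Delta> w0 w S)"

definition chi8 :: "nat \<Rightarrow> int"
  where "chi8 k = (if k mod 8 = 1 \<or> k mod 8 = 7 then 1 else -1)"

definition chi4 :: "nat \<Rightarrow> int"
  where "chi4 k = (if k mod 4 = 1 then 1 else -1)"

definition H_set :: "nat \<Rightarrow> int \<Rightarrow> nat set"
  where "H_set n1 \<Delta> = {k \<in> units_mod n1. \<exists>w0 w S. admissible_rep n1 \<Delta> w0 w S \<and>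
      (if w0 then chi8 k else 1) * (if w then chi4 k else 1)
        * (\<Prod>p\<in>S. Legendre (int k) (int p)) = 1}"

definition equiv_Delta :: "('g, 'b) monoid_scheme \<Rightarrow> int \<Rightarrow> 'g \<Rightarrow> 'g \<Rightarrow> bool"
  where "equiv_Delta G \<Delta> g h =
    (\<exists>k\<in>H_set (grp_exponent G) \<Delta>. conjugate G g (h [^]\<^bsub>G\<^esub> k))"

definition union_of_classes :: "('g, 'b) monoid_scheme \<Rightarrow> int \<Rightarrow> 'g set \<Rightarrow> bool"
  where "union_of_classes G \<Delta> C =
    (\<forall>g\<in>carrier G. \<forall>h\<in>carrier G. equiv_Delta G \<Delta> g h \<longrightarrow> (g \<in> C \<longleftrightarrow> h \<in> C))"

end

theory Submission
  imports Defs "HOL-Algebra.Sylow" "Jordan_Normal_Form.Schur_Decomposition"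
begin

text \<open>
  The Hermitian matrix \<open>M\<close> is convolution with a class function \<open>m = \<i> u + v\<close>, where \<open>u\<close> and \<open>v\<close>
  are class functions with values in \<open>{-1, 0, 1}\<close>, and the walk is periodic iff all numbers
  \<open>exp (\<i> t \<theta>)\<close>, \<open>\<theta>\<close> an eigenvalue, coincide for some \<open>t \<noteq> 0\<close>.

  If the walk is periodic, then trace \<open>0\<close> and the integrality of the trace of \<open>M\<^sup>2\<close> force all
  eigenvalues of \<open>\<i> u\<close> and \<open>v\<close> to be integer multiples of one \<open>\<surd>D\<close>. For an integral central element
  \<open>w\<close> of the group ring and a prime \<open>p\<close> not dividing \<open>|G|\<close>, counting cyclic rotations of words
  gives \<open>w\<^sup>p(g\<^sup>p) \<equiv> w(g) (mod p)\<close>; in particular the centre modulo \<open>p\<close> is reduced. When the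
  eigenvalues of \<open>w\<close> lie in \<open>\<int>\<surd>\<Delta>\<close> and its values in \<open>{-1, 0, 1}\<close>, this yields \<open>w(g) = (\<Delta>/p) w(g\<^sup>p)\<close>
  for all such odd \<open>p\<close>, and quadratic reciprocity turns the Legendre symbol into the character
  defining \<open>H\<^sub>\<Delta>\<close>. A non-admissible \<open>\<Delta>\<close> is excluded by some \<open>k \<equiv> 1\<close> modulo the exponent with
  \<open>(\<Delta>/k) = -1\<close>.

  Conversely, if \<open>P\<close> is the spectral projection for \<open>\<theta>\<close>, the trace of \<open>P g\<^sup>k\<close> is a polynomial with
  rational coefficients in \<open>\<zeta>\<^sup>k\<close>, because the multiplicities of the eigenvalues of \<open>g\<close> on the image
  of \<open>P\<close> are integers. The transformation of \<open>u\<close> and \<open>v\<close> under \<open>g \<mapsto> g\<^sup>k\<close> then makes \<open>\<theta> \<theta>'\<close> equal to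
  its average over the units \<open>k\<close>, which is rational by the rationality of Ramanujan sums. Hence all
  eigenvalues are rational multiples of one real number.
\<close>

section \<open>Quadratic characters\<close>

text \<open>Irreducible characters do not occur; central idempotents of the group algebra and their
  traces replace them. Suppose \<open>w\<close> has eigenvalues a sqrt \<Delta> with integral a. The
  p-th power of each is a^p \<Delta>^((p-1)/2) sqrt \<Delta>, which Fermat and Euler turn into
  (\<Delta>/p) times the eigenvalue. So X^p - (\<Delta>/p) X is nilpotent at \<open>w\<close> modulo
  p, hence zero there, and the rotation congruence yields the sign law at p. Since \<open>w\<close>
  takes values in {-1, 0, 1}, the law is an equality for each single odd p; factoring k extends it
  to all odd k prime to |G|, and no primes in arithmetic progressions are needed. The law is wanted
  for \<open>u\<close> and \<open>v\<close> separately, whereas periodicity concerns \<i> u + v. The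
  conjugate function - \<i> u + v has the same real spectrum, and this separates the two parts on
  common eigenvectors. In the converse the obstacle is the factor \<i>, which may lie outside the
  field of the \<open>expo\<close>-th roots of unity. If D and -D are both admissible it lies
  inside; otherwise \<open>u\<close> or \<open>v\<close> vanishes, and \<i> is at most a common
  scalar.\<close>

lemma odd_prime_gt_2: "prime p \<Longrightarrow> odd p \<Longrightarrow> p > (2::nat)"
  by (metis even_numeral nat_less_le prime_ge_2_nat)

lemma Legendre_cong:
  assumes "[a = b] (mod p)"
  shows "Legendre a p = Legendre b p"
proof -
  have "[a = 0] (mod p) \<longleftrightarrow> [b = 0] (mod p)" using assms by (meson cong_sym cong_trans)
  moreover have "QuadRes p a \<longleftrightarrow> QuadRes p b"
    unfolding QuadRes_def using assms by (meson cong_sym cong_trans)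
  ultimately show ?thesis by (simp add: Legendre_def)
qed

lemma Legendre_range: "Legendre a p \<in> {-1, 0, 1}"
  by (simp add: Legendre_def)

lemma Legendre_one: "p > 1 \<Longrightarrow> Legendre 1 (int p) = 1"
  by (auto simp: Legendre_def QuadRes_def cong_def intro: exI[of _ 1])

lemma Legendre_eq_0_iff: "Legendre a (int p) = 0 \<longleftrightarrow> int p dvd a"
  by (simp add: Legendre_def cong_0_iff)

lemma Legendre_pm1: "\<not> int p dvd a \<Longrightarrow> Legendre a (int p) = 1 \<or> Legendre a (int p) = -1"
  by (simp add: Legendre_def cong_0_iff)

text \<open>Two elements of {-1, 0, 1} differ by at most 2. Through this bound Euler's criterion and
  the Frobenius congruence become equalities.\<close>

lemma small_cong_imp_eq:
  assumes "[x = y] (mod int p)" "p > 2" "x \<in> {-1, 0, 1}" "y \<in> {-1, 0, 1}"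
  shows "x = (y::int)"
proof -
  have "int p dvd x - y" using assms(1) by (simp add: cong_iff_dvd_diff)
  moreover have "\<bar>x - y\<bar> < int p" using assms(2-4) by auto
  ultimately show ?thesis using dvd_imp_le_int[of "x - y" "int p"] by force
qed

lemma Legendre_mult:
  assumes "prime p" "odd p"
  shows "Legendre (a * b) (int p) = Legendre a (int p) * Legendre b (int p)"
proof (rule small_cong_imp_eq)
  have p: "p > 2" using assms odd_prime_gt_2 by blast
  note e = euler_criterion[OF assms(1) p]
  have "[Legendre a (int p) * Legendre b (int p) = a ^ ((p - 1) div 2) * b ^ ((p - 1) div 2)] (mod int p)"
    by (intro cong_mult e)
  then show "[Legendre (a * b) (int p) = Legendre a (int p) * Legendre b (int p)] (mod int p)"
    using e[of "a * b"] unfolding power_mult_distrib by (meson cong_sym cong_trans)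
  show "Legendre a (int p) * Legendre b (int p) \<in> {- 1, 0, 1}"
    using Legendre_range[of a "int p"] Legendre_range[of b "int p"] by auto
qed (use assms odd_prime_gt_2 Legendre_range in auto)

lemma Legendre_prod:
  assumes "prime p" "odd p"
  shows "Legendre (\<Prod>i\<in>I. f i) (int p) = (\<Prod>i\<in>I. Legendre (f i) (int p))"
  by (induction I rule: infinite_finite_induct)
    (use assms prime_gt_1_nat in \<open>auto simp: Legendre_mult Legendre_one\<close>)

lemma Legendre_minus_one:
  assumes "prime p" "odd p"
  shows "Legendre (-1) (int p) = (-1) ^ ((p - 1) div 2)"
proof (rule small_cong_imp_eq)
  show "[Legendre (-1) (int p) = (-1) ^ ((p - 1) div 2)] (mod int p)"
    using euler_criterion[OF assms(1) odd_prime_gt_2[OF assms]] .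
qed (use assms odd_prime_gt_2 Legendre_range in \<open>auto simp: minus_one_power_iff\<close>)

lemma chi4_eq:
  assumes "odd p"
  shows "chi4 p = (-1) ^ ((p - 1) div 2)"
proof -
  have "p mod 4 = 1 \<longleftrightarrow> even ((p - 1) div 2)" using assms by presburger
  then show ?thesis by (simp add: chi4_def minus_one_power_iff)
qed

text \<open>Gauss's lemma for the multiplier 2: the symbol is the parity of the number of doubles
  2x, x at most h = (p-1)/2, that exceed h.\<close>

lemma Legendre_two:
  assumes "prime p" "odd p"
  shows "Legendre 2 (int p) = chi8 p"
proof -
  have p: "p > 2" using assms odd_prime_gt_2 by blast
  have "\<not> int p dvd 2" using p by (auto dest: zdvd_imp_le)
  then interpret GAUSS p 2
    by unfold_locales (use assms p in \<open>auto simp: cong_0_iff\<close>)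
  define h where "h = (p - 1) div 2"
  have ph: "int p = 2 * int h + 1" using assms p unfolding h_def by (auto elim: oddE)
  have hi: "(int p - 1) div 2 = int h" using ph by simp
  \<comment> \<open>The doubles are at most 2h = p - 1, hence already reduced modulo p; those above
    h come from x > h div 2.\<close>
  have "C = (\<lambda>x. x * 2) ` {0<..int h}"
  proof -
    have "C = (\<lambda>x. (x * 2) mod int p) ` {0<..int h}"
      by (simp add: C_def B_def A_def hi image_image)
    also have "\<dots> = (\<lambda>x. x * 2) ` {0<..int h}"
      by (rule image_cong[OF refl]) (use ph in auto)
    finally show ?thesis .
  qed
  then have "E = (\<lambda>x. x * 2) ` {int (h div 2)<..int h}"
    unfolding E_def hi by (auto simp: image_def)
  then have "card E = h - h div 2"
    by (simp add: card_image inj_on_def)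
  moreover have "even (h - h div 2) \<longleftrightarrow> p mod 8 = 1 \<or> p mod 8 = 7"
  proof -
    obtain a r where hr: "h = 4 * a + r" "r < 4"
      by (metis div_mult_mod_eq mod_less_divisor mult.commute zero_less_numeral)
    have "p = 8 * a + 2 * r + 1" using ph hr(1) by linarith
    moreover have "r = 0 \<or> r = 1 \<or> r = 2 \<or> r = 3" using hr(2) by linarith
    moreover have "h div 2 = 2 * a + r div 2" unfolding hr(1) by linarith
    ultimately show ?thesis using hr(1) by auto
  qed
  ultimately show ?thesis
    using gauss_lemma by (simp add: chi8_def minus_one_power_iff)
qed

text \<open>Otherwise squaring would be onto, hence injective, on the nonzero residues, although 1
  and p - 1 have the same square.\<close>

lemma exists_nonresidue:
  assumes "prime p" "odd p"
  shows "\<exists>r::nat. Legendre (int r) (int p) = -1"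
proof (rule ccontr)
  assume no: "\<not> ?thesis"
  have p: "p > 2" using assms odd_prime_gt_2 by blast
  let ?U = "{1..<int p}" and ?s = "\<lambda>x. x\<^sup>2 mod int p"
  have "?U \<subseteq> ?s ` ?U"
  proof
    fix y assume y: "y \<in> ?U"
    then have nd: "\<not> int p dvd y" by (auto dest: zdvd_imp_le)
    then have "Legendre y (int p) = 1"
      using no Legendre_pm1[OF nd] y by (metis atLeastLessThan_iff int_nat_eq order_trans zero_le_one)
    then obtain z where z: "[z\<^sup>2 = y] (mod int p)"
      using nd by (auto simp: Legendre_def QuadRes_def split: if_splits)
    have "(z mod int p)\<^sup>2 mod int p = y" using z y by (simp add: power_mod cong_def)
    moreover have "z mod int p \<noteq> 0" using calculation y by force
    ultimately show "y \<in> ?s ` ?U"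
      using p pos_mod_bound[of "int p" z] pos_mod_sign[of "int p" z]
      by (intro image_eqI[of _ _ "z mod int p"]) (simp, simp del: pos_mod_sign pos_mod_bound)
  qed
  then have "card ?U \<le> card (?s ` ?U)" by (intro card_mono) auto
  then have "inj_on ?s ?U"
    by (intro eq_card_imp_inj_on) (use card_image_le[of ?U ?s] in auto)
  moreover have "?s 1 = ?s (int p - 1)"
  proof -
    have "(int p - 1)\<^sup>2 = 1 + int p * (int p - 2)" by (simp add: power2_eq_square algebra_simps)
    then show ?thesis by simp
  qed
  ultimately have "1 = int p - 1" by (rule inj_onD) (use p in auto)
  then show False using p by simp
qed

section \<open>The quadratic character attached to a discriminant\<close>

definition sgn_char :: "bool \<Rightarrow> bool \<Rightarrow> nat set \<Rightarrow> nat \<Rightarrow> int"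
  where "sgn_char w0 w S k = (if w0 then chi8 k else 1) * (if w then chi4 k else 1)
        * (\<Prod>p\<in>S. Legendre (int k) (int p))"

text \<open>\<open>sgn_char\<close> and \<open>disc_rep\<close> take as parameters the data that
  \<open>admissible\<close> and \<open>H_set\<close> quantify existentially, so that reciprocity and
  uniqueness can be stated without a modulus.\<close>

definition disc_rep :: "bool \<Rightarrow> bool \<Rightarrow> nat set \<Rightarrow> int"
  where "disc_rep w0 w S = (if w0 then 2 else 1) * (if w then -1 else 1) * (\<Prod>p\<in>S. pstar p)"

definition odd_primes :: "nat set \<Rightarrow> bool"
  where "odd_primes S \<longleftrightarrow> finite S \<and> (\<forall>p\<in>S. prime p \<and> odd p)"

lemma odd_mod_8: "odd (k::nat) \<Longrightarrow> k mod 8 \<in> {1, 3, 5, 7}"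
proof -
  assume "odd k"
  then have o: "odd (k mod 8)" by (simp add: dvd_mod_iff)
  have "x = 0 \<or> x = 1 \<or> x = 2 \<or> x = 3 \<or> x = 4 \<or> x = 5 \<or> x = 6 \<or> x = 7" if "x < 8" for x :: nat
    using that by linarith
  from this[of "k mod 8"] have "k mod 8 = 0 \<or> k mod 8 \<in> {1, 3, 5, 7} \<or> k mod 8 \<in> {2, 4, 6}" by auto
  with o show ?thesis by (auto dest: sym)
qed

lemma odd_mod_4: "odd (k::nat) \<Longrightarrow> k mod 4 \<in> {1, 3}"
proof -
  assume "odd k"
  then have o: "odd (k mod 4)" by (simp add: dvd_mod_iff)
  have "x = 0 \<or> x = 1 \<or> x = 2 \<or> x = 3" if "x < 4" for x :: nat
    using that by linarith
  from this[of "k mod 4"] have "k mod 4 = 0 \<or> k mod 4 \<in> {1, 3} \<or> k mod 4 \<in> {2}" by auto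
  with o show ?thesis by (auto dest: sym)
qed

lemma chi8_mult: "odd k \<Longrightarrow> odd l \<Longrightarrow> chi8 (k * l) = chi8 k * chi8 l"
proof -
  assume "odd k" "odd l"
  then have "k mod 8 \<in> {1, 3, 5, 7}" "l mod 8 \<in> {1, 3, 5, 7}" by (metis odd_mod_8)+
  moreover have "(k * l) mod 8 = ((k mod 8) * (l mod 8)) mod 8" by (simp add: mod_mult_eq)
  ultimately show ?thesis unfolding chi8_def by auto
qed

lemma chi4_mult: "odd k \<Longrightarrow> odd l \<Longrightarrow> chi4 (k * l) = chi4 k * chi4 l"
proof -
  assume "odd k" "odd l"
  then have "k mod 4 \<in> {1, 3}" "l mod 4 \<in> {1, 3}" by (metis odd_mod_4)+
  moreover have "(k * l) mod 4 = ((k mod 4) * (l mod 4)) mod 4" by (simp add: mod_mult_eq)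
  ultimately show ?thesis unfolding chi4_def by auto
qed

text \<open>\<open>chi8\<close> and \<open>chi4\<close> are -1 at every even argument, so
  multiplicativity is claimed only for odd ones once either factor is present.\<close>

lemma sgn_char_mult:
  assumes "odd_primes S" "w0 \<or> w \<Longrightarrow> odd k \<and> odd l"
  shows "sgn_char w0 w S (k * l) = sgn_char w0 w S k * sgn_char w0 w S l"
proof -
  have "(\<Prod>p\<in>S. Legendre (int (k * l)) (int p))
      = (\<Prod>p\<in>S. Legendre (int k) (int p)) * (\<Prod>p\<in>S. Legendre (int l) (int p))"
    using assms(1) unfolding prod.distrib[symmetric] odd_primes_def
    by (intro prod.cong refl) (auto simp: Legendre_mult)
  then show ?thesis
    using assms(2) by (auto simp: sgn_char_def chi8_mult chi4_mult)
qed

lemma sgn_char_pm1: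
  assumes "\<And>p. p \<in> S \<Longrightarrow> \<not> p dvd k"
  shows "sgn_char w0 w S k = 1 \<or> sgn_char w0 w S k = -1"
proof -
  have "(\<Prod>p\<in>S. Legendre (int k) (int p)) = 1 \<or> (\<Prod>p\<in>S. Legendre (int k) (int p)) = -1"
    using assms
  proof (induction S rule: infinite_finite_induct)
    case (insert p S)
    have "Legendre (int k) (int p) = 1 \<or> Legendre (int k) (int p) = -1"
      using insert.prems[of p] by (intro Legendre_pm1) auto
    then show ?case using insert by auto
  qed auto
  then show ?thesis by (auto simp: sgn_char_def chi8_def chi4_def)
qed

text \<open>The sign in \<open>pstar p\<close> is the one that cancels the sign of the reciprocity
  law.\<close>

lemma Legendre_pstar:
  assumes p: "prime p" "odd p" and q: "prime q" "odd q" and "p \<noteq> q"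
  shows "Legendre (pstar p) (int q) = Legendre (int q) (int p)"
proof -
  have gt: "p > 2" "q > 2" using p q odd_prime_gt_2 by auto
  let ?e = "(p - 1) div 2" and ?f = "(q - 1) div 2"
  have pw: "Legendre ((-1) ^ n) (int q) = (-1) ^ (n * ?f)" for n
  proof (induction n)
    case 0
    then show ?case using prime_gt_1_nat[OF q(1)] by (simp add: Legendre_one)
  next
    case (Suc n)
    have "Legendre ((-1) ^ Suc n) (int q) = Legendre (-1) (int q) * Legendre ((-1) ^ n) (int q)"
      unfolding power_Suc by (rule Legendre_mult[OF q])
    then show ?case using Suc by (simp only: Legendre_minus_one[OF q] mult_Suc power_add)
  qed
  have nd: "\<not> int p dvd int q" using p q \<open>p \<noteq> q\<close> primes_dvd_imp_eq by auto
  have "Legendre (pstar p) (int q) = (-1) ^ (?e * ?f) * Legendre (int p) (int q)"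
    unfolding pstar_def by (simp add: Legendre_mult[OF q] pw)
  also have "\<dots> = Legendre (int p) (int q) * Legendre (int p) (int q) * Legendre (int q) (int p)"
    using Quadratic_Reciprocity[OF p(1) gt(1) q(1) gt(2) \<open>p \<noteq> q\<close>] by (simp add: mult_ac)
  also have "Legendre (int p) (int q) * Legendre (int p) (int q) = 1"
  proof -
    have "\<not> int q dvd int p" using p q \<open>p \<noteq> q\<close> primes_dvd_imp_eq by auto
    then show ?thesis using Legendre_pm1[of q "int p"] by auto
  qed
  finally show ?thesis by simp
qed

text \<open>Turns the symbol modulo a variable prime q, which the Frobenius congruence produces,
  into a function of q modulo fixed numbers: reciprocity for the primes in \<open>S\<close>, the two
  supplements for 2 and -1.\<close>

lemma Legendre_disc_rep:
  assumes S: "odd_primes S" and q: "prime q" "odd q" "q \<notin> S"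
  shows "Legendre (disc_rep w0 w S) (int q) = sgn_char w0 w S q"
proof -
  have "Legendre (\<Prod>p\<in>S. pstar p) (int q) = (\<Prod>p\<in>S. Legendre (int q) (int p))"
    unfolding Legendre_prod[OF q(1,2)]
  proof (rule prod.cong[OF refl])
    fix p assume "p \<in> S"
    then show "Legendre (pstar p) (int q) = Legendre (int q) (int p)"
      using S q by (intro Legendre_pstar) (auto simp: odd_primes_def)
  qed
  then show ?thesis
    using q prime_gt_1_nat[OF q(1)] unfolding disc_rep_def sgn_char_def
    by (auto simp: Legendre_mult[OF q(1,2)] Legendre_two Legendre_minus_one Legendre_one chi4_eq
        simp flip: Legendre_mult[OF q(1,2), of "-1"])
qed

lemma abs_prod_pstar: "\<bar>\<Prod>p\<in>S. pstar p\<bar> = int (\<Prod>S)"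
  unfolding abs_prod by (simp add: pstar_def abs_mult power_abs)

lemma abs_disc_rep: "\<bar>disc_rep w0 w S\<bar> = int ((if w0 then 2 else 1) * \<Prod>S)"
  by (auto simp: disc_rep_def abs_mult abs_prod_pstar)

lemma prime_dvd_disc_rep:
  assumes "odd_primes S" "prime q"
  shows "int q dvd disc_rep w0 w S \<longleftrightarrow> (w0 \<and> q = 2) \<or> q \<in> S"
proof -
  have "int q dvd disc_rep w0 w S \<longleftrightarrow> q dvd (if w0 then 2 else 1) * \<Prod>S"
    by (metis abs_disc_rep dvd_abs_iff int_dvd_int_iff)
  also have "\<dots> \<longleftrightarrow> (w0 \<and> q = 2) \<or> (\<exists>p\<in>S. q dvd p)"
    using assms by (auto simp: prime_dvd_mult_iff prime_dvd_prod_iff odd_primes_def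
        two_is_prime_nat primes_dvd_imp_eq)
  also have "(\<exists>p\<in>S. q dvd p) \<longleftrightarrow> q \<in> S"
    using assms unfolding odd_primes_def by (metis dvd_refl primes_dvd_imp_eq)
  finally show ?thesis .
qed

lemma disc_rep_nonzero: "odd_primes S \<Longrightarrow> disc_rep w0 w S \<noteq> 0"
  by (auto simp: disc_rep_def odd_primes_def pstar_def)

text \<open>\<open>S\<close> and \<open>w0\<close> are read off the prime divisors, \<open>w\<close>
  off the sign. Thus the existential quantifier in \<open>H_set\<close> leaves no choice.\<close>

lemma disc_rep_unique:
  assumes "odd_primes S" "odd_primes S'" and eq: "disc_rep w0 w S = disc_rep w0' w' S'"
  shows "w0 = w0' \<and> w = w' \<and> S = S'"
proof -
  have "q \<in> S \<longleftrightarrow> q \<in> S'" for q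
  proof (cases "prime q \<and> odd q")
    case True
    then show ?thesis
      using prime_dvd_disc_rep[OF assms(1), of q w0 w] prime_dvd_disc_rep[OF assms(2), of q w0' w'] eq
      by auto
  qed (use assms in \<open>auto simp: odd_primes_def\<close>)
  then have S: "S = S'" by blast
  have "2 \<notin> S" "2 \<notin> S'" using assms by (auto simp: odd_primes_def)
  then have w0: "w0 = w0'"
    using prime_dvd_disc_rep[OF assms(1) two_is_prime_nat, of w0 w]
      prime_dvd_disc_rep[OF assms(2) two_is_prime_nat, of w0' w'] eq by auto
  have "w = w'"
    using eq disc_rep_nonzero[OF assms(1), of w0 True] disc_rep_nonzero[OF assms(1), of w0 False]
    unfolding S[symmetric] w0[symmetric]
    by (auto simp: disc_rep_def split: if_splits)
  with S w0 show ?thesis by simp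
qed

lemma squarefree_eq_prod_prime_factors:
  assumes "squarefree (n::nat)"
  shows "n = \<Prod>(prime_factors n)"
proof -
  have n: "n > 0" using assms by (metis gr0I not_squarefree_0)
  have "multiplicity p n = 1" if "p \<in> prime_factors n" for p
  proof -
    have "prime p" "p dvd n" using that by (auto simp: in_prime_factors_iff)
    then have "multiplicity p n > 0" using n by (simp add: prime_multiplicity_gt_zero_iff)
    moreover have "multiplicity p n \<le> 1"
      using assms n \<open>prime p\<close> by (simp add: squarefree_factorial_semiring'')
    ultimately show ?thesis by simp
  qed
  then have "(\<Prod>p\<in>prime_factors n. p ^ multiplicity p n) = \<Prod>(prime_factors n)" by simp
  then show ?thesis using prime_factorization_nat[OF n] by simp
qed

text \<open>The absolute value determines \<open>w0\<close> and \<open>S\<close>; this already fixes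
  the sign of the product of the \<open>pstar p\<close>, and \<open>w\<close> corrects it where
  necessary.\<close>

lemma squarefree_disc_rep:
  assumes "squarefree (\<Delta>::int)"
  obtains w0 w S where "odd_primes S" "\<Delta> = disc_rep w0 w S"
proof -
  define n where "n = nat \<bar>\<Delta>\<bar>"
  have nz: "\<Delta> \<noteq> 0" using assms by auto
  have n: "squarefree n"
  proof (rule squarefreeI)
    fix x assume "x\<^sup>2 dvd n"
    then have "int x ^ 2 dvd \<Delta>" unfolding n_def by (metis dvd_abs_iff int_dvd_int_iff int_nat_eq abs_ge_zero of_nat_power)
    then have "int x dvd 1" using assms squarefreeD by blast
    then show "x dvd 1" by simp
  qed
  define S where "S = prime_factors n - {2}"
  have S: "odd_primes S"
    unfolding odd_primes_def S_def
    by (auto simp: in_prime_factors_iff) (metis dvd_mult2 even_mult_iff primes_dvd_imp_eq two_is_prime_nat)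
  have np: "n = (if 2 \<in> prime_factors n then 2 else 1) * \<Prod>S"
  proof (cases "2 \<in> prime_factors n")
    case True
    have "n = \<Prod>(prime_factors n)" by (rule squarefree_eq_prod_prime_factors[OF n])
    also have "\<dots> = 2 * \<Prod>S" unfolding S_def using True by (intro prod.remove) auto
    finally show ?thesis using True by simp
  next
    case False
    then have "S = prime_factors n" by (auto simp: S_def)
    then show ?thesis using squarefree_eq_prod_prime_factors[OF n] False by simp
  qed
  have "\<bar>\<Delta>\<bar> = int n" by (simp add: n_def)
  then have ab: "\<bar>\<Delta>\<bar> = \<bar>disc_rep (2 \<in> prime_factors n) False S\<bar>"
    using np by (simp only: abs_disc_rep)
  have mi: "disc_rep (2 \<in> prime_factors n) True S = - disc_rep (2 \<in> prime_factors n) False S"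
    by (simp add: disc_rep_def)
  from ab have "\<Delta> = disc_rep (2 \<in> prime_factors n) False S \<or> \<Delta> = disc_rep (2 \<in> prime_factors n) True S"
    unfolding mi by linarith
  with S that show thesis by blast
qed

lemma odd_prime_divs_odd_primes: "n > 0 \<Longrightarrow> S \<subseteq> odd_prime_divs n \<Longrightarrow> odd_primes S"
proof -
  assume n: "n > 0" and S: "S \<subseteq> odd_prime_divs n"
  have "odd_prime_divs n \<subseteq> {..n}" using n by (auto simp: odd_prime_divs_def dvd_imp_le)
  then have "finite S" using finite_subset[OF subset_trans[OF S]] by simp
  then show ?thesis using S by (auto simp: odd_primes_def odd_prime_divs_def)
qed

lemma admissible_rep_iff:
  assumes "n > 0"
  shows "admissible_rep n \<Delta> w0 w S \<longleftrightarrow> S \<subseteq> odd_prime_divs n \<and> (w0 \<longrightarrow> 8 dvd n) \<and> (w \<longrightarrow> 4 dvd n)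
    \<and> \<Delta> = disc_rep w0 w S"
proof -
  have "multiplicity 2 n \<ge> k \<longleftrightarrow> 2 ^ k dvd n" for k
    using assms by (simp add: power_dvd_iff_le_multiplicity)
  from this[of 3] this[of 2] show ?thesis
    using assms by (simp add: admissible_rep_def disc_rep_def)
qed

lemma H_set_eq:
  assumes "n > 0" "admissible_rep n \<Delta> w0 w S"
  shows "H_set n \<Delta> = {k \<in> units_mod n. sgn_char w0 w S k = 1}"
proof -
  have "w0' = w0 \<and> w' = w \<and> S' = S" if "admissible_rep n \<Delta> w0' w' S'" for w0' w' S'
    using that assms disc_rep_unique odd_prime_divs_odd_primes by (metis admissible_rep_iff)
  then show ?thesis
    using assms unfolding H_set_def sgn_char_def[symmetric] by blast
qed

text \<open>Admissibility makes 8, 4 and the primes of \<open>S\<close> divide n wherever they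
  occur, so each factor of the character has a period dividing n.\<close>

lemma sgn_char_cong:
  assumes "n > 0" "admissible_rep n \<Delta> w0 w S" "[k = l] (mod n)"
  shows "sgn_char w0 w S k = sgn_char w0 w S l"
proof -
  have a: "S \<subseteq> odd_prime_divs n" "w0 \<longrightarrow> 8 dvd n" "w \<longrightarrow> 4 dvd n"
    using assms by (auto simp: admissible_rep_iff)
  have "Legendre (int k) (int p) = Legendre (int l) (int p)" if "p \<in> S" for p
  proof -
    have "p dvd n" using that a by (auto simp: odd_prime_divs_def)
    then have "[k = l] (mod p)" using assms(3) cong_dvd_modulus_nat by blast
    then show ?thesis by (intro Legendre_cong) (simp add: cong_int_iff)
  qed
  moreover have "w0 \<longrightarrow> k mod 8 = l mod 8" "w \<longrightarrow> k mod 4 = l mod 4"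
    using a assms(3) cong_dvd_modulus_nat unfolding cong_def[symmetric] by blast+
  ultimately show ?thesis unfolding sgn_char_def chi8_def chi4_def by auto
qed

text \<open>At -1, \<open>chi8\<close> is 1, \<open>chi4\<close> is -1, and each Legendre symbol is
  the sign of \<open>pstar p\<close>. For a negative discriminant this makes inversion in G a power
  map of sign -1.\<close>

lemma sgn_char_minus_one:
  assumes n: "n > 0" "admissible_rep n \<Delta> w0 w S"
  shows "sgn_char w0 w S (n - 1) = sgn \<Delta>"
proof -
  have a: "S \<subseteq> odd_prime_divs n" "w0 \<longrightarrow> 8 dvd n" "w \<longrightarrow> 4 dvd n" "\<Delta> = disc_rep w0 w S"
    using assms by (auto simp: admissible_rep_iff)
  have pred_mod: "(n - 1) mod d = d - 1" if "d dvd n" "d > 0" for d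
  proof -
    from that n(1) obtain c where "n = d * Suc c" by (metis dvdE gr0_conv_Suc nat_0_less_mult_iff)
    then have "n - 1 = d - 1 + d * c" using \<open>d > 0\<close> by simp
    then have "(n - 1) mod d = (d - 1) mod d" by (simp only: mod_mult_self2)
    then show ?thesis using \<open>d > 0\<close> by simp
  qed
  have "w0 \<longrightarrow> chi8 (n - 1) = 1"
    using a(2) pred_mod[of 8] by (simp add: chi8_def)
  moreover have "w \<longrightarrow> chi4 (n - 1) = -1"
    using a(3) pred_mod[of 4] by (simp add: chi4_def)
  moreover have "(\<Prod>p\<in>S. Legendre (int (n - 1)) (int p)) = (\<Prod>p\<in>S. sgn (pstar p))"
  proof (rule prod.cong[OF refl])
    fix p assume "p \<in> S"
    then have p: "prime p" "odd p" "p dvd n" using a by (auto simp: odd_prime_divs_def)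
    have "[int (n - 1) = -1] (mod int p)"
      using p n(1) by (simp add: cong_iff_dvd_diff of_nat_diff)
    then have "Legendre (int (n - 1)) (int p) = Legendre (-1) (int p)" by (rule Legendre_cong)
    also have "\<dots> = sgn (pstar p)"
      using p prime_gt_0_nat[OF p(1)] by (simp add: Legendre_minus_one pstar_def sgn_mult minus_one_power_iff)
    finally show "Legendre (int (n - 1)) (int p) = sgn (pstar p)" .
  qed
  moreover have "sgn (\<Prod>p\<in>S. pstar p) = (\<Prod>p\<in>S. sgn (pstar p))"
    by (induction S rule: infinite_finite_induct) (simp_all add: sgn_mult)
  ultimately show ?thesis
    by (auto simp: sgn_char_def a(4) disc_rep_def sgn_mult)
qed

section \<open>Units on which the character is -1\<close>

lemma crt_exists_nat:
  assumes "coprime a b"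
  obtains k :: nat where "[k = x] (mod a)" "[k = y] (mod b)"
  using binary_chinese_remainder_nat[OF assms] by blast

lemma two_part_decomp:
  assumes "(n::nat) > 0"
  obtains m n' where "n = 2 ^ m * n'" "odd n'"
  using assms by (metis multiplicity_decompose' not_prime_unit prime_imp_prime_elem two_is_prime_nat
      bot_nat_0.not_eq_extremum)

lemma sgn_char_eq_one_if:
  assumes "\<And>p. p \<in> S \<Longrightarrow> prime p \<and> [k = 1] (mod p)"
  shows "(\<Prod>p\<in>S. Legendre (int k) (int p)) = 1"
proof (rule prod.neutral, rule ballI)
  fix p assume "p \<in> S"
  then have "prime p" "[int k = 1] (mod int p)" using assms by (auto simp: cong_int_iff[symmetric])
  then show "Legendre (int k) (int p) = 1"
    using Legendre_cong Legendre_one prime_gt_1_nat by metis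
qed

lemma sgn_char_one: "odd_primes S \<Longrightarrow> sgn_char w0 v S 1 = 1"
  using sgn_char_eq_one_if[of S 1] by (auto simp: sgn_char_def chi8_def chi4_def odd_primes_def)

text \<open>A nonresidue modulo one prime of \<open>S\<close>, made 1 modulo the rest of n by the
  Chinese remainder theorem, isolates one factor; if \<open>S\<close> is empty, the 2-part of n is
  used.\<close>

lemma exists_sgn_char_minus_one:
  assumes n: "n > 0" and adm: "admissible_rep n \<Delta> w0 w S" and "\<Delta> \<noteq> 1"
  shows "\<exists>k\<in>units_mod n. sgn_char w0 w S k = -1"
proof -
  have a: "S \<subseteq> odd_prime_divs n" "w0 \<longrightarrow> 8 dvd n" "w \<longrightarrow> 4 dvd n" "\<Delta> = disc_rep w0 w S"
    using assms by (auto simp: admissible_rep_iff)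
  have fin: "finite S" using odd_prime_divs_odd_primes[OF n a(1)] by (simp add: odd_primes_def)
  have "\<exists>k. coprime k n \<and> sgn_char w0 w S k = -1"
  proof (cases "S = {}")
    case False
    then obtain p where p: "p \<in> S" by auto
    then have pp: "prime p" "odd p" "p dvd n" using a by (auto simp: odd_prime_divs_def)
    obtain r :: nat where r: "Legendre (int r) (int p) = -1" using exists_nonresidue pp by blast
    obtain n' where n': "n = p ^ multiplicity p n * n'" "\<not> p dvd n'"
      using multiplicity_decompose'[of n p] n pp by (metis not_prime_unit neq0_conv)
    have cop: "coprime (p ^ multiplicity p n) n'"
      using n'(2) pp by (simp add: prime_imp_coprime)
    obtain k where k: "[k = r] (mod p ^ multiplicity p n)" "[k = 1] (mod n')"
      using crt_exists_nat[OF cop] .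
    have "multiplicity p n > 0" using pp n by (simp add: prime_multiplicity_gt_zero_iff)
    then have kp: "[k = r] (mod p)" using k(1) by (meson cong_dvd_modulus_nat dvd_power)
    have "\<not> int p dvd int k"
    proof -
      have "\<not> int p dvd int r" using r by (metis Legendre_eq_0_iff zero_neq_neg_one)
      then show ?thesis using kp by (simp add: cong_dvd_iff)
    qed
    then have c1: "coprime k (p ^ multiplicity p n)"
      using pp by (metis coprime_commute coprime_power_left_iff int_dvd_int_iff prime_imp_coprime)
    have c2: "coprime k n'" using k(2) by (metis cong_imp_coprime cong_sym coprime_1_left)
    have "coprime k n" using c1 c2 n'(1) by (metis coprime_mult_right_iff)
    moreover have "sgn_char w0 w S k = -1"
    proof -
      have dvd': "q dvd n'" if "q dvd n" "coprime q p" for q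
        using that n'(1) by (metis coprime_dvd_mult_right_iff coprime_power_right_iff)
      have "w0 \<longrightarrow> k mod 8 = 1"
      proof
        assume w0
        have "coprime (8::nat) p" using pp coprime_power_left_iff[of "2::nat" 3 p] by simp
        then have "8 dvd n'" using dvd' a(2) \<open>w0\<close> by blast
        then have "[k = 1] (mod 8)" using k(2) cong_dvd_modulus_nat by blast
        then show "k mod 8 = 1" by (simp add: cong_def)
      qed
      moreover have "w \<longrightarrow> k mod 4 = 1"
      proof
        assume w
        have "coprime (4::nat) p" using pp coprime_power_left_iff[of "2::nat" 2 p] by simp
        then have "4 dvd n'" using dvd' a(3) \<open>w\<close> by blast
        then have "[k = 1] (mod 4)" using k(2) cong_dvd_modulus_nat by blast
        then show "k mod 4 = 1" by (simp add: cong_def)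
      qed
      moreover have "(\<Prod>q\<in>S - {p}. Legendre (int k) (int q)) = 1"
      proof (rule sgn_char_eq_one_if)
        fix q assume q: "q \<in> S - {p}"
        then have q': "prime q" "q dvd n" using a by (auto simp: odd_prime_divs_def)
        then have "q dvd n'" using dvd' q pp by (metis DiffE insertI1 primes_coprime)
        then show "prime q \<and> [k = 1] (mod q)" using q' k(2) cong_dvd_modulus_nat by blast
      qed
      moreover have "Legendre (int k) (int p) = -1"
        using kp r Legendre_cong cong_int_iff by metis
      ultimately show ?thesis
        using prod.remove[OF fin p, of "\<lambda>q. Legendre (int k) (int q)"]
        by (auto simp: sgn_char_def chi8_def chi4_def)
    qed
    ultimately show ?thesis by blast
  next
    case True
    with \<open>\<Delta> \<noteq> 1\<close> have w: "w0 \<or> w" unfolding a(4) by (auto simp: disc_rep_def split: if_splits)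
    obtain m n' where mn: "n = 2 ^ m * n'" "odd n'" using two_part_decomp[OF n] .
    have cop: "coprime (2 ^ m) n'" using mn(2) by simp
    \<comment> \<open>5 has \<open>chi8\<close> = -1 and \<open>chi4\<close> = 1, so it works
      whether or not \<open>w\<close> holds; 3 has \<open>chi4\<close> = -1 and serves when only
      \<open>w\<close> holds.\<close>
    define r :: nat where "r = (if w0 then 5 else 3)"
    obtain k where k: "[k = r] (mod 2 ^ m)" "[k = 1] (mod n')"
      using crt_exists_nat[OF cop] .
    have m2: "m \<ge> 2"
    proof (rule ccontr)
      assume "\<not> m \<ge> 2"
      then have "2 ^ m = (1::nat) \<or> 2 ^ m = (2::nat)" by (auto simp: not_le less_2_cases_iff)
      moreover have "4 dvd n" using w a(2,3) by auto
      ultimately show False using mn by presburger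
    qed
    then have k4: "[k = r] (mod 4)" using k(1) le_imp_power_dvd[of 2 m "2::nat"] cong_dvd_modulus_nat by fastforce
    have k8: "w0 \<Longrightarrow> [k = r] (mod 8)"
    proof -
      assume w0
      have "m \<ge> 3"
      proof (rule ccontr)
        assume "\<not> m \<ge> 3"
        then have "m = 2" using m2 by linarith
        then have "2 ^ m = (4::nat)" by simp
        moreover have "8 dvd n" using \<open>w0\<close> a(2) by auto
        ultimately show False using mn by presburger
      qed
      then show ?thesis using k(1) le_imp_power_dvd[of 3 m "2::nat"] cong_dvd_modulus_nat by fastforce
    qed
    have "odd k" using k4 unfolding r_def cong_def by (auto split: if_splits) presburger+
    then have "coprime k (2 ^ m)" by simp
    moreover have "coprime k n'" using k(2) by (metis cong_imp_coprime cong_sym coprime_1_left)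
    ultimately have "coprime k n" using mn(1) by simp
    moreover have "sgn_char w0 w S k = -1"
      using k4 k8 w True unfolding sgn_char_def chi8_def chi4_def r_def cong_def by auto
    ultimately show ?thesis by blast
  qed
  then obtain k where k: "coprime k n" "sgn_char w0 w S k = -1" by blast
  have "k mod n \<in> units_mod n" using k(1) n by (simp add: units_mod_def)
  moreover have "sgn_char w0 w S (k mod n) = -1"
    using sgn_char_cong[OF n adm, of "k mod n" k] k(2) by (simp add: cong_def)
  ultimately show ?thesis by blast
qed

lemma units_mod_mult: "n > 0 \<Longrightarrow> k \<in> units_mod n \<Longrightarrow> l \<in> units_mod n \<Longrightarrow> k * l mod n \<in> units_mod n"
  by (simp add: units_mod_def)

lemma admissible_unit_odd:
  assumes "n > 0" "admissible_rep n \<Delta> w0 w S" "w0 \<or> w" "coprime k n"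
  shows "odd k"
proof
  assume "even k"
  moreover have "even n" using assms(1-3) by (auto simp: admissible_rep_iff elim: dvd_trans[rotated])
  ultimately show False using assms(4) by (metis coprime_common_divisor odd_one)
qed

lemma sgn_char_unit_pm1:
  assumes "n > 0" "admissible_rep n \<Delta> w0 w S" "k \<in> units_mod n"
  shows "sgn_char w0 w S k = 1 \<or> sgn_char w0 w S k = -1"
proof (rule sgn_char_pm1)
  fix p assume "p \<in> S"
  then have "prime p" "p dvd n" using assms by (auto simp: admissible_rep_iff odd_prime_divs_def)
  moreover have "coprime k n" using assms(3) by (simp add: units_mod_def)
  ultimately show "\<not> p dvd k" by (metis coprime_common_divisor not_prime_unit)
qed

lemma sgn_char_unit_mult:
  assumes "n > 0" "admissible_rep n \<Delta> w0 w S" "k \<in> units_mod n" "l \<in> units_mod n"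
  shows "sgn_char w0 w S (k * l) = sgn_char w0 w S k * sgn_char w0 w S l"
proof (rule sgn_char_mult)
  show "odd_primes S" using assms(1,2) odd_prime_divs_odd_primes by (simp add: admissible_rep_iff)
  assume "w0 \<or> w"
  then show "odd k \<and> odd l" using admissible_unit_odd[OF assms(1,2)] assms(3,4) by (simp add: units_mod_def)
qed

text \<open>If 8 or 4 fails to divide n where required, being 1 modulo n leaves enough freedom
  modulo 8 to reach -1. Oddness of k is recorded because the sign law is first proved for odd
  k.\<close>

lemma exists_sgn_char_minus_one_cong_1:
  assumes n: "n > 0" and S: "S \<subseteq> odd_prime_divs n" and "\<not> admissible_rep n (disc_rep w0 w S) w0 w S"
  shows "\<exists>k. odd k \<and> [k = 1] (mod n) \<and> sgn_char w0 w S k = -1"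
proof -
  obtain m n' where mn: "n = 2 ^ m * n'" "odd n'" using two_part_decomp[OF n] .
  have dn: "p dvd n'" "prime p" if "p \<in> S" for p
  proof -
    have "prime p" "odd p" "p dvd n" using that S by (auto simp: odd_prime_divs_def)
    then show "p dvd n'" "prime p" using mn by (metis coprime_dvd_mult_right_iff coprime_power_right_iff
        coprime_right_2_iff_odd)+
  qed
  have bad: "(w0 \<and> \<not> 8 dvd n) \<or> (w \<and> \<not> 4 dvd n)"
    using assms by (auto simp: admissible_rep_iff)
  have cop: "coprime (8::nat) n'" using mn(2) coprime_power_left_iff[of "2::nat" 3 n'] by simp
  show ?thesis
  proof (cases "w0 \<and> \<not> 8 dvd n")
    case True
    have "m < 3"
    proof (rule ccontr)
      assume "\<not> m < 3"
      then have "(8::nat) dvd 2 ^ m" using le_imp_power_dvd[of 3 m "2::nat"] by simp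
      then show False using True mn by simp
    qed
    then have m: "(2::nat) ^ m dvd 4" using le_imp_power_dvd[of m 2 "2::nat"] by simp
    \<comment> \<open>The 2-part of n divides 4, and 5 is 1 modulo 4: \<open>chi8\<close> becomes -1
      while \<open>chi4\<close> stays 1.\<close>
    obtain k where k: "[k = 5] (mod 8)" "[k = 1] (mod n')" using crt_exists_nat[OF cop] .
    have "k mod 8 = 5" using k(1) by (simp add: cong_def)
    moreover have "k mod 8 mod 4 = k mod 4" "k mod 8 mod 2 = k mod 2" by (simp_all add: mod_mod_cancel)
    ultimately have k8: "k mod 8 = 5" "k mod 4 = 1" "k mod 2 = 1" by simp_all
    then have "[k = 1] (mod 4)" by (simp add: cong_def)
    then have "[k = 1] (mod 2 ^ m)" using m cong_dvd_modulus_nat by blast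
    then have "[k = 1] (mod n)" using k(2) mn by (simp add: coprime_cong_mult_nat)
    moreover have "odd k" using k8 by (simp add: odd_iff_mod_2_eq_one)
    moreover have "sgn_char w0 w S k = -1"
      using True k8 sgn_char_eq_one_if[of S k] dn k(2) cong_dvd_modulus_nat
      unfolding sgn_char_def chi8_def chi4_def by auto
    ultimately show ?thesis by blast
  next
    case False
    with bad have w: "w" "\<not> 4 dvd n" by auto
    have w0: "\<not> w0" using False w dvd_trans[of 4 8 n] by auto
    have "m < 2"
    proof (rule ccontr)
      assume "\<not> m < 2"
      then have "(4::nat) dvd 2 ^ m" using le_imp_power_dvd[of 2 m "2::nat"] by simp
      then show False using w mn by simp
    qed
    then have m: "(2::nat) ^ m dvd 2" using le_imp_power_dvd[of m 1 "2::nat"] by simp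
    \<comment> \<open>The 2-part of n divides 2 and \<open>w0\<close> is false, so only
      \<open>chi4\<close> has to become -1.\<close>
    obtain k where k: "[k = 3] (mod 8)" "[k = 1] (mod n')" using crt_exists_nat[OF cop] .
    have "k mod 8 = 3" using k(1) by (simp add: cong_def)
    moreover have "k mod 8 mod 4 = k mod 4" "k mod 8 mod 2 = k mod 2" by (simp_all add: mod_mod_cancel)
    ultimately have k8: "k mod 2 = 1" "k mod 4 = 3" by simp_all
    then have "[k = 1] (mod 2)" by (simp add: cong_def)
    then have "[k = 1] (mod 2 ^ m)" using m cong_dvd_modulus_nat by blast
    then have "[k = 1] (mod n)" using k(2) mn by (simp add: coprime_cong_mult_nat)
    moreover have "odd k" using k8 by (simp add: odd_iff_mod_2_eq_one)
    moreover have "sgn_char w0 w S k = -1"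
      using w w0 k8 sgn_char_eq_one_if[of S k] dn k(2) cong_dvd_modulus_nat
      unfolding sgn_char_def chi8_def chi4_def by auto
    ultimately show ?thesis by blast
  qed
qed

section \<open>The group algebra\<close>

hide_const (open) Polynomial.order Module.smult

locale finite_group = group G for G :: "('g, 'b) monoid_scheme" (structure) +
  assumes finite_carrier [simp]: "finite (carrier G)"
begin

text \<open>The coefficient ring stays arbitrary: congruences modulo p use \<open>int\<close>,
  spectral theory uses \<open>complex\<close>, and \<open>ev_of_int\<close> links the two. The value
  0 off the carrier makes algebraic identities equalities of functions.\<close>

definition conv :: "('g \<Rightarrow> 'r::comm_ring_1) \<Rightarrow> ('g \<Rightarrow> 'r) \<Rightarrow> 'g \<Rightarrow> 'r"
  where "conv x y = (\<lambda>g. if g \<in> carrier G then \<Sum>h\<in>carrier G. x h * y (inv h \<otimes> g) else 0)"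

definition unit_ga :: "'g \<Rightarrow> 'r::comm_ring_1"
  where "unit_ga = (\<lambda>g. if g = \<one> then 1 else 0)"

definition supported :: "('g \<Rightarrow> 'r::comm_ring_1) \<Rightarrow> bool"
  where "supported x \<longleftrightarrow> (\<forall>g. g \<notin> carrier G \<longrightarrow> x g = 0)"

text \<open>The centre of the group algebra; conjugation invariance is written in the symmetric form
  that the commutation proofs use.\<close>

definition class_fun :: "('g \<Rightarrow> 'r::comm_ring_1) \<Rightarrow> bool"
  where "class_fun x \<longleftrightarrow> supported x \<and> (\<forall>g\<in>carrier G. \<forall>h\<in>carrier G. x (g \<otimes> h) = x (h \<otimes> g))"

lemma class_fun_supported: "class_fun x \<Longrightarrow> supported x"
  by (simp add: class_fun_def)

lemma class_funD: "class_fun x \<Longrightarrow> g \<in> carrier G \<Longrightarrow> h \<in> carrier G \<Longrightarrow> x (g \<otimes> h) = x (h \<otimes> g)"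
  by (simp add: class_fun_def)

lemma class_fun_conj:
  assumes "class_fun x" "g \<in> carrier G" "h \<in> carrier G"
  shows "x (h \<otimes> g \<otimes> inv h) = x g"
  using class_funD[OF assms(1), of "h \<otimes> g" "inv h"] assms
  by (simp flip: m_assoc)

lemma mult_inv_cancel [simp]:
  "g \<in> carrier G \<Longrightarrow> b \<in> carrier G \<Longrightarrow> g \<otimes> (inv g \<otimes> b) = b"
  "g \<in> carrier G \<Longrightarrow> b \<in> carrier G \<Longrightarrow> inv g \<otimes> (g \<otimes> b) = b"
  by (simp_all flip: m_assoc)

lemma sum_left_translate:
  "a \<in> carrier G \<Longrightarrow> (\<Sum>h\<in>carrier G. f (a \<otimes> h)) = (\<Sum>h\<in>carrier G. f h)"
  by (rule sum.reindex_bij_witness[of _ "\<lambda>h. inv a \<otimes> h" "\<lambda>h. a \<otimes> h"]) (simp_all flip: m_assoc)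

lemma sum_right_translate:
  "a \<in> carrier G \<Longrightarrow> (\<Sum>h\<in>carrier G. f (h \<otimes> a)) = (\<Sum>h\<in>carrier G. f h)"
  by (rule sum.reindex_bij_witness[of _ "\<lambda>h. h \<otimes> inv a" "\<lambda>h. h \<otimes> a"]) (simp_all add: m_assoc)

lemma conv_supported [simp]: "supported (conv x y)"
  by (simp add: supported_def conv_def)

lemma unit_supported [simp]: "supported unit_ga"
  by (auto simp: supported_def unit_ga_def)

lemma unit_class_fun [simp]: "class_fun unit_ga"
  unfolding class_fun_def
proof (intro conjI ballI unit_supported)
  fix g h assume "g \<in> carrier G" "h \<in> carrier G"
  then have "g \<otimes> h = \<one> \<longleftrightarrow> h \<otimes> g = \<one>"
    by (metis inv_comm)
  then show "unit_ga (g \<otimes> h) = unit_ga (h \<otimes> g)"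
    by (simp add: unit_ga_def)
qed

lemma conv_assoc: "conv (conv x y) z = conv x (conv y z)"
proof
  fix g
  show "conv (conv x y) z g = conv x (conv y z) g"
  proof (cases "g \<in> carrier G")
    case True
    have "conv (conv x y) z g
        = (\<Sum>h\<in>carrier G. \<Sum>k\<in>carrier G. x k * (y (inv k \<otimes> h) * z (inv h \<otimes> g)))"
      using True by (simp add: conv_def sum_distrib_right mult.assoc)
    also have "\<dots> = (\<Sum>k\<in>carrier G. \<Sum>h\<in>carrier G. x k * (y (inv k \<otimes> h) * z (inv h \<otimes> g)))"
      by (rule sum.swap)
    also have "\<dots> = (\<Sum>k\<in>carrier G. x k * conv y z (inv k \<otimes> g))"
    proof (rule sum.cong[OF refl])
      fix k assume k: "k \<in> carrier G"
      have "(\<Sum>h\<in>carrier G. y (inv k \<otimes> h) * z (inv h \<otimes> g))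
          = (\<Sum>h\<in>carrier G. y (inv k \<otimes> (k \<otimes> h)) * z (inv (k \<otimes> h) \<otimes> g))"
        by (rule sum_left_translate[OF k, symmetric])
      also have "\<dots> = conv y z (inv k \<otimes> g)"
        using k True by (simp add: conv_def inv_mult_group m_assoc flip: m_assoc[of "inv k" k])
      finally show "(\<Sum>h\<in>carrier G. x k * (y (inv k \<otimes> h) * z (inv h \<otimes> g)))
          = x k * conv y z (inv k \<otimes> g)"
        by (simp flip: sum_distrib_left)
    qed
    also have "\<dots> = conv x (conv y z) g"
      using True by (simp add: conv_def[of x "conv y z"])
    finally show ?thesis .
  qed (simp add: conv_def)
qed

lemma conv_unit_left [simp]: "supported x \<Longrightarrow> conv unit_ga x = x"
  by (rule ext) (auto simp: conv_def unit_ga_def supported_def if_distrib[of "\<lambda>c. c * _"] sum.delta cong: if_cong)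

lemma conv_commute:
  assumes "class_fun y"
  shows "conv x y = conv y x"
proof
  fix g
  show "conv x y g = conv y x g"
  proof (cases "g \<in> carrier G")
    case True
    have "conv x y g = (\<Sum>h\<in>carrier G. y (g \<otimes> inv h) * x h)"
      using True class_funD[OF assms] by (simp add: conv_def mult.commute)
    also have "\<dots> = (\<Sum>h\<in>carrier G. y h * x (inv h \<otimes> g))"
      by (rule sum.reindex_bij_witness[of _ "\<lambda>h. inv h \<otimes> g" "\<lambda>h. g \<otimes> inv h"])
        (use True in \<open>auto simp: inv_mult_group m_assoc\<close>)
    finally show ?thesis using True by (simp add: conv_def)
  qed (simp add: conv_def)
qed

lemma conv_unit_right [simp]: "supported x \<Longrightarrow> conv x unit_ga = x"
  using conv_commute[OF unit_class_fun, of x] by simp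

lemma class_fun_conv:
  assumes "class_fun x" "class_fun y"
  shows "class_fun (conv x y)"
  unfolding class_fun_def
proof (intro conjI ballI conv_supported)
  fix a b assume a: "a \<in> carrier G" and b: "b \<in> carrier G"
  have "conv x y (a \<otimes> b) = (\<Sum>h\<in>carrier G. x (a \<otimes> h) * y (inv (a \<otimes> h) \<otimes> (a \<otimes> b)))"
    using a b by (simp add: conv_def sum_left_translate[of a "\<lambda>h. x h * y (inv h \<otimes> (a \<otimes> b))"])
  also have "\<dots> = (\<Sum>h\<in>carrier G. x (h \<otimes> a) * y (inv (h \<otimes> a) \<otimes> (b \<otimes> a)))"
  proof (rule sum.cong[OF refl])
    fix h assume h: "h \<in> carrier G"
    have "inv (a \<otimes> h) \<otimes> (a \<otimes> b) = inv h \<otimes> b"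
      using a b h by (simp add: inv_mult_group m_assoc flip: m_assoc[of "inv a" a])
    moreover have "y (inv (h \<otimes> a) \<otimes> (b \<otimes> a)) = y (inv h \<otimes> b)"
      using a b h class_fun_conj[OF assms(2), of "inv h \<otimes> b" "inv a"]
      by (simp add: inv_mult_group m_assoc)
    ultimately show "x (a \<otimes> h) * y (inv (a \<otimes> h) \<otimes> (a \<otimes> b))
        = x (h \<otimes> a) * y (inv (h \<otimes> a) \<otimes> (b \<otimes> a))"
      using class_funD[OF assms(1) a h] by simp
  qed
  also have "\<dots> = conv x y (b \<otimes> a)"
    using a b by (simp add: conv_def sum_right_translate[of a "\<lambda>h. x h * y (inv h \<otimes> (b \<otimes> a))"])
  finally show "conv x y (a \<otimes> b) = conv x y (b \<otimes> a)" .
qed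

lemma conv_add_left: "conv (\<lambda>g. x g + y g) z = (\<lambda>g. conv x z g + conv y z g)"
  by (auto simp: conv_def algebra_simps sum.distrib)

lemma conv_add_right: "conv z (\<lambda>g. x g + y g) = (\<lambda>g. conv z x g + conv z y g)"
  by (auto simp: conv_def algebra_simps sum.distrib)

lemma conv_scale_left: "conv (\<lambda>g. c * x g) z = (\<lambda>g. c * conv x z g)"
  by (auto simp: conv_def sum_distrib_left mult.assoc)

lemma conv_scale_right: "conv z (\<lambda>g. c * x g) = (\<lambda>g. c * conv z x g)"
  by (auto simp: conv_def sum_distrib_left mult.left_commute)

lemma conv_sum_left: "conv (\<lambda>g. \<Sum>i\<in>I. f i g) z = (\<lambda>g. \<Sum>i\<in>I. conv (f i) z g)"
  by (auto simp: conv_def sum_distrib_right sum.swap[of _ I])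

lemma conv_sum_right: "conv z (\<lambda>g. \<Sum>i\<in>I. f i g) = (\<lambda>g. \<Sum>i\<in>I. conv z (f i) g)"
  by (auto simp: conv_def sum_distrib_left sum.swap[of _ I])

lemma conv_zero_left [simp]: "conv (\<lambda>_. 0) z = (\<lambda>_. 0)"
  by (auto simp: conv_def)

lemma conv_zero_right [simp]: "conv z (\<lambda>_. 0) = (\<lambda>_. 0)"
  by (auto simp: conv_def)

lemma class_fun_add: "class_fun x \<Longrightarrow> class_fun y \<Longrightarrow> class_fun (\<lambda>g. x g + y g)"
  and class_fun_scale: "class_fun x \<Longrightarrow> class_fun (\<lambda>g. c * x g)"
  and class_fun_zero [simp]: "class_fun (\<lambda>g. 0)"
  by (auto simp add: class_fun_def supported_def)

text \<open>Horner evaluation with convolution as the product, a constant a standing for a times the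
  identity \<open>unit_ga\<close>.\<close>

definition ev :: "'r::comm_ring_1 poly \<Rightarrow> ('g \<Rightarrow> 'r) \<Rightarrow> 'g \<Rightarrow> 'r"
  where "ev q x = fold_coeffs (\<lambda>a y g. a * unit_ga g + conv x y g) q (\<lambda>_. 0)"

lemma ev_0 [simp]: "ev 0 x = (\<lambda>_. 0)"
  by (simp add: ev_def)

lemma ev_pCons: "ev (pCons a q) x = (\<lambda>g. a * unit_ga g + conv x (ev q x) g)"
proof (cases "pCons a q = 0")
  case False
  then show ?thesis
    by (auto simp: ev_def fold_coeffs_def cCons_def coeffs_eq_Nil)
qed (auto simp: fun_eq_iff)

lemma ev_add: "ev (p + q) x = (\<lambda>g. ev p x g + ev q x g)"
proof (induction p q rule: poly_induct2)
  case (pCons a p b q)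
  then show ?case by (simp add: ev_pCons conv_add_right algebra_simps)
qed simp

lemma ev_smult: "ev (smult c p) x = (\<lambda>g. c * ev p x g)"
  by (induction p) (simp_all add: ev_pCons conv_scale_right algebra_simps)

lemma ev_minus: "ev (- p) x = (\<lambda>g. - ev p x g)"
  using ev_smult[of "- 1" p x] by simp

lemma ev_diff: "ev (p - q) x = (\<lambda>g. ev p x g - ev q x g)"
  using ev_add[of p "- q" x] by (simp add: ev_minus)

lemma ev_sum: "ev (\<Sum>i\<in>I. f i) x = (\<lambda>g. \<Sum>i\<in>I. ev (f i) x g)"
  by (induction I rule: infinite_finite_induct) (simp_all add: ev_add)

lemma ev_supported [simp]: "supported (ev p x)"
  by (induction p) (auto simp: ev_pCons supported_def conv_def unit_ga_def)

lemma ev_1 [simp]: "ev 1 x = unit_ga"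
  by (simp add: one_pCons ev_pCons)

lemma ev_X [simp]: "supported x \<Longrightarrow> ev [:0, 1:] x = x"
  by (simp add: ev_pCons)

lemma ev_class_fun: "class_fun x \<Longrightarrow> class_fun (ev p x)"
  by (induction p) (simp_all add: ev_pCons class_fun_add class_fun_scale class_fun_conv)

lemma ev_mult: "ev (p * q) x = conv (ev p x) (ev q x)"
proof (induction p)
  case (pCons a p)
  have "ev (pCons a p * q) x = (\<lambda>g. a * ev q x g + conv x (ev (p * q) x) g)"
    by (simp add: ev_add ev_smult ev_pCons)
  also have "\<dots> = conv (ev (pCons a p) x) (ev q x)"
    by (simp add: pCons.IH ev_pCons conv_add_left conv_scale_left conv_assoc)
  finally show ?case .
qed simp

lemma ev_of_int: "(\<lambda>g. of_int (ev p x g)) = ev (map_poly of_int p) (\<lambda>g. of_int (x g))"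
proof (induction p)
  case (pCons a p)
  then show ?case
    by (auto simp: ev_pCons map_poly_pCons fun_eq_iff conv_def unit_ga_def)
qed simp

end

section \<open>The Frobenius congruence\<close>

text \<open>Bezout: some multiple of d is 1 modulo p, and y has both periods.\<close>

lemma funpow_coprime_fixpoint:
  assumes "(f ^^ d) y = y" "(f ^^ p) y = y" "coprime d p"
  shows "f y = y"
proof (cases "p = 0")
  case True
  with assms show ?thesis by simp
next
  case False
  have iter: "(f ^^ (k * n)) y = y" if "(f ^^ k) y = y" for k n
    using that by (induction n) (simp_all add: funpow_add)
  obtain a where "[d * a = Suc 0] (mod p)"
    using cong_solve_coprime_nat[OF assms(3)] by auto
  then obtain b c where *: "d * a + p * b = Suc 0 + p * c"
    by (metis cong_iff_lin_nat mult.commute)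
  have "(f ^^ (d * a + p * b)) y = y"
    using iter[OF assms(1), of a] iter[OF assms(2), of b] by (simp add: funpow_add)
  moreover have "(f ^^ (Suc 0 + p * c)) y = f y"
    using iter[OF assms(2), of c] by (simp add: funpow_add)
  ultimately show ?thesis using * by simp
qed

text \<open>A cyclic group of prime order p acts on X through f. An orbit that is not a fixed point
  has exactly p elements, all with the same \<phi>, so it contributes a multiple of p; the induction
  removes one such orbit.\<close>

lemma sum_cong_sum_fixpoints:
  fixes \<phi> :: "'a \<Rightarrow> int"
  assumes "finite X" "prime p" "\<And>x. x \<in> X \<Longrightarrow> f x \<in> X" "\<And>x. x \<in> X \<Longrightarrow> (f ^^ p) x = x"
    "\<And>x. x \<in> X \<Longrightarrow> \<phi> (f x) = \<phi> x"
  shows "[sum \<phi> X = sum \<phi> {x \<in> X. f x = x}] (mod int p)"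
  using assms
proof (induction "card X" arbitrary: X rule: less_induct)
  case less
  show ?case
  proof (cases "\<forall>x\<in>X. f x = x")
    case True
    then have "{x \<in> X. f x = x} = X" by auto
    then show ?thesis by simp
  next
    case False
    then obtain x where x: "x \<in> X" "f x \<noteq> x" by auto
    have p: "p > 0" using less.prems prime_gt_0_nat by auto
    have fX: "(f ^^ i) y \<in> X" if "y \<in> X" for i y
      using that less.prems by (induction i) auto
    have ph: "\<phi> ((f ^^ i) x) = \<phi> x" for i
      using less.prems fX[OF x(1)] by (induction i) auto
    have retn: "(f ^^ (p - i)) ((f ^^ i) x) = x" if "i < p" for i
      using that less.prems(4)[OF x(1)] by (simp flip: funpow_add comp_apply[of "f ^^ _"])
    have nofix: "f ((f ^^ i) x) \<noteq> (f ^^ i) x" if "i < p" for i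
    proof
      assume *: "f ((f ^^ i) x) = (f ^^ i) x"
      have "(f ^^ n) ((f ^^ i) x) = (f ^^ i) x" for n
        by (induction n) (simp_all add: *)
      then have "x = (f ^^ i) x" using retn[OF that] by metis
      then show False using * x by simp
    qed
    define Orb where "Orb = (\<lambda>i. (f ^^ i) x) ` {..<p}"
    \<comment> \<open>An earlier return would give a period prime to p besides the period p, hence a
      fixed point.\<close>
    have inj: "inj_on (\<lambda>i. (f ^^ i) x) {..<p}"
    proof (rule linorder_inj_onI)
      fix i j assume ij: "i < j" "i \<in> {..<p}" "j \<in> {..<p}"
      show "(f ^^ i) x \<noteq> (f ^^ j) x"
      proof
        assume eq: "(f ^^ i) x = (f ^^ j) x"
        have "(f ^^ (j - i)) ((f ^^ i) x) = (f ^^ i) x"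
          using ij eq funpow_add[of "j - i" i f] by (simp add: fun_eq_iff)
        moreover have "(f ^^ p) ((f ^^ i) x) = (f ^^ i) x"
          using less.prems fX x by blast
        moreover have "coprime (j - i) p"
        proof -
          have "\<not> p dvd j - i" using ij by (auto dest: dvd_imp_le)
          then show ?thesis using \<open>prime p\<close> prime_imp_coprime coprime_commute by blast
        qed
        ultimately have "f ((f ^^ i) x) = (f ^^ i) x" by (rule funpow_coprime_fixpoint)
        then show False using nofix ij by auto
      qed
    qed auto
    have OX: "Orb \<subseteq> X" using fX x by (auto simp: Orb_def)
    have xO: "x \<in> Orb" using p by (force simp: Orb_def)
    have memO: "(f ^^ i) x \<in> Orb" for i
    proof -
      have "(f ^^ i) x = (f ^^ (i mod p)) x"
        by (rule funpow_mod_eq[symmetric]) (use less.prems x in blast)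
      then show ?thesis using p by (auto simp: Orb_def)
    qed
    let ?Y = "X - Orb"
    have clo: "f y \<in> ?Y" if "y \<in> ?Y" for y
    proof -
      have "f y \<notin> Orb"
      proof
        assume "f y \<in> Orb"
        then obtain i where i: "f y = (f ^^ i) x" by (auto simp: Orb_def)
        have "y = (f ^^ (p - 1)) (f y)"
          using less.prems(4)[of y] that p
          by (metis DiffD1 Suc_pred' comp_apply funpow_Suc_right)
        also have "\<dots> = (f ^^ (p - 1 + i)) x" by (simp add: i funpow_add)
        finally show False using memO that by simp
      qed
      then show ?thesis using that less.prems by blast
    qed
    have IH: "[sum \<phi> ?Y = sum \<phi> {x \<in> ?Y. f x = x}] (mod int p)"
    proof (rule less.hyps)
      show "card ?Y < card X"
        using xO x OX less.prems(1) by (metis Diff_iff Diff_subset psubsetI psubset_card_mono)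
    qed (use less.prems clo in auto)
    have fixeq: "{x \<in> ?Y. f x = x} = {x \<in> X. f x = x}"
      using nofix by (auto simp: Orb_def)
    have "sum \<phi> Orb = (\<Sum>i<p. \<phi> x)"
      unfolding Orb_def using inj by (simp add: sum.reindex ph)
    then have "sum \<phi> X = sum \<phi> ?Y + int p * \<phi> x"
      using sum.subset_diff[OF OX less.prems(1), of \<phi>] by simp
    then have "[sum \<phi> X = sum \<phi> ?Y] (mod int p)" by (simp add: cong_def)
    with IH fixeq show ?thesis by (auto intro: cong_trans)
  qed
qed

lemma fermat_theorem_int:
  assumes "prime p" "\<not> int p dvd a"
  shows "[a ^ (p - 1) = 1] (mod int p)"
proof -
  define b where "b = nat (a mod int p)"
  have p0: "p > 0" using assms prime_gt_0_nat by blast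
  then have b: "int b = a mod int p" by (simp add: b_def)
  then have "\<not> p dvd b" using assms(2) by (metis dvd_mod_iff dvd_refl int_dvd_int_iff)
  then have "[b ^ (p - 1) = 1] (mod p)" using fermat_theorem[OF assms(1)] by blast
  then have "[int b ^ (p - 1) = 1] (mod int p)" by (metis cong_int_iff of_nat_1 of_nat_power)
  moreover have "[a = int b] (mod int p)" by (simp add: b cong_def)
  ultimately show ?thesis by (meson cong_pow cong_trans)
qed

lemma int_power_prime_cong:
  assumes "prime p"
  shows "[(a::int) ^ p = a] (mod int p)"
proof (cases "int p dvd a")
  case True
  then have "int p dvd a ^ p" using assms by (simp add: prime_gt_0_nat dvd_power_iff dvd_power_same
      prime_dvd_power_iff)
  with True show ?thesis by (simp add: cong_def mod_eq_0_iff_dvd dvd_imp_mod_0)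
next
  case False
  have "[a ^ (p - 1) = 1] (mod int p)"
    by (rule fermat_theorem_int[OF assms False])
  then have "[a ^ (p - 1) * a = 1 * a] (mod int p)" by (rule cong_mult) simp
  moreover have "a ^ (p - 1) * a = a ^ p"
    using prime_gt_0_nat[OF assms] by (metis Suc_diff_1 power_Suc2)
  ultimately show ?thesis by simp
qed

context finite_group
begin

abbreviation expo :: nat where "expo \<equiv> grp_exponent G"

lemma expo_props: "expo > 0 \<and> (\<forall>g\<in>carrier G. g [^] expo = \<one>)"
proof -
  have "order G > 0 \<and> (\<forall>g\<in>carrier G. g [^] order G = \<one>)"
    using order_gt_0_iff_finite pow_order_eq_1 by auto
  then show ?thesis
    unfolding grp_exponent_def by (rule LeastI)
qed

lemma expo_pos [simp]: "expo > 0" and pow_expo: "g \<in> carrier G \<Longrightarrow> g [^] expo = \<one>"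
  using expo_props by auto

lemma pow_mod_expo:
  assumes "g \<in> carrier G"
  shows "g [^] (k mod expo) = g [^] k"
proof -
  have "g [^] k = g [^] (expo * (k div expo) + k mod expo)" by simp
  also have "\<dots> = g [^] (k mod expo)"
    using nat_pow_mult[OF assms, of "expo * (k div expo)" "k mod expo"]
      nat_pow_pow[OF assms, of expo "k div expo"] pow_expo[OF assms] assms
    by (metis l_one nat_pow_closed nat_pow_one)
  finally show ?thesis by simp
qed

lemma pow_cong_expo: "g \<in> carrier G \<Longrightarrow> [a = b] (mod expo) \<Longrightarrow> g [^] a = g [^] b"
  unfolding cong_def by (metis pow_mod_expo)

lemma expo_dvd_order: "expo dvd order G"
proof -
  let ?r = "order G mod expo"
  have "g [^] ?r = \<one>" if "g \<in> carrier G" for g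
    using that pow_mod_expo pow_order_eq_1 by simp
  moreover have "?r < expo" by simp
  ultimately have "?r = 0"
    using not_less_Least[of ?r "\<lambda>n. 0 < n \<and> (\<forall>g\<in>carrier G. g [^] n = \<one>)"]
    unfolding grp_exponent_def by auto
  then show ?thesis by auto
qed

text \<open>One direction is Cauchy's theorem, from a subgroup of order p: if p were prime to the
  exponent, it would be invertible modulo it, and x^p = 1 would give x = 1.\<close>

lemma prime_dvd_expo_iff:
  assumes "prime p"
  shows "p dvd expo \<longleftrightarrow> p dvd order G"
proof
  assume "p dvd order G"
  then obtain m where "order G = p ^ 1 * m" by (auto simp: dvd_def)
  then obtain H where H: "subgroup H G" "card H = p"
    using sylow_thm[OF assms is_group _ finite_carrier, of 1 m] by auto
  interpret H: group "G\<lparr>carrier := H\<rparr>" using H(1) by (rule subgroup_imp_group)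
  have "\<exists>x\<in>H. x \<noteq> \<one>"
  proof (rule ccontr)
    assume "\<not> (\<exists>x\<in>H. x \<noteq> \<one>)"
    then have "H \<subseteq> {\<one>}" by auto
    then have "card H \<le> 1" using card_mono[of "{\<one>}" H] by simp
    with H(2) assms prime_gt_1_nat show False by (metis not_less)
  qed
  then obtain x where x: "x \<in> H" "x \<noteq> \<one>" by auto
  have xG: "x \<in> carrier G" by (rule subgroup.mem_carrier[OF H(1) x(1)])
  have "x [^]\<^bsub>G\<lparr>carrier := H\<rparr>\<^esub> order (G\<lparr>carrier := H\<rparr>) = \<one>"
    using H.pow_order_eq_1[of x] x by simp
  then have xp: "x [^] p = \<one>"
    using H by (simp add: Coset.order_def nat_pow_consistent[symmetric])
  show "p dvd expo"
  proof (rule ccontr)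
    assume "\<not> p dvd expo"
    then have "coprime p expo" using assms by (simp add: prime_imp_coprime)
    then obtain r where r: "[p * r = Suc 0] (mod expo)"
      using cong_solve_coprime_nat by auto
    have "x [^] (p * r) = x [^] Suc 0" using pow_cong_expo[OF xG r] .
    moreover have "x [^] (p * r) = \<one>"
      using xp xG by (simp add: nat_pow_pow[symmetric] nat_pow_one)
    ultimately show False using x xG by simp
  qed
qed (use expo_dvd_order in \<open>auto intro: dvd_trans\<close>)

lemma pow_inj_coprime:
  assumes "coprime k expo" "x \<in> carrier G" "z \<in> carrier G" "x [^] k = z [^] k"
  shows "x = z"
proof -
  obtain r where r: "[k * r = Suc 0] (mod expo)"
    using cong_solve_coprime_nat[OF assms(1)] by auto
  have "x [^] (k * r) = z [^] (k * r)"
    using assms by (simp add: nat_pow_pow[symmetric])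
  then show ?thesis
    using pow_cong_expo[OF assms(2) r] pow_cong_expo[OF assms(3) r] assms by simp
qed

lemma conj_nat_pow:
  assumes "a \<in> carrier G" "g \<in> carrier G"
  shows "(a \<otimes> g \<otimes> inv a) [^] (k::nat) = a \<otimes> g [^] k \<otimes> inv a"
proof (induction k)
  case (Suc k)
  then show ?case using assms by (simp add: m_assoc)
qed (use assms in simp)

section \<open>Convolution powers as sums over words\<close>

primrec cpow :: "('g \<Rightarrow> 'r::comm_ring_1) \<Rightarrow> nat \<Rightarrow> 'g \<Rightarrow> 'r" where
  "cpow x 0 = unit_ga"
| "cpow x (Suc n) = conv x (cpow x n)"

lemma ev_power: "ev (q ^ n) x = cpow (ev q x) n"
  by (induction n) (simp_all add: ev_mult)

lemma class_fun_cpow: "class_fun x \<Longrightarrow> class_fun (cpow x n)"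
  by (induction n) (simp_all add: class_fun_conv)

primrec lprod :: "'g list \<Rightarrow> 'g" where
  "lprod [] = \<one>"
| "lprod (x # xs) = x \<otimes> lprod xs"

lemma lprod_closed [simp]: "set xs \<subseteq> carrier G \<Longrightarrow> lprod xs \<in> carrier G"
  by (induction xs) auto

lemma lprod_snoc: "set xs \<subseteq> carrier G \<Longrightarrow> x \<in> carrier G \<Longrightarrow> lprod (xs @ [x]) = lprod xs \<otimes> x"
  by (induction xs) (auto simp: m_assoc)

lemma lprod_replicate: "x \<in> carrier G \<Longrightarrow> lprod (replicate n x) = x [^] n"
proof (induction n)
  case (Suc n)
  then show ?case using nat_pow_Suc2[of x n] by (simp del: nat_pow_Suc)
qed simp

definition words :: "nat \<Rightarrow> 'g list set"
  where "words n = {xs. set xs \<subseteq> carrier G \<and> length xs = n}"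

lemma finite_words [simp]: "finite (words n)"
  unfolding words_def by (rule finite_lists_length_eq) simp

lemma sum_words_Suc:
  "(\<Sum>xs\<in>words (Suc n). f xs) = (\<Sum>h\<in>carrier G. \<Sum>xs\<in>words n. f (h # xs))"
proof -
  have "(\<Sum>h\<in>carrier G. \<Sum>xs\<in>words n. f (h # xs)) = (\<Sum>(h, xs)\<in>carrier G \<times> words n. f (h # xs))"
    by (rule sum.cartesian_product)
  also have "\<dots> = (\<Sum>xs\<in>words (Suc n). f xs)"
    by (rule sum.reindex_bij_witness[of _ "\<lambda>xs. (hd xs, tl xs)" "\<lambda>(h, xs). h # xs"])
      (auto simp: words_def length_Suc_conv)
  finally show ?thesis by simp
qed

text \<open>In this expanded form the convolution power becomes accessible to the rotation of
  words.\<close>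

lemma cpow_eq_sum_words:
  "g \<in> carrier G \<Longrightarrow> cpow y n g = (\<Sum>xs\<in>words n. if lprod xs = g then prod_list (map y xs) else 0)"
proof (induction n arbitrary: g)
  case 0
  have "words 0 = {[]}" by (auto simp: words_def)
  then show ?case by (simp add: unit_ga_def)
next
  case (Suc n)
  have "cpow y (Suc n) g = (\<Sum>h\<in>carrier G. \<Sum>xs\<in>words n.
      y h * (if lprod xs = inv h \<otimes> g then prod_list (map y xs) else 0))"
    using Suc by (simp add: conv_def sum_distrib_left)
  also have "\<dots> = (\<Sum>h\<in>carrier G. \<Sum>xs\<in>words n.
      if lprod (h # xs) = g then prod_list (map y (h # xs)) else 0)"
  proof (intro sum.cong refl)
    fix h xs assume "h \<in> carrier G" "xs \<in> words n"
    then have "lprod xs = inv h \<otimes> g \<longleftrightarrow> h \<otimes> lprod xs = g"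
      using Suc.prems by (metis (mono_tags, lifting) inv_closed lprod_closed mem_Collect_eq
          mult_inv_cancel words_def)
    then show "y h * (if lprod xs = inv h \<otimes> g then prod_list (map y xs) else 0)
        = (if lprod (h # xs) = g then prod_list (map y (h # xs)) else 0)" by simp
  qed
  finally show ?case by (simp only: sum_words_Suc)
qed

text \<open>Rotation conjugates the product of a word instead of preserving it. So words are counted
  with product anywhere in the conjugacy class of g^p, weighted by the number of conjugating
  elements; this multiplies both sides by |G|, which is invertible modulo p.\<close>

theorem frobenius_cong:
  fixes y :: "'g \<Rightarrow> int"
  assumes y: "class_fun y" and p: "prime p" "\<not> p dvd order G" and g: "g \<in> carrier G"
  shows "[cpow y p (g [^] p) = y g] (mod int p)"
proof -
  have cop: "coprime p expo" using p prime_dvd_expo_iff prime_imp_coprime by blast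
  \<comment> \<open>A class function living on the conjugates of g^p, with total mass |G|; it makes
    the weight \<phi> of a word invariant under rotation.\<close>
  define N :: "'g \<Rightarrow> int" where "N z = (\<Sum>a\<in>carrier G. if a \<otimes> g [^] p \<otimes> inv a = z then 1 else 0)" for z
  have N_conj: "N (b \<otimes> z \<otimes> inv b) = N z" if b: "b \<in> carrier G" and z: "z \<in> carrier G" for b z
  proof -
    have "N (b \<otimes> z \<otimes> inv b)
        = (\<Sum>a\<in>carrier G. if (b \<otimes> a) \<otimes> g [^] p \<otimes> inv (b \<otimes> a) = b \<otimes> z \<otimes> inv b then 1 else 0)"
      unfolding N_def by (rule sum_left_translate[OF b, symmetric])
    also have "\<dots> = N z"
      unfolding N_def
    proof (intro sum.cong refl if_cong)
      fix a assume a: "a \<in> carrier G"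
      have "(b \<otimes> a) \<otimes> g [^] p \<otimes> inv (b \<otimes> a) = b \<otimes> (a \<otimes> g [^] p \<otimes> inv a) \<otimes> inv b"
        using a b g by (simp add: inv_mult_group m_assoc)
      then show "(b \<otimes> a \<otimes> g [^] p \<otimes> inv (b \<otimes> a) = b \<otimes> z \<otimes> inv b) = (a \<otimes> g [^] p \<otimes> inv a = z)"
        using a b g z by simp
    qed
    finally show ?thesis .
  qed
  define \<phi> where "\<phi> xs = prod_list (map y xs) * N (lprod xs)" for xs
  have rot: "rotate1 xs \<in> words p" if "xs \<in> words p" for xs
    using that by (simp add: words_def)
  have \<phi>_rot: "\<phi> (rotate1 xs) = \<phi> xs" if "xs \<in> words p" for xs
  proof (cases xs)
    case (Cons x xs')
    then have c: "x \<in> carrier G" "set xs' \<subseteq> carrier G" using that by (auto simp: words_def)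
    have "lprod (xs' @ [x]) = inv x \<otimes> lprod (x # xs') \<otimes> inv (inv x)"
      using c by (simp add: lprod_snoc)
    then have "N (lprod (xs' @ [x])) = N (lprod (x # xs'))"
      using c N_conj[of "inv x" "lprod (x # xs')"] by simp
    then show ?thesis using Cons by (simp add: \<phi>_def mult.commute)
  qed simp
  have "[sum \<phi> (words p) = sum \<phi> {xs \<in> words p. rotate1 xs = xs}] (mod int p)"
  proof (rule sum_cong_sum_fixpoints)
    fix xs assume "xs \<in> words p"
    then show "(rotate1 ^^ p) xs = xs"
      by (auto simp: words_def simp flip: rotate_def)
  qed (use p rot \<phi>_rot in auto)
  \<comment> \<open>Words fixed by rotation are constant, and their products are p-th
    powers.\<close>
  also have "sum \<phi> {xs \<in> words p. rotate1 xs = xs} = (\<Sum>x\<in>carrier G. y x ^ p * N (x [^] p))"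
  proof -
    have p0: "p > 0" using p prime_gt_0_nat by auto
    have "xs = replicate p (hd xs) \<and> hd xs \<in> carrier G"
      if "xs \<in> words p" "rotate1 xs = xs" for xs
    proof -
      have "xs \<noteq> []" using that p0 by (auto simp: words_def)
      then have "card (set xs) = 1" using rotate1_fixpoint_card[OF that(2)] by simp
      then obtain z where "set xs = {z}" using card_1_singletonE by blast
      then have "xs = replicate p z" using that by (auto simp: words_def intro!: replicate_eqI)
      then show ?thesis using that \<open>xs \<noteq> []\<close> p0 by (auto simp: words_def)
    qed
    note const = this
    show ?thesis
    proof (rule sum.reindex_bij_witness[of _ "\<lambda>x. replicate p x" hd])
      fix xs assume "xs \<in> {xs \<in> words p. rotate1 xs = xs}"
      then have *: "replicate p (hd xs) = xs" "hd xs \<in> carrier G" using const by auto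
      then show "replicate p (hd xs) = xs" "hd xs \<in> carrier G" by auto
      have "\<phi> (replicate p (hd xs)) = y (hd xs) ^ p * N (hd xs [^] p)"
        using *(2) by (simp add: \<phi>_def lprod_replicate)
      then show "y (hd xs) ^ p * N (hd xs [^] p) = \<phi> xs" using *(1) by simp
    qed (use p0 in \<open>auto simp: words_def\<close>)
  qed
  also have "[(\<Sum>x\<in>carrier G. y x ^ p * N (x [^] p)) = (\<Sum>x\<in>carrier G. y x * N (x [^] p))] (mod int p)"
    by (intro cong_sum cong_mult int_power_prime_cong p cong_refl)
  also have "(\<Sum>x\<in>carrier G. y x * N (x [^] p)) = int (order G) * y g"
  proof -
    have "(\<Sum>x\<in>carrier G. y x * N (x [^] p))
        = (\<Sum>x\<in>carrier G. \<Sum>a\<in>carrier G. if a \<otimes> g \<otimes> inv a = x then y x else 0)"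
      unfolding N_def sum_distrib_left
    proof (intro sum.cong refl)
      fix x a assume xa: "x \<in> carrier G" "a \<in> carrier G"
      \<comment> \<open>As p is prime to the exponent, taking p-th powers is injective: only the x
        conjugate to g itself remain.\<close>
      have "a \<otimes> g [^] p \<otimes> inv a = x [^] p \<longleftrightarrow> a \<otimes> g \<otimes> inv a = x"
        using pow_inj_coprime[OF cop, of "a \<otimes> g \<otimes> inv a" x] xa g
        by (auto simp: conj_nat_pow[symmetric])
      then show "y x * (if a \<otimes> g [^] p \<otimes> inv a = x [^] p then 1 else 0)
          = (if a \<otimes> g \<otimes> inv a = x then y x else 0)" by simp
    qed
    also have "\<dots> = (\<Sum>a\<in>carrier G. \<Sum>x\<in>carrier G. if a \<otimes> g \<otimes> inv a = x then y x else 0)"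
      by (rule sum.swap)
    also have "\<dots> = (\<Sum>a\<in>carrier G. y (a \<otimes> g \<otimes> inv a))"
      using g by (intro sum.cong refl) simp
    also have "\<dots> = int (order G) * y g"
      using class_fun_conj[OF y g] by (simp add: Coset.order_def)
    finally show ?thesis .
  qed
  also have "sum \<phi> (words p) = int (order G) * cpow y p (g [^] p)"
  proof -
    have "sum \<phi> (words p) = (\<Sum>xs\<in>words p. \<Sum>a\<in>carrier G.
        if lprod xs = a \<otimes> g [^] p \<otimes> inv a then prod_list (map y xs) else 0)"
      unfolding \<phi>_def N_def sum_distrib_left by (intro sum.cong refl) auto
    also have "\<dots> = (\<Sum>a\<in>carrier G. cpow y p (a \<otimes> g [^] p \<otimes> inv a))"
      using g by (subst sum.swap) (simp add: cpow_eq_sum_words)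
    also have "\<dots> = int (order G) * cpow y p (g [^] p)"
      using class_fun_conj[OF class_fun_cpow[OF y]] g by (simp add: Coset.order_def)
    finally show ?thesis .
  qed
  finally have "[int (order G) * cpow y p (g [^] p) = int (order G) * y g] (mod int p)" .
  moreover have "coprime (int (order G)) (int p)"
    using p prime_imp_coprime coprime_commute by (metis coprime_int_iff)
  ultimately show ?thesis by (simp add: cong_mult_lcancel)
qed

text \<open>Reducedness modulo p: by \<open>frobenius_cong\<close>, Y^(p^j) at g is congruent to
  Y^(p^(j+1)) at g^p, so the exponent drops by one factor p at a time.\<close>

lemma dvd_of_dvd_frobenius_power:
  fixes w :: "'g \<Rightarrow> int"
  assumes w: "class_fun w" and p: "prime p" "\<not> p dvd order G"
    and "\<forall>g\<in>carrier G. int p dvd ev (Y ^ (p ^ j)) w g"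
  shows "\<forall>g\<in>carrier G. int p dvd ev Y w g"
  using assms(4)
proof (induction j)
  case (Suc j)
  have "int p dvd ev (Y ^ (p ^ j)) w g" if g: "g \<in> carrier G" for g
  proof -
    have "Y ^ (p ^ Suc j) = (Y ^ (p ^ j)) ^ p" by (metis power_Suc2 power_mult)
    then have "[ev (Y ^ (p ^ Suc j)) w (g [^] p) = ev (Y ^ (p ^ j)) w g] (mod int p)"
      using frobenius_cong[OF ev_class_fun[OF w] p g, of "Y ^ (p ^ j)"] by (simp only: ev_power)
    then show ?thesis using Suc.prems g cong_dvd_iff by blast
  qed
  then show ?case using Suc.IH by blast
qed simp

end

text \<open>Membership in the ideal (f, p) of the integer polynomials.\<close>

definition in_ideal :: "int \<Rightarrow> int poly \<Rightarrow> int poly \<Rightarrow> bool"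
  where "in_ideal p f q \<longleftrightarrow> (\<exists>H R. q = f * H + smult p R)"

lemma in_ideal_mult:
  assumes "in_ideal p f q" "in_ideal p f' q'"
  shows "in_ideal p (f * f') (q * q')"
proof -
  from assms obtain H R H' R' where "q = f * H + smult p R" "q' = f' * H' + smult p R'"
    by (auto simp: in_ideal_def)
  then have "q * q' = (f * f') * (H * H')
      + smult p (f * H * R' + R * f' * H' + smult p (R * R'))"
    by (simp add: algebra_simps smult_add_right)
  then show ?thesis unfolding in_ideal_def by blast
qed

lemma in_ideal_mult_right:
  assumes "in_ideal p f q"
  shows "in_ideal p f (q * r)"
proof -
  from assms obtain H R where "q = f * H + smult p R" by (auto simp: in_ideal_def)
  then have "q * r = f * (H * r) + smult p (R * r)"
    by (simp add: distrib_right mult.assoc)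
  then show ?thesis unfolding in_ideal_def by blast
qed

text \<open>Modulo X^2 - b, where b = a^2 \<Delta>, X^p equals b^((p-1)/2) X, and Fermat turns this
  into c X modulo p if p does not divide a. If p divides a, the quadratic is X^2 modulo p and a
  multiple of X need not lie in the ideal; this case dictates the square.\<close>

lemma in_ideal_frobenius_quadratic:
  fixes \<Delta> a :: int
  assumes p: "prime p" "odd p"
  defines "c \<equiv> \<Delta> ^ ((p - 1) div 2)"
  shows "in_ideal (int p) [:- (a\<^sup>2 * \<Delta>), 0, 1:] (([:0, 1:] ^ p - smult c [:0, 1:])\<^sup>2)"
proof -
  define X :: "int poly" where "X = [:0, 1:]"
  define b where "b = a\<^sup>2 * \<Delta>"
  define e where "e = (p - 1) div 2"
  have pe: "p = Suc (2 * e)" using p(2) unfolding e_def by presburger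
  have f: "[:- b, 0, 1:] = X\<^sup>2 - [:b:]" by (simp add: X_def power2_eq_square)
  obtain H0 where H0: "(X\<^sup>2) ^ e - [:b:] ^ e = (X\<^sup>2 - [:b:]) * H0"
    using power_diff_sumr2[of "X\<^sup>2" e "[:b:]"] by blast
  have be: "b ^ e = a ^ (p - 1) * c"
    unfolding b_def c_def power_mult_distrib power_mult[symmetric] using pe by simp
  define Y where "Y = X ^ p - smult c X"
  have cb: "[:b:] ^ e = [:b ^ e:]" by (rule poly_const_pow)
  \<comment> \<open>Division of X^p - c X by X^2 - b leaves the remainder (b^e - c) X.\<close>
  have Y: "Y = (X\<^sup>2 - [:b:]) * (X * H0) + smult (b ^ e - c) X"
  proof -
    have "X ^ p = X * (X\<^sup>2) ^ e" unfolding pe power_Suc power_mult ..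
    also have "(X\<^sup>2) ^ e = (X\<^sup>2 - [:b:]) * H0 + [:b ^ e:]"
      using H0 unfolding cb by (metis diff_add_cancel)
    finally have "Y = X * ((X\<^sup>2 - [:b:]) * H0 + [:b ^ e:]) - smult c X"
      by (simp add: Y_def)
    also have "\<dots> = (X\<^sup>2 - [:b:]) * (X * H0) + (X * [:b ^ e:] - smult c X)"
      by (simp only: distrib_left mult.left_commute add_diff_eq)
    also have "X * [:b ^ e:] - smult c X = smult (b ^ e - c) X"
      by (simp add: smult_diff_left)
    finally show ?thesis .
  qed
  have "in_ideal (int p) (X\<^sup>2 - [:b:]) (Y\<^sup>2)"
  proof (cases "int p dvd a")
    case False
    have "[a ^ (p - 1) = 1] (mod int p)"
      by (rule fermat_theorem_int[OF p(1) False])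
    then have "int p dvd (a ^ (p - 1) - 1) * c" by (simp add: cong_iff_dvd_diff)
    then have "int p dvd b ^ e - c" unfolding be by (simp add: left_diff_distrib)
    then obtain d where "b ^ e - c = int p * d" by (rule dvdE)
    then have "Y = (X\<^sup>2 - [:b:]) * (X * H0) + smult (int p) (smult d X)"
      using Y by (simp only: smult_smult)
    then have "in_ideal (int p) (X\<^sup>2 - [:b:]) Y"
      unfolding in_ideal_def by blast
    then show ?thesis unfolding power2_eq_square[of Y] by (rule in_ideal_mult_right)
  next
    case True
    then obtain k where "a = int p * k" by (auto simp: dvd_def)
    define d where "d = int p * k\<^sup>2 * \<Delta>"
    have d: "b = int p * d"
      unfolding b_def d_def \<open>a = int p * k\<close> by (simp add: power2_eq_square)
    let ?f = "X\<^sup>2 - [:b:]" and ?s = "b ^ e - c"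
    have sq: "(f * u + t)\<^sup>2 = f * (f * u\<^sup>2 + 2 * u * t) + t\<^sup>2" for f u t :: "int poly"
      by (simp add: power2_eq_square algebra_simps)
    have dist: "[:t:] * (F + smult q [:r:]) = F * [:t:] + smult q [:t * r:]" for t q r and F :: "int poly"
      by (simp add: algebra_simps smult_add_right)
    \<comment> \<open>The squared remainder is a multiple of X^2, and X^2 is p d modulo X^2 -
      b.\<close>
    have X2: "X\<^sup>2 = ?f + smult (int p) [:d:]" by (simp add: d)
    have "(smult ?s X)\<^sup>2 = [:?s\<^sup>2:] * X\<^sup>2" by (simp add: power2_eq_square)
    also have "\<dots> = ?f * [:?s\<^sup>2:] + smult (int p) [:?s\<^sup>2 * d:]"
      using dist[of "?s\<^sup>2" ?f "int p" d] X2 by simp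
    finally have "Y\<^sup>2 = ?f * (?f * (X * H0)\<^sup>2 + 2 * (X * H0) * smult ?s X + [:?s\<^sup>2:])
        + smult (int p) [:?s\<^sup>2 * d:]"
      unfolding Y sq by (simp only: distrib_left add.assoc)
    then show ?thesis unfolding in_ideal_def by blast
  qed
  then have "in_ideal (int p) [:- b, 0, 1:] (Y\<^sup>2)" unfolding f .
  then show ?thesis unfolding Y_def X_def b_def .
qed

context finite_group
begin

text \<open>Each factor of the annihilator absorbs one or two powers of X^p - c X, which is thus
  nilpotent at w modulo p. Reducedness gives w^p = c w modulo p, and this is read at g^p.\<close>

theorem frobenius_scalar_cong:
  fixes w :: "'g \<Rightarrow> int" and \<Delta> :: int
  assumes w: "class_fun w" and "finite A"
    and ann: "ev ([:0, 1:] * (\<Prod>a\<in>A. [:- (a\<^sup>2 * \<Delta>), 0, 1:])) w = (\<lambda>_. 0)"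
    and p: "prime p" "odd p" "\<not> p dvd order G" and g: "g \<in> carrier G"
  shows "[w g = \<Delta> ^ ((p - 1) div 2) * w (g [^] p)] (mod int p)"
proof -
  let ?X = "[:0, 1:] :: int poly"
  define c where "c = \<Delta> ^ ((p - 1) div 2)"
  define Y where "Y = ?X ^ p - smult c ?X"
  have p0: "p > 0" "p > 1" using p prime_gt_0_nat prime_gt_1_nat by auto
  have "in_ideal (int p) (\<Prod>a\<in>A. [:- (a\<^sup>2 * \<Delta>), 0, 1:]) (Y ^ (2 * card A))"
    using \<open>finite A\<close>
  proof (induction A)
    case empty
    show ?case unfolding in_ideal_def by (rule exI[of _ 1], rule exI[of _ 0]) simp
  next
    case (insert a A)
    then show ?case
      using in_ideal_mult[OF in_ideal_frobenius_quadratic[OF p(1,2), of a \<Delta>] insert.IH]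
      by (simp add: Y_def c_def power2_eq_square mult.assoc)
  qed
  moreover have "in_ideal (int p) ?X Y"
  proof -
    have "?X ^ p = ?X * ?X ^ (p - 1)" using p0(1) by (metis Suc_pred' power_Suc)
    moreover have "smult c ?X = ?X * [:c:]" by simp
    ultimately have "Y = ?X * (?X ^ (p - 1) - [:c:])"
      unfolding Y_def right_diff_distrib by metis
    then have "Y = ?X * (?X ^ (p - 1) - [:c:]) + smult (int p) 0" by simp
    then show ?thesis unfolding in_ideal_def by blast
  qed
  ultimately have ideal: "in_ideal (int p) (?X * (\<Prod>a\<in>A. [:- (a\<^sup>2 * \<Delta>), 0, 1:])) (Y * Y ^ (2 * card A))"
    using in_ideal_mult by blast
  \<comment> \<open>One power for the factor X and two for each quadratic factor. Since p^J is at
    least J, an exponent that is a power of p is reached.\<close>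
  define J where "J = Suc (2 * card A)"
  have "J \<le> p ^ J" using power_gt_expt[of p J] p0 by simp
  then have "Y ^ (p ^ J) = Y * Y ^ (2 * card A) * Y ^ (p ^ J - J)"
    by (metis J_def le_add_diff_inverse power_Suc power_add)
  then have "in_ideal (int p) (?X * (\<Prod>a\<in>A. [:- (a\<^sup>2 * \<Delta>), 0, 1:])) (Y ^ (p ^ J))"
    using in_ideal_mult_right[OF ideal] by simp
  then obtain H R where "Y ^ (p ^ J) = (?X * (\<Prod>a\<in>A. [:- (a\<^sup>2 * \<Delta>), 0, 1:])) * H + smult (int p) R"
    unfolding in_ideal_def by blast
  then have "ev (Y ^ (p ^ J)) w = (\<lambda>g. int p * ev R w g)"
    by (simp only: ev_add ev_smult ev_mult[of "?X * _"] ann) simp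
  then have "int p dvd ev Y w (g [^] p)"
    using dvd_of_dvd_frobenius_power[OF w p(1,3), of Y J] g by simp
  then have "[cpow w p (g [^] p) = c * w (g [^] p)] (mod int p)"
    unfolding Y_def ev_diff ev_smult ev_power ev_X[OF class_fun_supported[OF w]] cong_iff_dvd_diff .
  with frobenius_cong[OF w p(1,3) g] show ?thesis
    unfolding c_def by (meson cong_sym cong_trans)
qed

end

section \<open>Spectral decomposition\<close>

lemma trace_mult_commute:
  fixes X Y :: "complex mat"
  assumes "X \<in> carrier_mat n n" "Y \<in> carrier_mat n n"
  shows "(\<Sum>i<n. (X * Y) $$ (i, i)) = (\<Sum>i<n. (Y * X) $$ (i, i))"
proof -
  have "(\<Sum>i<n. (X * Y) $$ (i, i)) = (\<Sum>i<n. \<Sum>j<n. X $$ (i, j) * Y $$ (j, i))"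
    using assms by (intro sum.cong refl) (simp add: scalar_prod_def atLeast0LessThan)
  also have "\<dots> = (\<Sum>j<n. \<Sum>i<n. Y $$ (j, i) * X $$ (i, j))"
    by (subst sum.swap) (simp add: mult.commute)
  also have "\<dots> = (\<Sum>i<n. (Y * X) $$ (i, i))"
    using assms by (intro sum.cong refl) (simp add: scalar_prod_def atLeast0LessThan)
  finally show ?thesis .
qed

text \<open>After Schur triangularisation each diagonal entry equals its own square, so it is 0 or
  1, and the trace counts the ones.\<close>

lemma idempotent_mat_trace:
  fixes A :: "complex mat"
  assumes A: "A \<in> carrier_mat n n" and idem: "A * A = A"
  shows "\<exists>d::nat. (\<Sum>i<n. A $$ (i, i)) = of_nat d"
proof -
  obtain es where "char_poly A = (\<Prod>a\<leftarrow>es. [:- a, 1:])"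
    using char_poly_factorized[OF A] by blast
  from schur_decomposition_exists[OF A this] obtain B where
    B: "B \<in> carrier_mat n n" "upper_triangular B" "similar_mat A B" by blast
  then obtain P Q where "similar_mat_wit A B P Q" by (auto simp: similar_mat_def)
  from similar_mat_witD2[OF A this] have P: "P \<in> carrier_mat n n" and Q: "Q \<in> carrier_mat n n"
    and PQ: "P * Q = 1\<^sub>m n" "Q * P = 1\<^sub>m n" and AB: "A = P * B * Q" by auto
  have BA: "B = Q * A * P"
  proof -
    have "Q * A * P = Q * (P * (B * (Q * P)))"
      using P Q B(1) by (simp add: AB assoc_mult_mat[of _ n n _ n _ n])
    also have "\<dots> = (Q * P) * B"
      using P Q B(1) assoc_mult_mat[OF Q P B(1)] by (simp add: PQ)
    finally show ?thesis using B(1) by (simp add: PQ)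
  qed
  have "B * B = Q * (A * ((P * Q) * (A * P)))"
    using P Q A by (simp add: BA assoc_mult_mat[of _ n n _ n _ n])
  also have "\<dots> = Q * ((A * A) * P)"
    using P Q A by (simp add: PQ assoc_mult_mat[of _ n n _ n _ n])
  also have "\<dots> = B" using P Q A by (simp add: idem BA assoc_mult_mat[of _ n n _ n _ n])
  finally have BB: "B * B = B" .
  have diag: "B $$ (i, i) = 0 \<or> B $$ (i, i) = 1" if i: "i < n" for i
  proof -
    have "B $$ (i, i) = (B * B) $$ (i, i)" by (simp add: BB)
    also have "\<dots> = (\<Sum>j<n. B $$ (i, j) * B $$ (j, i))"
      using B(1) i by (simp add: scalar_prod_def atLeast0LessThan)
    also have "\<dots> = (\<Sum>j<n. if j = i then B $$ (i, i) * B $$ (i, i) else 0)"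
    proof (intro sum.cong refl)
      fix j assume "j \<in> {..<n}"
      then have "j < i \<or> j = i \<or> (i < j \<and> j < n)" by auto
      then show "B $$ (i, j) * B $$ (j, i) = (if j = i then B $$ (i, i) * B $$ (i, i) else 0)"
        using B(1,2) i upper_triangularD[OF B(2)] by auto
    qed
    also have "\<dots> = B $$ (i, i) * B $$ (i, i)" using i by simp
    finally show ?thesis by auto
  qed
  have "(\<Sum>i<n. A $$ (i, i)) = (\<Sum>i<n. (B * Q * P) $$ (i, i))"
    using trace_mult_commute[OF P, of "B * Q"] P Q B(1)
    by (simp add: AB assoc_mult_mat[of _ n n _ n _ n])
  also have "B * Q * P = B" using P Q B(1) PQ by (simp add: assoc_mult_mat[of _ n n _ n _ n])
  also have "(\<Sum>i<n. B $$ (i, i)) = (\<Sum>i<n. of_nat (if B $$ (i, i) = 1 then 1 else 0))"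
    using diag by (intro sum.cong refl) auto
  finally show ?thesis unfolding of_nat_sum[symmetric] by blast
qed

lemma exists_linear_dependency:
  fixes f :: "'i \<Rightarrow> 's \<Rightarrow> 'k::field"
  assumes "finite S" "finite I" "card S < card I"
  shows "\<exists>c. (\<exists>i\<in>I. c i \<noteq> 0) \<and> (\<forall>s\<in>S. (\<Sum>i\<in>I. c i * f i s) = 0)"
  using assms
proof (induction S arbitrary: I f rule: finite_induct)
  case empty
  then show ?case by (intro exI[of _ "\<lambda>_. 1"]) (auto simp: card_gt_0_iff)
next
  case (insert s S)
  show ?case
  proof (cases "\<forall>i\<in>I. f i s = 0")
    case True
    then show ?thesis using insert.IH[of I f] insert.prems insert.hyps by auto
  next
    case False
    then obtain j where j: "j \<in> I" "f j s \<noteq> 0" by auto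
    \<comment> \<open>Pivot elimination: multiples of \<open>f j\<close> clear the coordinate s, and
      the coefficient of j is chosen afterwards to match.\<close>
    define f' where "f' i t = f i t - f i s / f j s * f j t" for i t
    have "card S < card (I - {j})" using insert j by simp
    then obtain c where c: "\<exists>i\<in>I - {j}. c i \<noteq> 0" "\<forall>t\<in>S. (\<Sum>i\<in>I - {j}. c i * f' i t) = 0"
      using insert.IH[of "I - {j}" f'] insert.prems by auto
    define c' where "c' i = (if i = j then - (\<Sum>i\<in>I - {j}. c i * f i s) / f j s else c i)" for i
    have split: "(\<Sum>i\<in>I. c' i * f i t) = (\<Sum>i\<in>I - {j}. c i * f' i t)" for t
    proof -
      have "(\<Sum>i\<in>I - {j}. c i * f' i t)
          = (\<Sum>i\<in>I - {j}. c i * f i t) - (\<Sum>i\<in>I - {j}. c i * f i s) / f j s * f j t"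
        by (simp add: f'_def algebra_simps sum_subtractf sum_distrib_left sum_divide_distrib)
      moreover have "(\<Sum>i\<in>I. c' i * f i t) = c' j * f j t + (\<Sum>i\<in>I - {j}. c' i * f i t)"
        using insert.prems j by (intro sum.remove) auto
      moreover have "(\<Sum>i\<in>I - {j}. c' i * f i t) = (\<Sum>i\<in>I - {j}. c i * f i t)"
        by (intro sum.cong refl) (auto simp: c'_def)
      ultimately show ?thesis by (simp add: c'_def)
    qed
    have "f' i s = 0" for i using j by (simp add: f'_def)
    then have "\<forall>t\<in>insert s S. (\<Sum>i\<in>I. c' i * f i t) = 0"
      using c(2) by (simp add: split)
    moreover have "\<exists>i\<in>I. c' i \<noteq> 0" using c(1) by (auto simp: c'_def)
    ultimately show ?thesis by blast
  qed
qed

lemma prod_list_linear_dvd_power: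
  "(\<Prod>a\<leftarrow>as. [:- a, 1:]) dvd (\<Prod>a\<in>B. [:- a, 1:]) ^ length as" if "finite B" "set as \<subseteq> B"
  for as :: "complex list"
  using that(2)
proof (induction as)
  case (Cons a as)
  then have "[:- a, 1:] dvd (\<Prod>a\<in>B. [:- a, 1:])"
    using that(1) by (intro dvd_prodI[of B a "\<lambda>a. [:- a, 1:]"]) auto
  then have "[:- a, 1:] * (\<Prod>a\<leftarrow>as. [:- a, 1:]) dvd (\<Prod>a\<in>B. [:- a, 1:]) * (\<Prod>a\<in>B. [:- a, 1:]) ^ length as"
    using Cons by (intro mult_dvd_mono) auto
  then show ?case by (simp only: list.map prod_list.Cons length_Cons power_Suc)
qed simp

text \<open>Lagrange interpolation of the constant 1: both sides have degree below
  \<open>card B\<close> and agree at the nodes. Evaluated at a group algebra element, the summands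
  become its spectral idempotents.\<close>

lemma lagrange_sum:
  fixes B :: "complex set"
  assumes "finite B" "B \<noteq> {}"
  shows "(\<Sum>z\<in>B. smult (1 / (\<Prod>w\<in>B - {z}. z - w)) (\<Prod>w\<in>B - {z}. [:- w, 1:])) = 1"
    (is "?L = 1")
proof (rule poly_eqI_degree[of B])
  fix x assume x: "x \<in> B"
  have "poly ?L x = (\<Sum>z\<in>B. 1 / (\<Prod>w\<in>B - {z}. z - w) * (\<Prod>w\<in>B - {z}. x - w))"
    by (simp add: poly_sum poly_prod)
  also have "\<dots> = (\<Sum>z\<in>B. if z = x then 1 else 0)"
  proof (intro sum.cong refl)
    fix z assume z: "z \<in> B"
    show "1 / (\<Prod>w\<in>B - {z}. z - w) * (\<Prod>w\<in>B - {z}. x - w) = (if z = x then 1 else 0)"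
    proof (cases "z = x")
      case True
      then show ?thesis using assms(1) by (simp add: prod_zero_iff)
    next
      case False
      then have "(\<Prod>w\<in>B - {z}. x - w) = 0" using x assms(1) by (intro prod_zero) auto
      then show ?thesis using False by simp
    qed
  qed
  also have "\<dots> = 1" using assms x by simp
  finally show "poly ?L x = poly 1 x" by simp
next
  have "degree ?L \<le> card B - 1"
  proof (rule degree_sum_le[OF assms(1)])
    fix z assume z: "z \<in> B"
    have "degree (\<Prod>w\<in>B - {z}. [:- w, 1:]) \<le> sum (degree \<circ> (\<lambda>w. [:- w, 1:])) (B - {z})"
      using assms(1) by (intro degree_prod_sum_le) auto
    also have "\<dots> = card B - 1" using z assms(1) by simp
    finally show "degree (smult (1 / (\<Prod>w\<in>B - {z}. z - w)) (\<Prod>w\<in>B - {z}. [:- w, 1:])) \<le> card B - 1"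
      by (meson degree_smult_le order_trans)
  qed
  moreover have "card B > 0" using assms by (simp add: card_gt_0_iff)
  ultimately show "card B > degree ?L" by linarith
  show "card B > degree (1 :: complex poly)" using assms by (simp add: card_gt_0_iff)
qed

context finite_group
begin

text \<open>\<open>of_nat (order G) * x \<one>\<close> is the trace of the matrix of convolution
  with x, which is idempotent. All multiplicities come from here, also those of idempotents that are
  not central.\<close>

lemma idempotent_trace:
  fixes x :: "'g \<Rightarrow> complex"
  assumes "conv x x = x"
  shows "\<exists>d::nat. of_nat (order G) * x \<one> = of_nat d"
proof -
  let ?n = "order G"
  obtain s where s: "bij_betw s {..<?n} (carrier G)"
    using ex_bij_betw_nat_finite[of "carrier G"] by (auto simp: Coset.order_def atLeast0LessThan)
  have sc: "i < ?n \<Longrightarrow> s i \<in> carrier G" for i using s by (auto simp: bij_betw_def)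
  define X where "X = mat ?n ?n (\<lambda>(i, j). x (s j \<otimes> inv (s i)))"
  have Xc: "X \<in> carrier_mat ?n ?n" by (simp add: X_def)
  have "X * X = X"
  proof (rule eq_matI)
    fix i j assume "i < dim_row X" "j < dim_col X"
    then have ij: "i < ?n" "j < ?n" by (auto simp: X_def)
    have "(X * X) $$ (i, j) = (\<Sum>k<?n. x (s k \<otimes> inv (s i)) * x (s j \<otimes> inv (s k)))"
      using ij by (simp add: X_def scalar_prod_def atLeast0LessThan)
    also have "\<dots> = (\<Sum>c\<in>carrier G. x (c \<otimes> inv (s i)) * x (s j \<otimes> inv c))"
      by (rule sum.reindex_bij_betw[OF s])
    also have "\<dots> = (\<Sum>h\<in>carrier G. x h * x (inv h \<otimes> (s j \<otimes> inv (s i))))"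
      by (rule sum.reindex_bij_witness[of _ "\<lambda>h. inv h \<otimes> s j" "\<lambda>c. s j \<otimes> inv c"])
        (use ij sc in \<open>auto simp: inv_mult_group m_assoc\<close>)
    also have "\<dots> = X $$ (i, j)"
      using ij sc assms[THEN fun_cong, of "s j \<otimes> inv (s i)"] by (simp add: X_def conv_def)
    finally show "(X * X) $$ (i, j) = X $$ (i, j)" .
  qed (simp_all add: X_def)
  from idempotent_mat_trace[OF Xc this] obtain d where "(\<Sum>i<?n. X $$ (i, i)) = of_nat d" by blast
  moreover have "(\<Sum>i<?n. X $$ (i, i)) = (\<Sum>i<?n. x \<one>)"
    by (intro sum.cong refl) (auto simp: X_def sc)
  ultimately show ?thesis by auto
qed

text \<open>The matrix adjoint: the convolution matrix of \<open>star x\<close> is the conjugate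
  transpose of that of x.\<close>

definition star :: "('g \<Rightarrow> complex) \<Rightarrow> 'g \<Rightarrow> complex"
  where "star x = (\<lambda>g. if g \<in> carrier G then cnj (x (inv g)) else 0)"

lemma star_conv: "star (conv x y) = conv (star y) (star x)"
proof
  fix g
  show "star (conv x y) g = conv (star y) (star x) g"
  proof (cases "g \<in> carrier G")
    case True
    have "star (conv x y) g = (\<Sum>h\<in>carrier G. cnj (x h) * cnj (y (inv h \<otimes> inv g)))"
      using True by (simp add: star_def conv_def)
    also have "\<dots> = (\<Sum>h\<in>carrier G. cnj (y (inv h)) * cnj (x (inv g \<otimes> h)))"
      by (rule sum.reindex_bij_witness[of _ "\<lambda>h. inv g \<otimes> h" "\<lambda>h. g \<otimes> h"])
        (use True in \<open>auto simp: inv_mult_group m_assoc mult.commute\<close>)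
    also have "\<dots> = conv (star y) (star x) g"
      using True by (simp add: star_def conv_def inv_mult_group)
    finally show ?thesis .
  qed (simp add: star_def conv_def)
qed

lemma class_fun_star: "class_fun x \<Longrightarrow> class_fun (star x)"
  by (auto simp: class_fun_def supported_def star_def inv_mult_group)

lemma star_star: "supported x \<Longrightarrow> star (star x) = x"
  by (auto simp: supported_def star_def)

lemma star_scale: "star (\<lambda>g. c * x g) = (\<lambda>g. cnj c * star x g)"
  by (auto simp: star_def)

lemma conv_star_one: "conv x (star x) \<one> = of_real (\<Sum>g\<in>carrier G. (cmod (x g))\<^sup>2)"
  by (simp add: conv_def star_def flip: complex_norm_square)

lemma conv_star_one_eq_0: "supported x \<Longrightarrow> conv x (star x) \<one> = 0 \<Longrightarrow> x = (\<lambda>_. 0)"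
  unfolding conv_star_one of_real_eq_0_iff
  by (subst (asm) sum_nonneg_eq_0_iff) (auto simp: supported_def)

text \<open>Central elements are normal. The element h = \<open>conv x (star x)\<close> is
  self-adjoint and \<open>conv h (star h)\<close> contains the factor \<open>conv x x\<close>;
  positivity at the identity kills first h, then x.\<close>

lemma conv_self_zero:
  assumes x: "class_fun x" and "conv x x = (\<lambda>_. 0)"
  shows "x = (\<lambda>_. (0::complex))"
proof -
  define h where "h = conv x (star x)"
  have "star h = h"
    by (simp add: h_def star_conv star_star class_fun_supported[OF x])
  then have "conv h (star h) = conv x (conv (star x) (conv x (star x)))"
    by (simp add: h_def conv_assoc)
  also have "\<dots> = conv (conv x x) (conv (star x) (star x))"
    using conv_commute[OF x, of "star x"] by (simp add: conv_assoc flip: conv_assoc[of "star x"])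
  finally have "h = (\<lambda>_. 0)"
    using assms(2) by (intro conv_star_one_eq_0) (auto simp: h_def)
  then show ?thesis
    using class_fun_supported[OF x] by (intro conv_star_one_eq_0) (auto simp: h_def)
qed

lemma cpow_supported [simp]: "supported (cpow x n)"
  by (cases n) simp_all

lemma cpow_add: "cpow x (a + b) = conv (cpow x a) (cpow x b)"
  by (induction a) (simp_all add: conv_assoc)

lemma cpow_eq_zero:
  assumes x: "class_fun x" and "cpow x n = (\<lambda>_. 0)"
  shows "x = (\<lambda>_. (0::complex))"
  using assms(2)
proof (induction n rule: less_induct)
  case (less n)
  consider "n = 0" | "n = 1" | "n \<ge> 2" by linarith
  then show ?case
  proof cases
    case 1
    then have "unit_ga \<one> = (0::complex)" using less.prems by simp
    then show ?thesis by (simp add: unit_ga_def)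
  next
    case 2
    then show ?thesis using less.prems class_fun_supported[OF x] by simp
  next
    case 3
    \<comment> \<open>For n at least 2 the square of the power n - 1 is a multiple of the power
      n.\<close>
    have "cpow x ((n - 1) + (n - 1)) = cpow x (n + (n - 2))"
      using 3 by (intro arg_cong[where f = "cpow x"]) simp
    then have "conv (cpow x (n - 1)) (cpow x (n - 1)) = (\<lambda>_. 0)"
      using less.prems unfolding cpow_add by simp
    then have "cpow x (n - 1) = (\<lambda>_. 0)"
      using conv_self_zero[OF class_fun_cpow[OF x]] by blast
    then show ?thesis using less.IH[of "n - 1"] 3 by simp
  qed
qed

text \<open>There are \<open>order G + 1\<close> powers in a space of dimension
  \<open>order G\<close>.\<close>

lemma exists_annihilator:
  fixes m :: "'g \<Rightarrow> complex"
  assumes "supported m"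
  shows "\<exists>p. p \<noteq> 0 \<and> ev p m = (\<lambda>_. 0)"
proof -
  have "card (carrier G) < card {..order G}" by (simp add: Coset.order_def)
  from exists_linear_dependency[OF finite_carrier _ this, of "cpow m"]
  obtain c where c: "\<exists>i\<in>{..order G}. c i \<noteq> 0"
    "\<forall>s\<in>carrier G. (\<Sum>i\<le>order G. c i * cpow m i s) = 0" by auto
  define p where "p = (\<Sum>i\<le>order G. monom (c i) i)"
  have "ev p m g = (\<Sum>i\<le>order G. c i * cpow m i g)" for g
    using assms unfolding p_def ev_sum monom_altdef ev_smult ev_power by simp
  moreover have "ev p m g = 0" if "g \<notin> carrier G" for g
    using that ev_supported[of p m] by (simp add: supported_def)
  ultimately have "ev p m = (\<lambda>_. 0)" using c(2) by (metis (no_types, lifting))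
  moreover from c(1) obtain i where "i \<le> order G" "c i \<noteq> 0" by auto
  then have "coeff p i \<noteq> 0"
    by (simp add: p_def coeff_sum coeff_monom)
  then have "p \<noteq> 0" by auto
  ultimately show ?thesis by blast
qed

lemma exists_squarefree_annihilator:
  fixes m :: "'g \<Rightarrow> complex"
  assumes "class_fun m"
  shows "\<exists>B. finite B \<and> ev (\<Prod>a\<in>B. [:- a, 1:]) m = (\<lambda>_. 0)"
proof -
  obtain p where p: "p \<noteq> 0" "ev p m = (\<lambda>_. 0)"
    using exists_annihilator[OF class_fun_supported[OF assms]] by blast
  obtain as where as: "smult (coeff p (degree p)) (\<Prod>a\<leftarrow>as. [:- a, 1:]) = p"
    using fundamental_theorem_algebra_factorized[of p] by blast
  have "(\<lambda>g. lead_coeff p * ev (\<Prod>a\<leftarrow>as. [:- a, 1:]) m g) = (\<lambda>_. 0)"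
    using p(2) unfolding as[symmetric, THEN arg_cong[of _ _ "\<lambda>q. ev q m"]] ev_smult by simp
  then have 0: "ev (\<Prod>a\<leftarrow>as. [:- a, 1:]) m = (\<lambda>_. 0)" using p(1) by (auto simp: fun_eq_iff)
  obtain q where "(\<Prod>a\<in>set as. [:- a, 1:]) ^ length as = (\<Prod>a\<leftarrow>as. [:- a, 1:]) * q"
    using prod_list_linear_dvd_power[of "set as" as] by auto
  then have "ev ((\<Prod>a\<in>set as. [:- a, 1:]) ^ length as) m = (\<lambda>_. 0)"
    by (simp only: ev_mult 0 conv_zero_left)
  then have "ev (\<Prod>a\<in>set as. [:- a, 1:]) m = (\<lambda>_. 0)"
    unfolding ev_power using cpow_eq_zero[OF ev_class_fun[OF assms]] by blast
  then show ?thesis by blast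
qed

text \<open>\<open>e z\<close> is the projection onto the eigenspace of z. The clause
  \<open>e z \<one> \<noteq> 0\<close> says that its trace is nonzero, so every member of \<Theta>
  is a true eigenvalue.\<close>

definition spectral :: "('g \<Rightarrow> complex) \<Rightarrow> complex set \<Rightarrow> (complex \<Rightarrow> 'g \<Rightarrow> complex) \<Rightarrow> bool"
  where "spectral m \<Theta> e \<longleftrightarrow> finite \<Theta> \<and> (\<lambda>g. \<Sum>z\<in>\<Theta>. e z g) = unit_ga \<and>
    (\<forall>z\<in>\<Theta>. z \<in> \<real> \<and> class_fun (e z) \<and> e z \<one> \<noteq> 0 \<and> conv m (e z) = (\<lambda>g. z * e z g) \<and>
      conv (e z) (e z) = e z)"

lemma ev_eigen:
  assumes "conv m x = (\<lambda>g. z * x g)" "supported x"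
  shows "conv (ev q m) x = (\<lambda>g. poly q z * x g)"
proof (induction q)
  case (pCons a q)
  have "conv (ev (pCons a q) m) x = (\<lambda>g. a * x g + conv m (conv (ev q m) x) g)"
    using assms(2) by (simp add: ev_pCons conv_add_left conv_scale_left conv_assoc)
  also have "conv m (conv (ev q m) x) = (\<lambda>g. poly q z * (z * x g))"
    by (simp add: pCons.IH conv_scale_right assms(1))
  also have "(\<lambda>g. a * x g + poly q z * (z * x g)) = (\<lambda>g. poly (pCons a q) z * x g)"
    by (simp add: algebra_simps)
  finally show ?case .
qed simp

lemma eigen_orthogonal:
  assumes "conv m x = (\<lambda>g. z * x g)" "conv m y = (\<lambda>g. w * y g)" "class_fun x" "class_fun y" "z \<noteq> w"
  shows "conv x y = (\<lambda>_. (0::complex))"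
proof -
  have "(\<lambda>g. z * conv x y g) = conv m (conv x y)"
    using assms(1) by (simp add: conv_scale_left flip: conv_assoc)
  also have "\<dots> = conv m (conv y x)" using conv_commute[OF assms(4), of x] by simp
  also have "\<dots> = (\<lambda>g. w * conv x y g)"
    using assms(2) conv_commute[OF assms(4), of x] by (simp add: conv_scale_left flip: conv_assoc)
  finally show ?thesis using assms(5) by (auto simp: fun_eq_iff)
qed

lemma exists_spectral:
  assumes m: "class_fun m" and herm: "star m = m"
  shows "\<exists>\<Theta> e. spectral m \<Theta> e"
proof -
  obtain B where B: "finite B" "ev (\<Prod>a\<in>B. [:- a, 1:]) m = (\<lambda>_. 0)"
    using exists_squarefree_annihilator[OF m] by blast
  have B0: "B \<noteq> {}"
  proof
    assume "B = {}"
    then have "unit_ga \<one> = (0::complex)" using B(2) by (simp add: fun_eq_iff)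
    then show False by (simp add: unit_ga_def)
  qed
  \<comment> \<open>Lagrange polynomials for the roots of the annihilator; a root that is not an
    eigenvalue gives the zero function and is left out of \<Theta>.\<close>
  define l where "l z = smult (1 / (\<Prod>w\<in>B - {z}. z - w)) (\<Prod>w\<in>B - {z}. [:- w, 1:])" for z
  define e where "e z = ev (l z) m" for z
  define \<Theta> where "\<Theta> = {z \<in> B. e z \<noteq> (\<lambda>_. 0)}"
  have sum_e: "(\<lambda>g. \<Sum>z\<in>\<Theta>. e z g) = unit_ga"
  proof -
    have "(\<lambda>g. \<Sum>z\<in>B. e z g) = ev (\<Sum>z\<in>B. l z) m" by (simp add: e_def ev_sum)
    also have "\<dots> = unit_ga" unfolding l_def lagrange_sum[OF B(1) B0] by simp
    moreover have "(\<Sum>z\<in>\<Theta>. e z g) = (\<Sum>z\<in>B. e z g)" for g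
      using B(1) by (intro sum.mono_neutral_left) (auto simp: \<Theta>_def)
    ultimately show ?thesis by simp
  qed
  have cls: "class_fun (e z)" for z unfolding e_def by (rule ev_class_fun[OF m])
  have eig: "conv m (e z) = (\<lambda>g. z * e z g)" if z: "z \<in> B" for z
  proof -
    have "[:- z, 1:] * l z = smult (1 / (\<Prod>w\<in>B - {z}. z - w)) (\<Prod>w\<in>B. [:- w, 1:])"
      unfolding l_def using prod.remove[OF B(1) z, of "\<lambda>w. [:- w, 1:]"] by simp
    then have "ev ([:- z, 1:] * l z) m = (\<lambda>_. 0)"
      by (simp only: ev_smult B(2)) simp
    moreover have "ev [:- z, 1:] m = (\<lambda>g. - z * unit_ga g + m g)"
      using class_fun_supported[OF m] by (simp add: ev_pCons)
    ultimately have "conv (\<lambda>g. - z * unit_ga g + m g) (e z) = (\<lambda>_. 0)"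
      unfolding ev_mult e_def by simp
    then have "(\<lambda>g. - z * e z g + conv m (e z) g) = (\<lambda>_. 0)"
      unfolding conv_add_left conv_scale_left conv_unit_left[OF class_fun_supported[OF cls]] .
    then show ?thesis by (auto simp: fun_eq_iff)
  qed
  have idem: "conv (e z) (e z) = e z" if z: "z \<in> B" for z
  proof -
    have "poly (l z) z = 1"
      using B(1) by (simp add: l_def poly_prod prod_zero_iff)
    then show ?thesis
      using ev_eigen[OF eig[OF z] class_fun_supported[OF cls], of "l z"] by (simp add: e_def)
  qed
  have star_eig: "conv (star (e z)) m = (\<lambda>g. cnj z * star (e z) g)" if "z \<in> B" for z
    using arg_cong[OF eig[OF that], of star] by (simp add: star_conv herm star_scale)
  have norm_nz: "conv (e z) (star (e z)) \<one> \<noteq> 0" if "z \<in> \<Theta>" for z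
    using that conv_star_one_eq_0[OF class_fun_supported[OF cls]] by (auto simp: \<Theta>_def)
  \<comment> \<open>The product of \<open>e z\<close> with its adjoint is nonzero, and the
    self-adjoint central m multiplies it both by z and by \<open>cnj z\<close>.\<close>
  have real: "z \<in> \<real>" if z: "z \<in> \<Theta>" for z
  proof -
    have zB: "z \<in> B" using z by (simp add: \<Theta>_def)
    have 1: "conv m (conv (e z) (star (e z))) = (\<lambda>g. z * conv (e z) (star (e z)) g)"
      using eig[OF zB] by (simp add: conv_scale_left flip: conv_assoc)
    have "conv (conv (e z) (star (e z))) m = (\<lambda>g. cnj z * conv (e z) (star (e z)) g)"
      by (simp add: conv_assoc conv_scale_right star_eig[OF zB])
    then have "(\<lambda>g. z * conv (e z) (star (e z)) g) = (\<lambda>g. cnj z * conv (e z) (star (e z)) g)"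
      using 1 conv_commute[OF m] by metis
    then have "z * conv (e z) (star (e z)) \<one> = cnj z * conv (e z) (star (e z)) \<one>" by (rule fun_cong)
    then have "cnj z = z" using norm_nz[OF z] by simp
    then show ?thesis using Reals_cnj_iff by blast
  qed
  \<comment> \<open>The adjoint of \<open>e z\<close> belongs to the same eigenvalue and is
    orthogonal to the other idempotents. So it equals \<open>conv (e z) (star (e z))\<close>, whose
    value at the identity is a nonzero sum of squares.\<close>
  have one: "e z \<one> \<noteq> 0" if z: "z \<in> \<Theta>" for z
  proof -
    have zB: "z \<in> B" using z by (simp add: \<Theta>_def)
    have eigs: "conv m (star (e z)) = (\<lambda>g. z * star (e z) g)"
      using star_eig[OF zB] real[OF z] Reals_cnj_iff[of z] conv_commute[OF m, of "star (e z)"] by simp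
    have ss: "supported (star (e z))" by (simp add: class_fun_supported class_fun_star cls)
    have "star (e z) = conv (\<lambda>g. \<Sum>w\<in>\<Theta>. e w g) (star (e z))"
      unfolding sum_e using ss by simp
    also have "\<dots> = (\<lambda>g. \<Sum>w\<in>\<Theta>. conv (e w) (star (e z)) g)" by (rule conv_sum_left)
    also have "\<dots> = (\<lambda>g. \<Sum>w\<in>\<Theta>. if w = z then conv (e z) (star (e z)) g else 0)"
    proof (intro ext sum.cong refl)
      fix g w assume w: "w \<in> \<Theta>"
      then show "conv (e w) (star (e z)) g = (if w = z then conv (e z) (star (e z)) g else 0)"
        using eigen_orthogonal[OF eig eigs cls class_fun_star[OF cls], of w] by (auto simp: \<Theta>_def)
    qed
    also have "\<dots> = conv (e z) (star (e z))" using z B(1) by (auto simp: \<Theta>_def)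
    finally have "star (e z) \<one> = conv (e z) (star (e z)) \<one>" by (rule fun_cong)
    then show ?thesis using norm_nz[OF z] by (auto simp: star_def)
  qed
  have "spectral m \<Theta> e"
    unfolding spectral_def using B(1) sum_e cls real one eig idem by (auto simp: \<Theta>_def)
  then show ?thesis by blast
qed

lemma cpow_eigen:
  assumes "conv m x = (\<lambda>g. z * x g)" "supported x"
  shows "conv (cpow m k) x = (\<lambda>g. z ^ k * x g)"
  using assms by (induction k) (simp_all add: conv_assoc conv_scale_right mult.assoc mult.left_commute)

lemma spectral_cpow:
  assumes "spectral m \<Theta> e"
  shows "cpow m k = (\<lambda>g. \<Sum>z\<in>\<Theta>. z ^ k * e z g)"
proof -
  have "cpow m k = conv (cpow m k) (\<lambda>g. \<Sum>z\<in>\<Theta>. e z g)"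
    using assms by (simp add: spectral_def)
  also have "\<dots> = (\<lambda>g. \<Sum>z\<in>\<Theta>. conv (cpow m k) (e z) g)" by (rule conv_sum_right)
  also have "\<dots> = (\<lambda>g. \<Sum>z\<in>\<Theta>. z ^ k * e z g)"
  proof (intro ext sum.cong refl)
    fix g z assume "z \<in> \<Theta>"
    then show "conv (cpow m k) (e z) g = z ^ k * e z g"
      using assms cpow_eigen[of m "e z" z k] by (simp add: spectral_def class_fun_supported)
  qed
  finally show ?thesis .
qed

section \<open>The walk in terms of the spectrum\<close>

lemma mat_pow_cayley:
  assumes M: "\<And>a b. a \<in> carrier G \<Longrightarrow> b \<in> carrier G \<Longrightarrow> M a b = m (b \<otimes> inv a)"
    and "a \<in> carrier G" "b \<in> carrier G"
  shows "mat_pow (carrier G) (\<lambda>x y. c * M x y) k a b = c ^ k * cpow m k (b \<otimes> inv a)"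
  using assms(2,3)
proof (induction k arbitrary: a b)
  case 0
  then have "b \<otimes> inv a = \<one> \<longleftrightarrow> a = b" using inv_solve_right' by fastforce
  then show ?case by (simp add: unit_ga_def)
next
  case (Suc k)
  have "mat_pow (carrier G) (\<lambda>x y. c * M x y) (Suc k) a b
      = (\<Sum>d\<in>carrier G. c ^ k * cpow m k (d \<otimes> inv a) * (c * m (b \<otimes> inv d)))"
    using Suc by (simp add: mat_mult_def M)
  also have "\<dots> = (\<Sum>h\<in>carrier G. c ^ Suc k * (m h * cpow m k (inv h \<otimes> (b \<otimes> inv a))))"
    by (rule sum.reindex_bij_witness[of _ "\<lambda>h. inv h \<otimes> b" "\<lambda>d. b \<otimes> inv d"])
      (use Suc.prems in \<open>auto simp: inv_mult_group m_assoc\<close>)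
  also have "\<dots> = c ^ Suc k * cpow m (Suc k) (b \<otimes> inv a)"
    using Suc.prems by (simp add: conv_def sum_distrib_left)
  finally show ?case .
qed

lemma mat_exp_cayley:
  assumes M: "\<And>a b. a \<in> carrier G \<Longrightarrow> b \<in> carrier G \<Longrightarrow> M a b = m (b \<otimes> inv a)"
    and sp: "spectral m \<Theta> e" and ab: "a \<in> carrier G" "b \<in> carrier G"
  shows "mat_exp (carrier G) (\<lambda>x y. c * M x y) a b = (\<Sum>z\<in>\<Theta>. exp (c * z) * e z (b \<otimes> inv a))"
proof -
  let ?g = "b \<otimes> inv a"
  have "(\<lambda>k. \<Sum>z\<in>\<Theta>. (c * z) ^ k /\<^sub>R fact k * e z ?g) sums (\<Sum>z\<in>\<Theta>. exp (c * z) * e z ?g)"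
    by (intro sums_sum sums_mult2 exp_converges)
  moreover have "(\<Sum>z\<in>\<Theta>. (c * z) ^ k /\<^sub>R fact k * e z ?g)
      = mat_pow (carrier G) (\<lambda>x y. c * M x y) k a b / of_nat (fact k)" for k
  proof -
    have "mat_pow (carrier G) (\<lambda>x y. c * M x y) k a b = c ^ k * cpow m k ?g"
      using mat_pow_cayley[of M m a b c k] M ab by blast
    then show ?thesis unfolding spectral_cpow[OF sp]
      by (simp add: scaleR_conv_of_real sum_distrib_left sum_divide_distrib power_mult_distrib field_simps)
  qed
  ultimately show ?thesis unfolding mat_exp_def by (simp add: sums_iff)
qed

text \<open>Convolution with one idempotent isolates its coefficient in the exponential, and
  \<open>e z \<one> \<noteq> 0\<close> allows a comparison with \<gamma> at the identity.\<close>

theorem periodic_iff_spectral: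
  assumes M: "\<And>a b. a \<in> carrier G \<Longrightarrow> b \<in> carrier G \<Longrightarrow> M a b = m (b \<otimes> inv a)"
    and sp: "spectral m \<Theta> e"
  shows "periodic_walk (carrier G) M \<longleftrightarrow>
    (\<exists>t::real. t \<noteq> 0 \<and> (\<exists>\<gamma>. \<forall>z\<in>\<Theta>. exp (\<i> * of_real t * z) = \<gamma>))"
proof -
  have "(\<forall>a\<in>carrier G. \<forall>b\<in>carrier G.
        mat_exp (carrier G) (\<lambda>x y. \<i> * of_real t * M x y) a b = (if a = b then \<gamma> else 0))
      \<longleftrightarrow> (\<forall>z\<in>\<Theta>. exp (\<i> * of_real t * z) = \<gamma>)" (is "?L \<longleftrightarrow> ?R") for t \<gamma>
  proof
    assume L: ?L
    define E where "E z = exp (\<i> * of_real t * z)" for z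
    have "(\<Sum>z\<in>\<Theta>. E z * e z g) = \<gamma> * unit_ga g" for g
    proof (cases "g \<in> carrier G")
      case True
      \<comment> \<open>The entries depend only on the quotient of column and row, so the row of the
        identity carries the whole exponential.\<close>
      have "(\<Sum>z\<in>\<Theta>. E z * e z g) = mat_exp (carrier G) (\<lambda>x y. \<i> * of_real t * M x y) \<one> g"
        using mat_exp_cayley[of M m \<Theta> e \<one> g "\<i> * of_real t"] M sp True by (simp add: E_def)
      also have "\<dots> = \<gamma> * unit_ga g" using L True by (auto simp: unit_ga_def)
      finally show ?thesis .
    next
      case False
      then have "e z g = 0" if "z \<in> \<Theta>" for z
        using sp that by (auto simp: spectral_def class_fun_def supported_def)
      then show ?thesis using False by (auto simp: unit_ga_def)
    qed
    then have *: "(\<lambda>g. \<Sum>z\<in>\<Theta>. E z * e z g) = (\<lambda>g. \<gamma> * unit_ga g)" by (rule ext)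
    show ?R
    proof
      fix z assume z: "z \<in> \<Theta>"
      have fin: "finite \<Theta>" using sp by (simp add: spectral_def)
      have "(\<lambda>g. \<gamma> * e z g) = conv (\<lambda>g. \<gamma> * unit_ga g) (e z)"
        using z sp by (simp add: conv_scale_left spectral_def class_fun_supported)
      also have "\<dots> = (\<lambda>g. \<Sum>w\<in>\<Theta>. E w * conv (e w) (e z) g)"
        unfolding *[symmetric] conv_sum_left by (simp add: conv_scale_left)
      also have "\<dots> = (\<lambda>g. \<Sum>w\<in>\<Theta>. if w = z then E z * e z g else 0)"
      proof (intro ext sum.cong refl)
        fix g w assume "w \<in> \<Theta>"
        then show "E w * conv (e w) (e z) g = (if w = z then E z * e z g else 0)"
          using z sp eigen_orthogonal[of m "e w" w "e z" z] by (auto simp: spectral_def)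
      qed
      also have "\<dots> = (\<lambda>g. E z * e z g)" using fin z by simp
      finally have "\<gamma> * e z \<one> = E z * e z \<one>" by (rule fun_cong)
      then show "exp (\<i> * of_real t * z) = \<gamma>" using z sp by (simp add: spectral_def E_def)
    qed
  next
    assume R: ?R
    show ?L
    proof (intro ballI)
      fix a b assume ab: "a \<in> carrier G" "b \<in> carrier G"
      have "mat_exp (carrier G) (\<lambda>x y. \<i> * of_real t * M x y) a b = (\<Sum>z\<in>\<Theta>. \<gamma> * e z (b \<otimes> inv a))"
        using mat_exp_cayley[of M m \<Theta> e a b "\<i> * of_real t"] M sp ab R by simp
      also have "\<dots> = \<gamma> * unit_ga (b \<otimes> inv a)"
        using sp unfolding spectral_def by (metis sum_distrib_left)
      also have "\<dots> = (if a = b then \<gamma> else 0)"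
      proof -
        have "b \<otimes> inv a = \<one> \<longleftrightarrow> a = b" using ab inv_solve_right' by fastforce
        then show ?thesis by (simp add: unit_ga_def)
      qed
      finally show "mat_exp (carrier G) (\<lambda>x y. \<i> * of_real t * M x y) a b = (if a = b then \<gamma> else 0)" .
    qed
  qed
  then show ?thesis unfolding periodic_walk_def by simp
qed

end

section \<open>Eigenvalues in \<open>\<int>\<surd>\<Delta>\<close>\<close>

text \<open>Writing \<tau>^2 = a/b = ab/b^2, D is the squarefree part of ab.\<close>

lemma sqrt_squarefree_form:
  fixes \<tau> :: real
  assumes "\<tau>\<^sup>2 \<in> \<rat>" "\<tau> \<noteq> 0"
  shows "\<exists>D::int. D > 0 \<and> squarefree D \<and> (\<exists>q\<in>\<rat>. \<tau> = q * sqrt (of_int D))"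
proof -
  from assms(1) obtain a b :: int where ab: "b > 0" "\<tau>\<^sup>2 = of_int a / of_int b"
    by (auto elim!: Rats_cases')
  have "\<tau>\<^sup>2 > 0" using assms(2) by simp
  then have a: "a > 0" using ab by (simp add: zero_less_divide_iff)
  define D where "D = squarefree_part (a * b)"
  define s where "s = square_part (a * b)"
  have n: "a * b = D * s\<^sup>2" unfolding D_def s_def by (rule squarefree_decompose)
  have "D * s\<^sup>2 > 0" using a ab by (simp flip: n)
  then have D: "D > 0" by (simp add: zero_less_mult_iff)
  have "\<tau>\<^sup>2 = of_int (a * b) / (of_int b)\<^sup>2" using ab by (simp add: power2_eq_square)
  also have "\<dots> = (of_int s / of_int b * sqrt (of_int D))\<^sup>2"
    unfolding n using D by (simp add: power_mult_distrib power_divide)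
  finally have "\<tau> = of_int s / of_int b * sqrt (of_int D) \<or> \<tau> = - (of_int s / of_int b) * sqrt (of_int D)"
    by (simp add: power2_eq_iff)
  moreover have "of_int s / of_int b \<in> (\<rat> :: real set)" "- (of_int s / of_int b) \<in> (\<rat> :: real set)"
    by simp_all
  moreover have "squarefree D" by (simp add: D_def)
  ultimately show ?thesis using D by blast
qed

text \<open>All powers of b divide the nonzero f. This is the step that makes a rational algebraic
  integer an integer.\<close>

lemma rational_power_denom:
  fixes a b f :: int
  assumes "coprime a b" "b > 0" "f \<noteq> 0" "\<And>k. b ^ k dvd a ^ k * f"
  shows "b = 1"
proof (rule ccontr)
  assume "b \<noteq> 1"
  then have b: "b \<ge> 2" using assms(2) by linarith
  have dvd: "b ^ k dvd f" for k
    using assms(1) assms(4)[of k] by (simp add: coprime_dvd_mult_right_iff coprime_commute)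
  define k where "k = nat \<bar>f\<bar>"
  have "b ^ k \<le> \<bar>f\<bar>" using dvd_imp_le_int[OF assms(3) dvd[of k]] by linarith
  moreover have "int k < 2 ^ k" using less_exp[of k] by (metis of_nat_less_iff of_nat_numeral of_nat_power)
  moreover have "(2::int) ^ k \<le> b ^ k" using b by (intro power_mono) auto
  ultimately show False by (simp add: k_def)
qed

lemma rat_mult_squarefree_int:
  fixes q :: real and \<Delta> :: int
  assumes "q \<in> \<rat>" "squarefree \<Delta>" "q\<^sup>2 * of_int \<Delta> \<in> \<int>"
  shows "q \<in> \<int>"
proof -
  from assms(1) obtain a b :: int where ab: "b > 0" "coprime a b" "q = of_int a / of_int b"
    by (auto elim!: Rats_cases')
  from assms(3) obtain c :: int where "q\<^sup>2 * of_int \<Delta> = of_int c" by (auto elim: Ints_cases)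
  then have "of_int (a\<^sup>2 * \<Delta>) = (of_int (c * b\<^sup>2) :: real)"
    using ab by (simp add: power_divide field_simps)
  then have "a\<^sup>2 * \<Delta> = c * b\<^sup>2" by (simp only: of_int_eq_iff)
  then have "b\<^sup>2 dvd a\<^sup>2 * \<Delta>" by simp
  moreover have "coprime (b\<^sup>2) (a\<^sup>2)" using ab(2) by (simp add: coprime_commute)
  ultimately have "b\<^sup>2 dvd \<Delta>" by (simp add: coprime_dvd_mult_right_iff)
  then have "b dvd 1" using assms(2) squarefreeD by blast
  then have "b = 1" using ab(1) by simp
  then show ?thesis using ab(3) by simp
qed

context finite_group
begin

text \<open>What is left of \<open>spectral\<close> without reality and idempotence; it also fits
  \<open>u\<close>, whose eigenvalues are purely imaginary.\<close>

definition resolution :: "('g \<Rightarrow> complex) \<Rightarrow> complex set \<Rightarrow> (complex \<Rightarrow> 'g \<Rightarrow> complex) \<Rightarrow> bool"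
  where "resolution m \<Theta> e \<longleftrightarrow> finite \<Theta> \<and> (\<lambda>g. \<Sum>z\<in>\<Theta>. e z g) = unit_ga \<and>
    (\<forall>z\<in>\<Theta>. class_fun (e z) \<and> e z \<one> \<noteq> 0 \<and> conv m (e z) = (\<lambda>g. z * e z g))"

lemma spectral_resolution: "spectral m \<Theta> e \<Longrightarrow> resolution m \<Theta> e"
  by (auto simp: spectral_def resolution_def)

lemma order_pos: "order G > 0"
  using order_gt_0_iff_finite by simp

lemma spectral_trace_nat:
  assumes "spectral m \<Theta> e"
  obtains d :: "complex \<Rightarrow> nat" where "\<And>z. z \<in> \<Theta> \<Longrightarrow> of_nat (order G) * e z \<one> = of_nat (d z)"
    "\<And>z. z \<in> \<Theta> \<Longrightarrow> d z \<noteq> 0"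
proof -
  have "\<forall>z\<in>\<Theta>. \<exists>d::nat. of_nat (order G) * e z \<one> = of_nat d"
    using assms idempotent_trace by (simp add: spectral_def)
  then obtain d where d: "\<forall>z\<in>\<Theta>. of_nat (order G) * e z \<one> = of_nat (d z)" by metis
  have "d z \<noteq> 0" if "z \<in> \<Theta>" for z
  proof
    assume "d z = 0"
    then have "of_nat (order G) * e z \<one> = (0::complex)" using d that by simp
    then have "e z \<one> = 0" using order_pos by simp
    then show False using assms that by (simp add: spectral_def)
  qed
  with d that show thesis by blast
qed

text \<open>Equal exponentials make all differences of eigenvalues integer multiples of \<tau> = 2
  pi / t. Trace zero makes the eigenvalues themselves rational multiples of \<tau>, and the trace of
  the square makes \<tau>^2 rational.\<close>

lemma spectral_periodic_rational:
  assumes m: "supported m" and sp: "spectral m \<Theta> e" and t: "t \<noteq> 0"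
    and ex: "\<And>z. z \<in> \<Theta> \<Longrightarrow> exp (\<i> * of_real t * z) = \<gamma>"
    and m1: "m \<one> = 0" and mm: "conv m m \<one> = of_nat N" "N > 0"
  shows "\<exists>D::int. D > 0 \<and> squarefree D \<and> (\<forall>z\<in>\<Theta>. \<exists>q\<in>\<rat>. z = of_real (q * sqrt (of_int D)))"
proof -
  obtain d where d: "\<And>z. z \<in> \<Theta> \<Longrightarrow> of_nat (order G) * e z \<one> = of_nat (d z)"
    using spectral_trace_nat[OF sp] by metis
  have fin: "finite \<Theta>" using sp by (simp add: spectral_def)
  have re: "z = of_real (Re z)" if "z \<in> \<Theta>" for z
    using sp that by (simp add: spectral_def of_real_Re)
  \<comment> \<open>Power moments of the spectrum with multiplicities \<open>d z\<close>; k = 0, 1,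
    2 give the dimension, the trace and the trace of the square.\<close>
  have mom: "of_nat (order G) * cpow m k \<one> = of_real (\<Sum>z\<in>\<Theta>. Re z ^ k * d z)" for k
  proof -
    have "of_nat (order G) * cpow m k \<one> = (\<Sum>z\<in>\<Theta>. z ^ k * (of_nat (order G) * e z \<one>))"
      unfolding spectral_cpow[OF sp] by (simp add: sum_distrib_left mult.left_commute)
    also have "\<dots> = (\<Sum>z\<in>\<Theta>. of_real (Re z ^ k * d z))"
      using d re by (intro sum.cong refl) (metis of_real_mult of_real_of_nat_eq of_real_power)
    finally show ?thesis by simp
  qed
  have s0: "(\<Sum>z\<in>\<Theta>. real (d z)) = real (order G)"
  proof -
    have "complex_of_real (\<Sum>z\<in>\<Theta>. real (d z)) = of_real (real (order G))"
      using mom[of 0] by (simp add: unit_ga_def)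
    then show ?thesis by (simp only: of_real_eq_iff)
  qed
  have s1: "(\<Sum>z\<in>\<Theta>. Re z * d z) = 0"
  proof -
    have "complex_of_real (\<Sum>z\<in>\<Theta>. Re z * d z) = of_real 0"
      using mom[of 1] m m1 by simp
    then show ?thesis by (simp only: of_real_eq_iff)
  qed
  have s2: "(\<Sum>z\<in>\<Theta>. (Re z)\<^sup>2 * d z) = real (order G) * real N"
  proof -
    have "of_real (\<Sum>z\<in>\<Theta>. (Re z)\<^sup>2 * d z) = of_nat (order G) * conv m m \<one>"
      using mom[of 2] m by (simp add: numeral_2_eq_2)
    also have "\<dots> = complex_of_real (real (order G) * real N)" by (simp add: mm)
    finally show ?thesis by (simp only: of_real_eq_iff)
  qed
  have "\<Theta> \<noteq> {}" using s0 order_pos by force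
  then obtain z0 where z0: "z0 \<in> \<Theta>" by auto
  define \<tau> where "\<tau> = 2 * pi / t"
  have \<tau>0: "\<tau> \<noteq> 0" using t by (simp add: \<tau>_def)
  have "\<exists>k::int. Re z = Re z0 + \<tau> * k" if z: "z \<in> \<Theta>" for z
  proof -
    have "exp (\<i> * of_real (t * (Re z - Re z0))) = exp (\<i> * of_real t * z) / exp (\<i> * of_real t * z0)"
      using re[OF z] re[OF z0] by (simp add: exp_diff[symmetric]) (metis of_real_diff right_diff_distrib mult.assoc)
    also have "\<dots> = 1" using ex[OF z] ex[OF z0] by (metis divide_self exp_not_eq_zero)
    finally have "Re (exp (\<i> * of_real (t * (Re z - Re z0)))) = 1" by simp
    then have "cos (t * (Re z - Re z0)) = 1" unfolding Re_exp by simp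
    then obtain n :: int where "t * (Re z - Re z0) = of_int n * 2 * pi" using cos_one_2pi_int by blast
    then have "Re z = Re z0 + \<tau> * n" using t by (simp add: \<tau>_def field_simps)
    then show ?thesis by blast
  qed
  then obtain k :: "complex \<Rightarrow> int" where k: "\<And>z. z \<in> \<Theta> \<Longrightarrow> Re z = Re z0 + \<tau> * k z" by metis
  \<comment> \<open>The spectrum has mean 0, so averaging \<open>Re z = Re z0 + \<tau> * k z\<close>
    expresses \<open>Re z0\<close> through \<tau>.\<close>
  define c where "c = - (\<Sum>z\<in>\<Theta>. k z * d z) / real (order G)"
  have c: "Re z0 = \<tau> * c"
  proof -
    have "0 = (\<Sum>z\<in>\<Theta>. Re z0 * d z + \<tau> * (k z * d z))"
      using s1 k by (simp add: algebra_simps)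
    also have "\<dots> = Re z0 * real (order G) + \<tau> * (\<Sum>z\<in>\<Theta>. k z * d z)"
      by (simp add: sum.distrib sum_distrib_left flip: s0)
    finally show ?thesis unfolding c_def using order_pos by (simp add: field_simps)
  qed
  have cQ: "c \<in> \<rat>" unfolding c_def by (intro Rats_divide Rats_minus_iff[THEN iffD2] Rats_of_nat Rats_of_int)
  define r where "r z = c + k z" for z
  have r: "Re z = \<tau> * r z" "r z \<in> \<rat>" if "z \<in> \<Theta>" for z
    using k[OF that] c cQ by (simp_all add: r_def algebra_simps)
  have eq: "\<tau>\<^sup>2 * (\<Sum>z\<in>\<Theta>. (r z)\<^sup>2 * d z) = real (order G) * real N"
    unfolding s2[symmetric] sum_distrib_left
    by (intro sum.cong refl) (simp add: r power_mult_distrib)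
  \<comment> \<open>Positivity of N rules out a vanishing sum of squares, so the equation can be
    solved for \<tau>^2.\<close>
  moreover have "real (order G) * real N \<noteq> 0" using order_pos mm(2) by simp
  ultimately have "\<tau>\<^sup>2 = real (order G) * real N / (\<Sum>z\<in>\<Theta>. (r z)\<^sup>2 * d z)"
    by (metis mult_zero_right nonzero_mult_div_cancel_right)
  moreover have "(\<Sum>z\<in>\<Theta>. (r z)\<^sup>2 * d z) \<in> \<rat>"
    using r by (intro Rats_sum Rats_mult Rats_power) auto
  ultimately have "\<tau>\<^sup>2 \<in> \<rat>" by simp
  from sqrt_squarefree_form[OF this \<tau>0] obtain D q where D: "D > 0" "squarefree D" "q \<in> \<rat>" "\<tau> = q * sqrt (of_int D)"
    by blast
  have "\<exists>q\<in>\<rat>. z = of_real (q * sqrt (of_int D))" if z: "z \<in> \<Theta>" for z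
  proof (rule bexI[of _ "r z * q"])
    show "z = of_real (r z * q * sqrt (of_int D))" using re[OF z] r(1)[OF z] D(4) by (simp add: mult_ac)
  qed (use r z D in auto)
  with D show ?thesis by blast
qed

lemma resolution_nonzero_component:
  assumes "resolution m \<Theta> e" "supported x" "x \<noteq> (\<lambda>_. 0)"
  shows "\<exists>z\<in>\<Theta>. conv (e z) x \<noteq> (\<lambda>_. 0)"
proof (rule ccontr)
  assume "\<not> ?thesis"
  then have 0: "conv (e z) x g = 0" if "z \<in> \<Theta>" for z g using that by auto
  have "x = conv (\<lambda>g. \<Sum>z\<in>\<Theta>. e z g) x" using assms by (simp add: resolution_def)
  also have "\<dots> = (\<lambda>_. 0)" using 0 by (simp add: conv_sum_left)
  finally show False using assms(3) by blast
qed

lemma eigen_in_spectrum: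
  assumes res: "resolution m \<Theta> e" and x: "supported x" "x \<noteq> (\<lambda>_. 0)" "conv m x = (\<lambda>g. c * x g)"
  shows "c \<in> \<Theta>"
proof -
  obtain z where z: "z \<in> \<Theta>" "conv (e z) x \<noteq> (\<lambda>_. 0)"
    using resolution_nonzero_component[OF res x(1,2)] by blast
  have e: "class_fun (e z)" "conv m (e z) = (\<lambda>g. z * e z g)" using res z by (auto simp: resolution_def)
  have "(\<lambda>g. z * conv (e z) x g) = conv (conv m (e z)) x" by (simp add: e conv_scale_left)
  also have "\<dots> = conv (e z) (conv m x)" using conv_commute[OF e(1), of m] by (simp add: conv_assoc)
  also have "\<dots> = (\<lambda>g. c * conv (e z) x g)" by (simp add: x conv_scale_right)
  finally have "z = c" using z(2) by (auto simp: fun_eq_iff)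
  with z show ?thesis by simp
qed

text \<open>The eigenvector is a nonvanishing product of two central components; m and m' can act
  through either factor.\<close>

lemma joint_eigenvector:
  assumes "resolution m A f" "resolution m' B h" "\<alpha> \<in> A"
  shows "\<exists>\<beta>\<in>B. \<exists>x. supported x \<and> x \<noteq> (\<lambda>_. 0) \<and> conv m x = (\<lambda>g. \<alpha> * x g) \<and> conv m' x = (\<lambda>g. \<beta> * x g)"
proof -
  have f: "class_fun (f \<alpha>)" "f \<alpha> \<noteq> (\<lambda>_. 0)" "conv m (f \<alpha>) = (\<lambda>g. \<alpha> * f \<alpha> g)"
    using assms by (auto simp: resolution_def)
  obtain \<beta> where b: "\<beta> \<in> B" "conv (h \<beta>) (f \<alpha>) \<noteq> (\<lambda>_. 0)"
    using resolution_nonzero_component[OF assms(2) class_fun_supported[OF f(1)] f(2)] by blast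
  have h: "class_fun (h \<beta>)" "conv m' (h \<beta>) = (\<lambda>g. \<beta> * h \<beta> g)"
    using assms b by (auto simp: resolution_def)
  have "conv m (conv (h \<beta>) (f \<alpha>)) = conv (conv m (f \<alpha>)) (h \<beta>)"
    using conv_commute[OF f(1), of "h \<beta>"] by (simp add: conv_assoc)
  also have "\<dots> = (\<lambda>g. \<alpha> * conv (h \<beta>) (f \<alpha>) g)"
    using conv_commute[OF f(1), of "h \<beta>"] by (simp add: f(3) conv_scale_left)
  finally have "conv m (conv (h \<beta>) (f \<alpha>)) = (\<lambda>g. \<alpha> * conv (h \<beta>) (f \<alpha>) g)" .
  moreover have "conv m' (conv (h \<beta>) (f \<alpha>)) = (\<lambda>g. \<beta> * conv (h \<beta>) (f \<alpha>) g)"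
    using h(2) by (simp add: conv_scale_left flip: conv_assoc)
  ultimately show ?thesis using b conv_supported by blast
qed

lemma conv_cnj: "conv (\<lambda>g. cnj (x g)) (\<lambda>g. cnj (y g)) = (\<lambda>g. cnj (conv x y g))"
  by (auto simp: conv_def)

text \<open>Real eigenvalues survive conjugation; this gives \<i> u + v and - \<i> u + v one common
  \<Theta>.\<close>

lemma spectral_cnj:
  assumes "spectral m \<Theta> e"
  shows "spectral (\<lambda>g. cnj (m g)) \<Theta> (\<lambda>z g. cnj (e z g))"
proof -
  have "(\<lambda>g. \<Sum>z\<in>\<Theta>. cnj (e z g)) = unit_ga"
  proof
    fix g
    have "(\<Sum>z\<in>\<Theta>. cnj (e z g)) = cnj (\<Sum>z\<in>\<Theta>. e z g)" by simp
    also have "\<dots> = unit_ga g"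
      using assms by (simp add: spectral_def unit_ga_def fun_eq_iff)
    finally show "(\<Sum>z\<in>\<Theta>. cnj (e z g)) = unit_ga g" .
  qed
  then show ?thesis
    using assms by (auto simp: spectral_def conv_cnj class_fun_def supported_def Reals_cnj_iff)
qed

text \<open>Transfers annihilation from the complex spectrum to an identity over \<open>int\<close>,
  which can then be reduced modulo p.\<close>

lemma ev_int_eq_zero_iff:
  fixes w :: "'g \<Rightarrow> int"
  assumes "resolution (\<lambda>g. of_int (w g)) A f"
  shows "ev p w = (\<lambda>_. 0) \<longleftrightarrow> (\<forall>a\<in>A. poly (map_poly of_int p) a = 0)"
proof -
  let ?W = "\<lambda>g. of_int (w g) :: complex" and ?p = "map_poly of_int p :: complex poly"
  have "ev p w = (\<lambda>_. 0) \<longleftrightarrow> (\<lambda>g. of_int (ev p w g)) = (\<lambda>_. 0 :: complex)" by (auto simp: fun_eq_iff)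
  also have "\<dots> \<longleftrightarrow> ev ?p ?W = (\<lambda>_. 0)" by (simp only: ev_of_int)
  also have "\<dots> \<longleftrightarrow> (\<forall>a\<in>A. poly ?p a = 0)"
  proof
    assume 0: "ev ?p ?W = (\<lambda>_. 0)"
    show "\<forall>a\<in>A. poly ?p a = 0"
    proof
      fix a assume a: "a \<in> A"
      have "(\<lambda>_. 0) = (\<lambda>g. poly ?p a * f a g)"
        using ev_eigen[of ?W "f a" a ?p] assms a 0 by (simp add: resolution_def class_fun_supported)
      then have "poly ?p a * f a \<one> = 0" by (metis (mono_tags))
      then show "poly ?p a = 0" using assms a by (simp add: resolution_def)
    qed
  next
    assume 0: "\<forall>a\<in>A. poly ?p a = 0"
    have "ev ?p ?W = conv (ev ?p ?W) (\<lambda>g. \<Sum>a\<in>A. f a g)" using assms by (simp add: resolution_def)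
    also have "\<dots> = (\<lambda>g. \<Sum>a\<in>A. conv (ev ?p ?W) (f a) g)" by (rule conv_sum_right)
    also have "\<dots> = (\<lambda>_. 0)"
    proof
      fix g
      have "conv (ev ?p ?W) (f a) g = 0" if a: "a \<in> A" for a
        using ev_eigen[of ?W "f a" a ?p] assms a 0 by (simp add: resolution_def class_fun_supported)
      then show "(\<Sum>a\<in>A. conv (ev ?p ?W) (f a) g) = 0" by simp
    qed
    finally show "ev ?p ?W = (\<lambda>_. 0)" .
  qed
  finally show ?thesis .
qed

text \<open>If a^2 = n/b in lowest terms, stripping the factor b X^2 - n from an integral
  annihilator leaves a nonzero integral vector on which w^2 acts as n/b. Iteration makes every b^k
  divide n^k times a fixed nonzero entry.\<close>

lemma eigenvalue_square_int:
  fixes w :: "'g \<Rightarrow> int"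
  assumes w: "class_fun w" and res: "resolution (\<lambda>g. of_int (w g)) A f"
    and rat: "\<And>a. a \<in> A \<Longrightarrow> a\<^sup>2 \<in> \<rat>" and a: "a \<in> A"
  shows "a\<^sup>2 \<in> \<int>"
proof -
  have finA: "finite A" using res by (simp add: resolution_def)
  define R :: "rat set" where "R = {r. \<exists>a\<in>A. a\<^sup>2 = of_rat r}"
  have finR: "finite R"
  proof (rule finite_imageD[of "of_rat :: rat \<Rightarrow> complex"])
    show "finite ((of_rat :: rat \<Rightarrow> complex) ` R)"
      by (rule finite_subset[of _ "(\<lambda>a. a\<^sup>2) ` A"]) (use finA in \<open>force simp: R_def\<close>)+
  qed (simp add: inj_on_def)
  define pl where "pl r = [:- fst (quotient_of r), 0, snd (quotient_of r):]" for r
  have pl: "poly (map_poly of_int (pl r)) z = of_int (snd (quotient_of r)) * (z\<^sup>2 - of_rat r)" for r and z :: complex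
  proof -
    have "(of_rat r :: complex) = of_int (fst (quotient_of r)) / of_int (snd (quotient_of r))"
      using arg_cong[OF quotient_of_div[OF surjective_pairing], of "of_rat :: rat \<Rightarrow> complex" r]
      by (simp add: of_rat_divide)
    moreover have "snd (quotient_of r) \<noteq> 0" using quotient_of_denom_pos'[of r] by simp
    ultimately show ?thesis by (simp add: pl_def map_poly_pCons field_simps power2_eq_square)
  qed
  have map_prod: "map_poly of_int (\<Prod>r\<in>B. pl r) = (\<Prod>r\<in>B. map_poly of_int (pl r) :: complex poly)" for B
    by (induction B rule: infinite_finite_induct) (simp_all add: of_int_poly_hom.hom_mult)
  from rat[OF a] obtain r where r: "a\<^sup>2 = of_rat r" by (auto elim: Rats_cases)
  then have rR: "r \<in> R" using a by (auto simp: R_def)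
  \<comment> \<open>The remaining factors vanish only where the square differs from r, so F is
    nonzero at a.\<close>
  define F where "F = (\<Prod>s\<in>R - {r}. pl s)"
  have all0: "ev (pl r * F) w = (\<lambda>_. 0)"
  proof -
    have "pl r * F = (\<Prod>s\<in>R. pl s)" unfolding F_def using finR rR by (simp add: prod.remove)
    moreover have "poly (map_poly of_int (\<Prod>s\<in>R. pl s)) b = (0::complex)" if b: "b \<in> A" for b
    proof -
      obtain s where "b\<^sup>2 = of_rat s" using rat[OF b] by (auto elim: Rats_cases)
      then show ?thesis using b finR unfolding map_prod poly_prod
        by (intro prod_zero) (auto simp: pl R_def)
    qed
    ultimately show ?thesis using ev_int_eq_zero_iff[OF res] by simp
  qed
  have "poly (map_poly of_int F) a \<noteq> (0::complex)"
    unfolding F_def map_prod poly_prod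
  proof (subst prod_zero_iff)
    have "snd (quotient_of s) \<noteq> 0" for s using quotient_of_denom_pos'[of s] by simp
    then show "\<not> (\<exists>s\<in>R - {r}. poly (map_poly of_int (pl s)) a = 0)"
      by (auto simp: pl r)
  qed (use finR in simp)
  then have "ev F w \<noteq> (\<lambda>_. 0)" using ev_int_eq_zero_iff[OF res] a by blast
  then obtain g where g: "ev F w g \<noteq> 0" by auto
  obtain n b where nb: "quotient_of r = (n, b)" by (cases "quotient_of r")
  have b: "b > 0" "coprime n b" using nb quotient_of_denom_pos quotient_of_coprime by auto
  have step: "(\<lambda>g. n * ev F w g) = (\<lambda>g. b * ev ([:0, 0, 1:] * F) w g)"
  proof -
    have "pl r = smult b [:0, 0, 1:] - [:n:]" by (simp add: pl_def nb)
    then have eq: "pl r * F = smult b ([:0, 0, 1:] * F) - smult n F"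
      by (simp add: left_diff_distrib)
    have "(\<lambda>g. b * ev ([:0, 0, 1:] * F) w g - n * ev F w g) = (\<lambda>_. 0)"
      using all0 unfolding eq ev_diff ev_smult .
    then show ?thesis by (simp only: fun_eq_iff eq_iff_diff_eq_0[symmetric] right_minus_eq) auto
  qed
  have pw: "n ^ k * ev F w h = b ^ k * ev ([:0, 0, 1:] ^ k * F) w h" for k h
  proof (induction k arbitrary: h)
    case (Suc k)
    have IH: "(\<lambda>h. b ^ k * ev ([:0, 0, 1:] ^ k * F) w h) = (\<lambda>h. n ^ k * ev F w h)"
      using Suc by auto
    have "(\<lambda>h. b ^ k * ev ([:0, 0, 1:] ^ Suc k * F) w h)
        = conv (ev [:0, 0, 1:] w) (\<lambda>h. b ^ k * ev ([:0, 0, 1:] ^ k * F) w h)"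
      unfolding power_Suc mult.assoc ev_mult[of "[:0, 0, 1:]"] conv_scale_right ..
    also have "\<dots> = (\<lambda>h. n ^ k * ev ([:0, 0, 1:] * F) w h)"
      unfolding IH unfolding conv_scale_right ev_mult ..
    finally have "b ^ k * ev ([:0, 0, 1:] ^ Suc k * F) w h = n ^ k * ev ([:0, 0, 1:] * F) w h"
      by (rule fun_cong)
    moreover have "n * ev F w h = b * ev ([:0, 0, 1:] * F) w h" using step by (rule fun_cong)
    ultimately show ?case by (metis mult.assoc mult.left_commute power_Suc)
  qed simp
  have "b = 1"
    by (rule rational_power_denom[OF b(2,1) g]) (metis pw dvd_triv_left)
  then have "r = of_int n" using nb quotient_of_div by fastforce
  then show ?thesis using r by simp
qed

text \<open>As \<Delta> is squarefree, a rational q with q^2 \<Delta> integral is an integer; this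
  gives the annihilator the shape needed for the reduction modulo p.\<close>

lemma int_annihilator:
  fixes w :: "'g \<Rightarrow> int"
  assumes w: "class_fun w" and res: "resolution (\<lambda>g. of_int (w g)) A f"
    and sqf: "squarefree \<Delta>"
    and sq: "\<And>a. a \<in> A \<Longrightarrow> \<exists>q\<in>\<rat>. a\<^sup>2 = of_real (q\<^sup>2 * of_int \<Delta>)"
  shows "\<exists>B::int set. finite B \<and> ev ([:0, 1:] * (\<Prod>b\<in>B. [:- (b\<^sup>2 * \<Delta>), 0, 1:])) w = (\<lambda>_. 0)"
proof -
  have finA: "finite A" using res by (simp add: resolution_def)
  have "a\<^sup>2 \<in> \<rat>" if a: "a \<in> A" for a
  proof -
    obtain q where q: "q \<in> \<rat>" "a\<^sup>2 = of_real (q\<^sup>2 * of_int \<Delta>)" using sq[OF a] by blast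
    then obtain n b :: int where "q = of_int n / of_int b" by (auto elim: Rats_cases')
    then have "a\<^sup>2 = (of_int n / of_int b)\<^sup>2 * of_int \<Delta>" using q(2) by simp
    then show ?thesis by (simp add: Rats_mult Rats_power Rats_divide)
  qed
  then have int: "a\<^sup>2 \<in> \<int>" if "a \<in> A" for a using eigenvalue_square_int[OF w res] that by blast
  have "\<exists>b::int. a\<^sup>2 = of_int (b\<^sup>2 * \<Delta>)" if a: "a \<in> A" for a
  proof -
    obtain q where q: "q \<in> \<rat>" "a\<^sup>2 = of_real (q\<^sup>2 * of_int \<Delta>)" using sq[OF a] by blast
    obtain c where "a\<^sup>2 = of_int c" using int[OF a] by (auto elim: Ints_cases)
    then have "complex_of_real (q\<^sup>2 * of_int \<Delta>) = of_real (of_int c)" using q(2) by simp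
    then have "q\<^sup>2 * of_int \<Delta> = of_int c" by (simp only: of_real_eq_iff)
    then have "q \<in> \<int>" using rat_mult_squarefree_int[OF q(1) sqf] by simp
    then obtain b where "q = of_int b" by (auto elim: Ints_cases)
    then show ?thesis using q(2) by auto
  qed
  then obtain b :: "complex \<Rightarrow> int" where b: "\<And>a. a \<in> A \<Longrightarrow> a\<^sup>2 = of_int ((b a)\<^sup>2 * \<Delta>)" by metis
  define B where "B = b ` A"
  have finB: "finite B" using finA by (simp add: B_def)
  have map_prod: "map_poly of_int (\<Prod>b\<in>C. [:- (b\<^sup>2 * \<Delta>), 0, 1:])
      = (\<Prod>b\<in>C. [:- of_int (b\<^sup>2 * \<Delta>), 0, 1:] :: complex poly)" for C
  proof (induction C rule: infinite_finite_induct)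
    case (insert x C)
    show ?case
      unfolding prod.insert[OF insert.hyps] of_int_poly_hom.hom_mult insert.IH by (simp add: map_poly_pCons)
  qed simp_all
  have "ev ([:0, 1:] * (\<Prod>b\<in>B. [:- (b\<^sup>2 * \<Delta>), 0, 1:])) w = (\<lambda>_. 0)"
    unfolding ev_int_eq_zero_iff[OF res]
  proof
    fix a assume a: "a \<in> A"
    have "(\<Prod>c\<in>B. poly [:- of_int (c\<^sup>2 * \<Delta>), 0, 1:] a) = 0"
      using a b[OF a] finB by (intro prod_zero) (auto simp: B_def power2_eq_square intro!: bexI[of _ a])
    then show "poly (map_poly of_int ([:0, 1:] * (\<Prod>b\<in>B. [:- (b\<^sup>2 * \<Delta>), 0, 1:]))) a = 0"
      unfolding of_int_poly_hom.hom_mult poly_mult map_prod poly_prod by simp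
  qed
  with finB show ?thesis by blast
qed

text \<open>By Cauchy's theorem the exponent and the order have the same prime divisors.\<close>

lemma coprime_order_of_expo:
  assumes "coprime k expo"
  shows "coprime k (order G)"
proof (rule ccontr)
  assume "\<not> coprime k (order G)"
  then have "gcd k (order G) \<noteq> 1" unfolding coprime_iff_gcd_eq_1 .
  then obtain p where p: "prime p" "p dvd gcd k (order G)" using prime_factor_nat[of "gcd k (order G)"] by auto
  then have "p dvd k" "p dvd expo" using prime_dvd_expo_iff[OF p(1)] by auto
  then have "p dvd 1" using coprime_common_divisor[OF assms] by auto
  then show False using p(1) by simp
qed

lemma eq_Legendre_power:
  fixes w :: "'g \<Rightarrow> int"
  assumes w: "class_fun w" "\<And>g. w g \<in> {-1, 0, 1}"
    and ann: "finite B" "ev ([:0, 1:] * (\<Prod>b\<in>B. [:- (b\<^sup>2 * \<Delta>), 0, 1:])) w = (\<lambda>_. 0)"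
    and p: "prime p" "odd p" "\<not> p dvd order G" and g: "g \<in> carrier G"
  shows "w g = Legendre \<Delta> (int p) * w (g [^] p)"
proof (rule small_cong_imp_eq)
  have p2: "p > 2" using p odd_prime_gt_2 by blast
  have "[w g = \<Delta> ^ ((p - 1) div 2) * w (g [^] p)] (mod int p)"
    by (rule frobenius_scalar_cong[OF w(1) ann p g])
  moreover have "[\<Delta> ^ ((p - 1) div 2) * w (g [^] p) = Legendre \<Delta> (int p) * w (g [^] p)] (mod int p)"
    by (intro cong_mult cong_refl cong_sym[OF euler_criterion[OF p(1) p2]])
  ultimately show "[w g = Legendre \<Delta> (int p) * w (g [^] p)] (mod int p)" by (rule cong_trans)
  show "p > 2" by (rule p2)
  show "Legendre \<Delta> (int p) * w (g [^] p) \<in> {- 1, 0, 1}"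
    using w(2)[of "g [^] p"] Legendre_range[of \<Delta> "int p"] by auto
qed (rule w(2))

text \<open>Both the character and the composition of power maps are multiplicative, so the law at
  primes spreads to odd k by factoring. A nonzero value of w is what forces \<Delta> to be
  admissible.\<close>

theorem power_sign_character:
  fixes w :: "'g \<Rightarrow> int"
  assumes w: "class_fun w" "\<And>g. w g \<in> {-1, 0, 1}" and nz: "w g0 \<noteq> 0"
    and ann: "finite B" "ev ([:0, 1:] * (\<Prod>b\<in>B. [:- (b\<^sup>2 * \<Delta>), 0, 1:])) w = (\<lambda>_. 0)"
    and sqf: "squarefree \<Delta>"
  shows "\<exists>w0 v S. admissible_rep expo \<Delta> w0 v S \<and>
    (\<forall>g\<in>carrier G. \<forall>k\<in>units_mod expo. w (g [^] k) = sgn_char w0 v S k * w g)"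
proof -
  note leg = eq_Legendre_power[OF w ann]
  have g0: "g0 \<in> carrier G" using nz w(1) by (auto simp: class_fun_def supported_def)
  obtain w0 v S where S: "odd_primes S" and \<Delta>: "\<Delta> = disc_rep w0 v S"
    using squarefree_disc_rep[OF sqf] .
  \<comment> \<open>A prime of \<open>S\<close> not dividing |G| would have Legendre symbol 0 and
    make w vanish at g0.\<close>
  have Sdiv: "S \<subseteq> odd_prime_divs expo"
  proof
    fix p assume pS: "p \<in> S"
    then have p: "prime p" "odd p" using S by (auto simp: odd_primes_def)
    have "p dvd order G"
    proof (rule ccontr)
      assume np: "\<not> p dvd order G"
      have "int p dvd \<Delta>" unfolding \<Delta> using prime_dvd_disc_rep[OF S p(1)] pS by simp
      then have "Legendre \<Delta> (int p) = 0" by (simp add: Legendre_eq_0_iff)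
      then show False using leg[OF p np g0] nz by simp
    qed
    then show "p \<in> odd_prime_divs expo"
      using p prime_dvd_expo_iff by (simp add: odd_prime_divs_def)
  qed
  have pw: "w g = sgn_char w0 v S k * w (g [^] k)"
    if "odd k" "coprime k (order G)" "g \<in> carrier G" for k g
    using that
  proof (induction k arbitrary: g rule: less_induct)
    case (less k)
    show ?case
    proof (cases "k = 1")
      case True
      then show ?thesis using less.prems sgn_char_one[OF S, of w0 v] by simp
    next
      case False
      then obtain p where p: "prime p" "p dvd k" using prime_factor_nat by blast
      then obtain l where l: "k = p * l" by (auto simp: dvd_def)
      have odd: "odd p" "odd l" using less.prems(1) l by auto
      have cop: "coprime p (order G)" "coprime l (order G)" using less.prems(2) l by auto
      have np: "\<not> p dvd order G" using cop(1) p(1) by (metis coprime_common_divisor dvd_refl not_prime_unit)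
      have "l < k" using l prime_gt_1_nat[OF p(1)] odd_pos[OF odd(2)] by simp
      have pS: "p \<notin> S" using Sdiv np prime_dvd_expo_iff[OF p(1)] by (auto simp: odd_prime_divs_def)
      have "w g = sgn_char w0 v S p * w (g [^] p)"
        using leg[OF p(1) odd(1) np less.prems(3)] Legendre_disc_rep[OF S p(1) odd(1) pS] by (simp add: \<Delta>)
      also have "w (g [^] p) = sgn_char w0 v S l * w ((g [^] p) [^] l)"
        using less.IH[OF \<open>l < k\<close> odd(2) cop(2)] less.prems(3) by simp
      also have "(g [^] p) [^] l = g [^] k" using less.prems(3) by (simp add: nat_pow_pow l)
      finally show ?thesis using sgn_char_mult[OF S, of w0 v p l] odd l by simp
    qed
  qed
  \<comment> \<open>A k that is 1 modulo the exponent has trivial power map, so its sign cannot be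
    -1.\<close>
  have adm: "admissible_rep expo \<Delta> w0 v S"
  proof (rule ccontr)
    assume "\<not> ?thesis"
    then obtain k where k: "odd k" "[k = 1] (mod expo)" "sgn_char w0 v S k = -1"
      using exists_sgn_char_minus_one_cong_1[OF expo_pos Sdiv] unfolding \<Delta> by blast
    have "coprime k expo" using k(2) by (metis cong_imp_coprime cong_sym coprime_1_left)
    then have "w g0 = sgn_char w0 v S k * w (g0 [^] k)"
      using pw[OF k(1) coprime_order_of_expo g0] by blast
    moreover have "g0 [^] k = g0" using pow_cong_expo[OF g0 k(2)] g0 by simp
    ultimately show False using k(3) nz by simp
  qed
  have "w (g [^] k) = sgn_char w0 v S k * w g" if g: "g \<in> carrier G" and k: "k \<in> units_mod expo" for g k
  proof -
    have cop: "coprime k expo" using k by (simp add: units_mod_def)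
    \<comment> \<open>An even unit occurs only for an odd exponent; adding the exponent makes it odd
      and changes neither the power map nor the character.\<close>
    define k' where "k' = (if odd k then k else k + expo)"
    have cong: "[k' = k] (mod expo)" by (simp add: k'_def cong_def)
    have "odd k'"
    proof (cases "odd k")
      case False
      then have "odd expo" using cop by (metis coprime_common_divisor odd_one)
      then show ?thesis using False by (simp add: k'_def)
    qed (simp add: k'_def)
    moreover have cop': "coprime k' expo" using cop cong by (metis cong_imp_coprime cong_sym)
    ultimately have "w g = sgn_char w0 v S k' * w (g [^] k')"
      using pw coprime_order_of_expo g by blast
    also have "sgn_char w0 v S k' = sgn_char w0 v S k" by (rule sgn_char_cong[OF expo_pos adm cong])
    also have "g [^] k' = g [^] k" by (rule pow_cong_expo[OF g cong])
    finally have eq: "w g = sgn_char w0 v S k * w (g [^] k)" .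
    have "sgn_char w0 v S k = 1 \<or> sgn_char w0 v S k = -1"
      by (rule sgn_char_unit_pm1[OF expo_pos adm k])
    then show ?thesis using eq by auto
  qed
  with adm show ?thesis by blast
qed

end

section \<open>Periodicity implies the class condition\<close>

locale mixed_cayley = finite_group G for G :: "('g, 'b) monoid_scheme" (structure) +
  fixes Ci C1 Cm1 :: "'g set"
  assumes Ci: "Ci \<subseteq> carrier G - {\<one>}" and C1: "C1 \<subseteq> carrier G - {\<one>}" and Cm1: "Cm1 \<subseteq> carrier G - {\<one>}"
    and conj_Ci: "conj_closed G Ci" and conj_C1: "conj_closed G C1" and conj_Cm1: "conj_closed G Cm1"
    and disj_Ci: "Ci \<inter> inv_set G Ci = {}" and disj_C: "C1 \<inter> Cm1 = {}"
    and inv_C1: "inv_set G C1 = C1" and inv_Cm1: "inv_set G Cm1 = Cm1"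
begin

definition u :: "'g \<Rightarrow> int"
  where "u g = (if g \<in> Ci then 1 else 0) - (if g \<in> inv_set G Ci then 1 else 0)"

definition v :: "'g \<Rightarrow> int"
  where "v g = (if g \<in> C1 then 1 else 0) - (if g \<in> Cm1 then 1 else 0)"

text \<open>Both \<open>mi\<close> and \<open>mr\<close> are self-adjoint, since \<open>u\<close> is
  odd and \<open>v\<close> even under inversion.\<close>

definition mi :: "'g \<Rightarrow> complex" where "mi g = \<i> * of_int (u g)"

definition mr :: "'g \<Rightarrow> complex" where "mr g = of_int (v g)"

definition m :: "'g \<Rightarrow> complex" where "m g = mi g + mr g"

lemma inv_set_iff: "C \<subseteq> carrier G \<Longrightarrow> g \<in> carrier G \<Longrightarrow> g \<in> inv_set G C \<longleftrightarrow> inv g \<in> C"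
proof
  assume C: "C \<subseteq> carrier G" "g \<in> carrier G" "g \<in> inv_set G C"
  then obtain h where "h \<in> C" "g = inv h" by (auto simp: inv_set_def)
  then show "inv g \<in> C" using C by auto
next
  assume C: "C \<subseteq> carrier G" "g \<in> carrier G" "inv g \<in> C"
  then have "g = inv (inv g)" by simp
  then show "g \<in> inv_set G C" unfolding inv_set_def using C(3) by (rule image_eqI)
qed

lemma inv_set_carrier: "C \<subseteq> carrier G \<Longrightarrow> inv_set G C \<subseteq> carrier G"
  unfolding inv_set_def by auto

lemma conj_closed_mult_commute:
  assumes "conj_closed G C" "g \<in> carrier G" "h \<in> carrier G"
  shows "g \<otimes> h \<in> C \<longleftrightarrow> h \<otimes> g \<in> C"
proof -
  have "h \<otimes> g \<in> C" if "g \<otimes> h \<in> C" "g \<in> carrier G" "h \<in> carrier G" for g h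
  proof -
    have "inv g \<otimes> (g \<otimes> h) \<otimes> inv (inv g) \<in> C"
      using assms(1) that unfolding conj_closed_def by blast
    then show ?thesis using that by simp
  qed
  then show ?thesis using assms by blast
qed

lemma sub: "Ci \<subseteq> carrier G" "C1 \<subseteq> carrier G" "Cm1 \<subseteq> carrier G" "inv_set G Ci \<subseteq> carrier G"
  using Ci C1 Cm1 inv_set_carrier by blast+

lemma class_fun_u: "class_fun u"
proof -
  have "supported u" using sub by (auto simp: supported_def u_def)
  moreover have "u (g \<otimes> h) = u (h \<otimes> g)" if gh: "g \<in> carrier G" "h \<in> carrier G" for g h
  proof -
    have "g \<otimes> h \<in> inv_set G Ci \<longleftrightarrow> h \<otimes> g \<in> inv_set G Ci"
      using gh sub conj_closed_mult_commute[OF conj_Ci, of "inv h" "inv g"]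
      by (simp add: inv_set_iff inv_mult_group)
    then show ?thesis using conj_closed_mult_commute[OF conj_Ci gh] by (simp add: u_def)
  qed
  ultimately show ?thesis by (simp add: class_fun_def)
qed

lemma class_fun_v: "class_fun v"
proof -
  have "supported v" using sub by (auto simp: supported_def v_def)
  then show ?thesis
    using conj_closed_mult_commute[OF conj_C1] conj_closed_mult_commute[OF conj_Cm1]
    by (simp add: class_fun_def v_def)
qed

lemma class_fun_of_int: "class_fun x \<Longrightarrow> class_fun (\<lambda>g. of_int (x g))"
  by (simp add: class_fun_def supported_def)

lemma class_fun_m: "class_fun mi" "class_fun mr" "class_fun m"
proof -
  show *: "class_fun mi" "class_fun mr"
    using class_fun_scale[OF class_fun_of_int[OF class_fun_u]] class_fun_of_int[OF class_fun_v]
    unfolding mi_def[abs_def] mr_def[abs_def] by blast+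
  show "class_fun m" unfolding m_def[abs_def] using class_fun_add[OF *] .
qed

lemma u_inv: "g \<in> carrier G \<Longrightarrow> u (inv g) = - u g"
  using sub by (simp add: u_def inv_set_iff)

lemma v_inv: "g \<in> carrier G \<Longrightarrow> v (inv g) = v g"
  using inv_set_iff[OF sub(2), of g] inv_set_iff[OF sub(3), of g] inv_C1 inv_Cm1 by (simp add: v_def)

lemma u_range: "u g \<in> {-1, 0, 1}" and v_range: "v g \<in> {-1, 0, 1}"
  by (auto simp: u_def v_def)

lemma u_eq_1_iff: "u g = 1 \<longleftrightarrow> g \<in> Ci"
  using disj_Ci by (auto simp: u_def)

lemma v_eq_1_iff: "v g = 1 \<longleftrightarrow> g \<in> C1" and v_eq_m1_iff: "v g = -1 \<longleftrightarrow> g \<in> Cm1"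
  using disj_C by (auto simp: v_def)

lemma star_m: "star mi = mi" "star mr = mr" "star m = m"
proof -
  show "star mi = mi" "star mr = mr" "star m = m"
    using class_fun_m[THEN class_fun_supported]
    by (auto simp: star_def mi_def mr_def m_def u_inv v_inv fun_eq_iff supported_def)
qed

lemma matrix_eq:
  "a \<in> carrier G \<Longrightarrow> b \<in> carrier G \<Longrightarrow> mixed_cayley_mat G Ci C1 Cm1 a b = m (b \<otimes> inv a)"
  by (simp add: mixed_cayley_mat_def Defs.adj_mat_def m_def mi_def mr_def u_def v_def)

lemma m_one: "m \<one> = 0"
proof -
  have "\<one> \<notin> inv_set G Ci" using inv_set_iff[OF sub(1) one_closed] Ci by auto
  then show ?thesis using Ci C1 Cm1 by (auto simp: m_def mi_def mr_def u_def v_def)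
qed

text \<open>The cross terms cancel because \<open>u\<close> changes sign under inversion. The value
  is positive unless all three connection sets are empty.\<close>

lemma conv_m_m_one: "conv m m \<one> = of_nat (nat (\<Sum>g\<in>carrier G. (u g)\<^sup>2 + (v g)\<^sup>2))"
proof -
  have "conv m m \<one> = (\<Sum>g\<in>carrier G. m g * m (inv g))" by (simp add: conv_def)
  also have "\<dots> = (\<Sum>g\<in>carrier G. of_int ((u g)\<^sup>2 + (v g)\<^sup>2))"
    by (intro sum.cong refl) (simp add: m_def mi_def mr_def u_inv v_inv algebra_simps power2_eq_square)
  also have "\<dots> = of_int (\<Sum>g\<in>carrier G. (u g)\<^sup>2 + (v g)\<^sup>2)" by simp
  finally show ?thesis by (simp add: sum_nonneg)
qed

lemma union_of_classes_empty: "union_of_classes G \<Delta> {}"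
  by (simp add: union_of_classes_def)

lemma union_of_classes_level_set:
  fixes w :: "'g \<Rightarrow> int"
  assumes w: "class_fun w" and adm: "admissible_rep expo \<Delta> w0 w' S"
    and pw: "\<And>g k. g \<in> carrier G \<Longrightarrow> k \<in> units_mod expo \<Longrightarrow> w (g [^] k) = sgn_char w0 w' S k * w g"
    and C: "\<And>g. g \<in> C \<longleftrightarrow> w g = c"
  shows "union_of_classes G \<Delta> C"
  unfolding union_of_classes_def
proof (intro ballI impI)
  fix g h assume g: "g \<in> carrier G" and h: "h \<in> carrier G" and "equiv_Delta G \<Delta> g h"
  then obtain k x where k: "k \<in> H_set expo \<Delta>" and x: "x \<in> carrier G" "g = x \<otimes> h [^] k \<otimes> inv x"
    by (auto simp: equiv_Delta_def Defs.conjugate_def)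
  have k': "k \<in> units_mod expo" "sgn_char w0 w' S k = 1"
    using k unfolding H_set_eq[OF expo_pos adm] by auto
  have "w g = w (h [^] k)" using class_fun_conj[OF w, of "h [^] k" x] h x by simp
  also have "\<dots> = w h" using pw[OF h k'(1)] k'(2) by simp
  finally show "g \<in> C \<longleftrightarrow> h \<in> C" using C by simp
qed

text \<open>For empty C1 and Cm1 the condition still asks for a unit outside H_D; any such unit then
  works.\<close>

lemma exists_unit_not_H:
  assumes "admissible expo D" "D \<noteq> 1"
  shows "\<exists>k. k \<in> units_mod expo - H_set expo D"
proof -
  obtain w0 w' S where adm: "admissible_rep expo D w0 w' S" using assms(1) by (auto simp: admissible_def)
  then obtain k where "k \<in> units_mod expo" "sgn_char w0 w' S k = -1"
    using exists_sgn_char_minus_one[OF expo_pos adm assms(2)] by blast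
  then show ?thesis unfolding H_set_eq[OF expo_pos adm] by auto
qed

definition condition :: "int \<Rightarrow> bool"
  where "condition D \<longleftrightarrow> D > 0 \<and> squarefree D \<and>
       (if admissible expo (- D) then union_of_classes G (- D) Ci else Ci = {}) \<and>
       (if admissible expo D
        then union_of_classes G D C1 \<and> union_of_classes G D Cm1 \<and>
             (D \<noteq> 1 \<longrightarrow> (\<exists>k \<in> units_mod expo - H_set expo D. C1 = pow_set G Cm1 k))
        else C1 = {} \<and> Cm1 = {})"

lemma unit_inverse_pow:
  assumes "k \<in> units_mod expo" "h \<in> carrier G"
  shows "\<exists>g\<in>carrier G. g [^] k = h"
proof -
  have "coprime k expo" using assms(1) by (simp add: units_mod_def)
  then obtain l where l: "[k * l = Suc 0] (mod expo)" using cong_solve_coprime_nat by auto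
  have "(h [^] l) [^] k = h [^] (k * l)" using assms(2) by (simp add: nat_pow_pow mult.commute)
  also have "\<dots> = h" using pow_cong_expo[OF assms(2) l] assms(2) by simp
  finally show ?thesis using assms(2) by blast
qed

lemma condition_of_periodic:
  assumes "periodic_walk (carrier G) (mixed_cayley_mat G Ci C1 Cm1)"
  shows "\<exists>D. condition D"
proof -
  define N where "N = nat (\<Sum>g\<in>carrier G. (u g)\<^sup>2 + (v g)\<^sup>2)"
  have mm: "conv m m \<one> = of_nat N" using conv_m_m_one by (simp add: N_def)
  show ?thesis
  proof (cases "N = 0")
    case True
    have "(\<Sum>g\<in>carrier G. (u g)\<^sup>2 + (v g)\<^sup>2) = 0"
      using True sum_nonneg[of "carrier G" "\<lambda>g. (u g)\<^sup>2 + (v g)\<^sup>2"] by (simp add: N_def)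
    then have "(u g)\<^sup>2 + (v g)\<^sup>2 = 0" if "g \<in> carrier G" for g
      using that by (subst (asm) sum_nonneg_eq_0_iff) auto
    then have "u g = 0 \<and> v g = 0" if "g \<in> carrier G" for g using that by simp
    then have "Ci = {}" "C1 = {}" "Cm1 = {}"
      using sub u_eq_1_iff v_eq_1_iff v_eq_m1_iff by (metis equals0I subsetD zero_neq_one zero_neq_neg_one)+
    \<comment> \<open>The matrix is zero, and D = 1 makes the clause about a unit k vacuous.\<close>
    then have "condition 1" unfolding condition_def by (simp add: union_of_classes_empty)
    then show ?thesis by blast
  next
    case False
    obtain \<Theta> e where sp: "spectral m \<Theta> e" using exists_spectral[OF class_fun_m(3) star_m(3)] by blast
    obtain t \<gamma> where t: "t \<noteq> 0" "\<forall>z\<in>\<Theta>. exp (\<i> * of_real t * z) = \<gamma>"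
      using assms periodic_iff_spectral[of "mixed_cayley_mat G Ci C1 Cm1" m, OF matrix_eq sp] by auto
    obtain D :: int where D: "D > 0" "squarefree D" "\<forall>z\<in>\<Theta>. \<exists>q\<in>\<rat>. z = of_real (q * sqrt (of_int D))"
      using spectral_periodic_rational[OF class_fun_supported[OF class_fun_m(3)] sp t(1) _ m_one mm] t(2) False
      by blast
    obtain A f where A: "spectral mi A f" using exists_spectral[OF class_fun_m(1) star_m(1)] by blast
    obtain B h where B: "spectral mr B h" using exists_spectral[OF class_fun_m(2) star_m(2)] by blast
    \<comment> \<open>On a common eigenvector m acts by \<alpha> + \<beta> and its conjugate by
      \<beta> - \<alpha>. Both numbers lie in \<Theta>, and half their difference and half their sum
      are \<alpha> and \<beta>.\<close>
    have both: "\<exists>q\<in>\<rat>. \<exists>r\<in>\<rat>. \<alpha> = of_real (q * sqrt (of_int D)) \<and> \<beta> = of_real (r * sqrt (of_int D))"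
      if x: "supported x" "x \<noteq> (\<lambda>_. 0)" "conv mi x = (\<lambda>g. \<alpha> * x g)" "conv mr x = (\<lambda>g. \<beta> * x g)" for \<alpha> \<beta> x
    proof -
      have "conv m x = (\<lambda>g. (\<alpha> + \<beta>) * x g)"
        unfolding m_def[abs_def] conv_add_left x(3,4) by (simp add: algebra_simps)
      then have 1: "\<alpha> + \<beta> \<in> \<Theta>"
        using eigen_in_spectrum[OF spectral_resolution[OF sp] x(1,2)] by blast
      have eq: "(\<lambda>g. cnj (m g)) = (\<lambda>g. - 1 * mi g + mr g)" by (simp add: m_def mi_def mr_def)
      have "conv (\<lambda>g. cnj (m g)) x = (\<lambda>g. - 1 * (\<alpha> * x g) + \<beta> * x g)"
        unfolding eq conv_add_left conv_scale_left x(3,4) ..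
      also have "\<dots> = (\<lambda>g. (\<beta> - \<alpha>) * x g)" by (simp add: algebra_simps)
      finally have "conv (\<lambda>g. cnj (m g)) x = (\<lambda>g. (\<beta> - \<alpha>) * x g)" .
      then have 2: "\<beta> - \<alpha> \<in> \<Theta>"
        using eigen_in_spectrum[OF spectral_resolution[OF spectral_cnj[OF sp]] x(1,2)] by blast
      obtain q where q: "q \<in> \<rat>" "\<alpha> + \<beta> = of_real (q * sqrt (of_int D))"
        using bspec[OF D(3) 1] by (rule bexE)
      obtain r where r: "r \<in> \<rat>" "\<beta> - \<alpha> = of_real (r * sqrt (of_int D))"
        using bspec[OF D(3) 2] by (rule bexE)
      have "2 * \<alpha> = (\<alpha> + \<beta>) - (\<beta> - \<alpha>)" "2 * \<beta> = (\<alpha> + \<beta>) + (\<beta> - \<alpha>)" by simp_all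
      then have "\<alpha> = of_real ((q - r) / 2 * sqrt (of_int D))" "\<beta> = of_real ((q + r) / 2 * sqrt (of_int D))"
        unfolding q(2) r(2) by (simp_all add: field_simps)
      moreover have "(q - r) / 2 \<in> \<rat>" "(q + r) / 2 \<in> \<rat>" using q(1) r(1) by simp_all
      ultimately show ?thesis by blast
    qed
    have eig_A: "\<exists>q\<in>\<rat>. \<alpha> = of_real (q * sqrt (of_int D))" if "\<alpha> \<in> A" for \<alpha>
      using joint_eigenvector[OF spectral_resolution[OF A] spectral_resolution[OF B] that] both by blast
    have eig_B: "\<exists>q\<in>\<rat>. \<beta> = of_real (q * sqrt (of_int D))" if "\<beta> \<in> B" for \<beta>
      using joint_eigenvector[OF spectral_resolution[OF B] spectral_resolution[OF A] that] both by blast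
    have resv: "resolution (\<lambda>g. of_int (v g)) B h"
      using spectral_resolution[OF B] unfolding mr_def[abs_def] .
    \<comment> \<open>\<open>u\<close> is - \<i> times \<open>mi\<close>, so the squares of its
      eigenvalues are - D times rational squares: the discriminant is - D for \<open>u\<close> and D
      for \<open>v\<close>.\<close>
    have resu: "resolution (\<lambda>g. of_int (u g)) ((\<lambda>\<alpha>. - \<i> * \<alpha>) ` A) (\<lambda>a. f (\<i> * a))"
    proof -
      have "conv (\<lambda>g. of_int (u g)) (f \<alpha>) = (\<lambda>g. - \<i> * \<alpha> * f \<alpha> g)" if "\<alpha> \<in> A" for \<alpha>
      proof -
        have "(\<lambda>g. of_int (u g)) = (\<lambda>g. - \<i> * mi g)" by (simp add: mi_def)
        moreover have "conv mi (f \<alpha>) = (\<lambda>g. \<alpha> * f \<alpha> g)" using A that by (simp add: spectral_def)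
        ultimately show ?thesis by (simp only: conv_scale_left) (simp add: mult.assoc)
      qed
      moreover have "inj_on (\<lambda>\<alpha>. - \<i> * \<alpha>) A" by (simp add: inj_on_def)
      ultimately show ?thesis
        using spectral_resolution[OF A] unfolding resolution_def by (simp add: sum.reindex mult.assoc[symmetric])
    qed
    obtain Bv where Bv: "finite Bv" "ev ([:0, 1:] * (\<Prod>b\<in>Bv. [:- (b\<^sup>2 * D), 0, 1:])) v = (\<lambda>_. 0)"
    proof -
      have "\<exists>q\<in>\<rat>. \<beta>\<^sup>2 = of_real (q\<^sup>2 * of_int D)" if b: "\<beta> \<in> B" for \<beta>
      proof -
        obtain q where q: "q \<in> \<rat>" "\<beta> = of_real (q * sqrt (of_int D))" using eig_B[OF b] by blast
        have "(q * sqrt (of_int D))\<^sup>2 = q\<^sup>2 * of_int D" using D(1) by (simp add: power_mult_distrib)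
        then have "\<beta>\<^sup>2 = of_real (q\<^sup>2 * of_int D)" unfolding q(2) by (metis of_real_power)
        then show ?thesis using q(1) by blast
      qed
      then show thesis using int_annihilator[OF class_fun_v resv D(2)] that by blast
    qed
    obtain Bu where Bu: "finite Bu" "ev ([:0, 1:] * (\<Prod>b\<in>Bu. [:- (b\<^sup>2 * - D), 0, 1:])) u = (\<lambda>_. 0)"
    proof -
      have "\<exists>q\<in>\<rat>. a\<^sup>2 = of_real (q\<^sup>2 * of_int (- D))" if a: "a \<in> (\<lambda>\<alpha>. - \<i> * \<alpha>) ` A" for a
      proof -
        obtain \<alpha> where \<alpha>: "\<alpha> \<in> A" "a = - \<i> * \<alpha>" using a by auto
        obtain q where q: "q \<in> \<rat>" "\<alpha> = of_real (q * sqrt (of_int D))" using eig_A[OF \<alpha>(1)] by blast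
        have "(q * sqrt (of_int D))\<^sup>2 = q\<^sup>2 * of_int D" using D(1) by (simp add: power_mult_distrib)
        then have "\<alpha>\<^sup>2 = of_real (q\<^sup>2 * of_int D)" unfolding q(2) by (metis of_real_power)
        then have "a\<^sup>2 = of_real (q\<^sup>2 * of_int (- D))" by (simp add: \<alpha>(2) power_mult_distrib)
        then show ?thesis using q(1) by blast
      qed
      moreover have "squarefree (- D)" using D(2) by simp
      ultimately show thesis using int_annihilator[OF class_fun_u resu] that by blast
    qed
    have 1: "if admissible expo (- D) then union_of_classes G (- D) Ci else Ci = {}"
    proof (cases "Ci = {}")
      case True
      then show ?thesis by (simp add: union_of_classes_empty)
    next
      case ne: False
      then obtain g where "g \<in> Ci" by auto
      then have nz: "u g \<noteq> 0" using u_eq_1_iff[of g] by simp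
      have sq: "squarefree (- D)" using D(2) by simp
      obtain w0 w' S where adm: "admissible_rep expo (- D) w0 w' S"
        and pw: "\<forall>g\<in>carrier G. \<forall>k\<in>units_mod expo. u (g [^] k) = sgn_char w0 w' S k * u g"
        using power_sign_character[OF class_fun_u u_range nz Bu sq] by blast
      have "union_of_classes G (- D) Ci"
        by (rule union_of_classes_level_set[OF class_fun_u adm, where c = 1]) (use pw u_eq_1_iff in auto)
      then show ?thesis using adm by (auto simp: admissible_def)
    qed
    have 2: "if admissible expo D
        then union_of_classes G D C1 \<and> union_of_classes G D Cm1 \<and>
             (D \<noteq> 1 \<longrightarrow> (\<exists>k \<in> units_mod expo - H_set expo D. C1 = pow_set G Cm1 k))
        else C1 = {} \<and> Cm1 = {}"
    proof (cases "C1 = {} \<and> Cm1 = {}")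
      case True
      then show ?thesis using exists_unit_not_H[of D]
        by (auto simp: union_of_classes_empty pow_set_def)
    next
      case ne: False
      then obtain g where "g \<in> C1 \<or> g \<in> Cm1" by auto
      then have nz: "v g \<noteq> 0" using v_eq_1_iff[of g] v_eq_m1_iff[of g] by auto
      obtain w0 w' S where adm: "admissible_rep expo D w0 w' S"
        and pw: "\<forall>g\<in>carrier G. \<forall>k\<in>units_mod expo. v (g [^] k) = sgn_char w0 w' S k * v g"
        using power_sign_character[OF class_fun_v v_range nz Bv D(2)] by blast
      have "union_of_classes G D C1"
        by (rule union_of_classes_level_set[OF class_fun_v adm, where c = 1]) (use pw v_eq_1_iff in auto)
      moreover have "union_of_classes G D Cm1"
        by (rule union_of_classes_level_set[OF class_fun_v adm, where c = "-1"]) (use pw v_eq_m1_iff in auto)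
      \<comment> \<open>A unit of sign -1 negates \<open>v\<close>, so its power map exchanges the
        level sets C1 and Cm1.\<close>
      moreover have "\<exists>k \<in> units_mod expo - H_set expo D. C1 = pow_set G Cm1 k" if D1: "D \<noteq> 1"
      proof -
        obtain k where k: "k \<in> units_mod expo" "sgn_char w0 w' S k = -1"
          using exists_sgn_char_minus_one[OF expo_pos adm D1] by blast
        have vk: "v (g [^] k) = - v g" if "g \<in> carrier G" for g using pw k that by simp
        have "C1 = pow_set G Cm1 k"
        proof
          show "C1 \<subseteq> pow_set G Cm1 k"
          proof
            fix h assume h: "h \<in> C1"
            then obtain g where g: "g \<in> carrier G" "g [^] k = h" using unit_inverse_pow[OF k(1)] sub by blast
            have "v h = 1" using h v_eq_1_iff by blast
            then have "v g = - 1" using vk[OF g(1)] unfolding g(2) by linarith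
            then show "h \<in> pow_set G Cm1 k" using g v_eq_m1_iff by (auto simp: pow_set_def)
          qed
          show "pow_set G Cm1 k \<subseteq> C1"
          proof
            fix h assume "h \<in> pow_set G Cm1 k"
            then obtain g where g: "g \<in> Cm1" "h = g [^] k" by (auto simp: pow_set_def)
            then have "v h = 1" using vk[of g] sub v_eq_m1_iff[of g] by auto
            then show "h \<in> C1" by (simp add: v_eq_1_iff)
          qed
        qed
        moreover have "k \<notin> H_set expo D" unfolding H_set_eq[OF expo_pos adm] using k by simp
        ultimately show ?thesis using k(1) by blast
      qed
      ultimately show ?thesis using adm by (auto simp: admissible_def)
    qed
    have "condition D" unfolding condition_def using D(1,2) 1 2 by blast
    then show ?thesis by blast
  qed
qed

end

section \<open>Rationality from Galois invariance\<close>

definition root_unity :: "nat \<Rightarrow> complex"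
  where "root_unity n = cis (2 * pi / real n)"

lemma root_unity_power: "root_unity n ^ k = cis (2 * pi * real k / real n)"
  by (simp add: root_unity_def DeMoivre mult_ac)

lemma root_unity_power_n: "n > 0 \<Longrightarrow> root_unity n ^ n = 1"
  by (simp add: root_unity_power)

lemma root_unity_power_mod: "n > 0 \<Longrightarrow> root_unity n ^ (k mod n) = root_unity n ^ k"
proof -
  assume n: "n > 0"
  have "root_unity n ^ k = root_unity n ^ (n * (k div n) + k mod n)" by simp
  also have "\<dots> = (root_unity n ^ n) ^ (k div n) * root_unity n ^ (k mod n)"
    by (simp only: power_add power_mult)
  finally show ?thesis using root_unity_power_n[OF n] by simp
qed

lemma root_unity_power_eq_iff:
  assumes "n > 0"
  shows "root_unity n ^ k = root_unity n ^ l \<longleftrightarrow> k mod n = l mod n"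
proof
  assume eq: "root_unity n ^ k = root_unity n ^ l"
  have "inj_on (\<lambda>k. cis (2 * pi * real k / real n)) {..<n}"
    using bij_betw_roots_unity[OF assms] by (rule bij_betw_imp_inj_on)
  moreover have "cis (2 * pi * real (k mod n) / real n) = cis (2 * pi * real (l mod n) / real n)"
    using eq root_unity_power_mod[OF assms] by (metis root_unity_power)
  ultimately show "k mod n = l mod n"
    using assms by (elim inj_onD) auto
qed (metis assms root_unity_power_mod)

lemma root_unity_nonzero [simp]: "root_unity n \<noteq> 0"
  by (simp add: root_unity_def)

lemma sum_powers_root_of_unity:
  fixes \<rho> :: complex
  assumes "\<rho> ^ n = 1"
  shows "(\<Sum>j<n. \<rho> ^ j) = (if \<rho> = 1 then of_nat n else 0)"
  using assms by (simp add: geometric_sum)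

lemma root_unity_mult_power: "d > 0 \<Longrightarrow> m > 0 \<Longrightarrow> root_unity (d * m) ^ (d * k) = root_unity m ^ k"
  by (simp add: root_unity_power mult.assoc)

text \<open>The sum over all k < n is geometric, hence rational, and the k with gcd d > 1 form the
  same kind of sum for n / d.\<close>

lemma ramanujan_sum_rational: "n > 0 \<Longrightarrow> (\<Sum>k\<in>units_mod n. root_unity n ^ (j * k)) \<in> \<rat>"
proof (induction n rule: less_induct)
  case (less n)
  define S where "S d = {k \<in> {..<n}. gcd k n = d}" for d
  let ?z = "\<lambda>k. root_unity n ^ (j * k)"
  have "(\<Sum>k<n. ?z k) = (\<Sum>k<n. (root_unity n ^ j) ^ k)" by (simp add: power_mult)
  also have "\<dots> \<in> \<rat>"
    using root_unity_power_n[OF less.prems]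
    by (subst sum_powers_root_of_unity) (simp_all flip: power_mult, metis mult.commute power_mult power_one)
  finally have total: "(\<Sum>k<n. ?z k) \<in> \<rat>" .
  have fin: "finite {d. d dvd n}" using less.prems by (simp add: finite_divisors_nat)
  have "(\<Sum>k<n. ?z k) = (\<Sum>d\<in>{d. d dvd n}. \<Sum>k\<in>S d. ?z k)"
    unfolding S_def by (rule sum.group[symmetric]) (use fin in auto)
  also have "\<dots> = (\<Sum>k\<in>S 1. ?z k) + (\<Sum>d\<in>{d. d dvd n} - {1}. \<Sum>k\<in>S d. ?z k)"
    using fin by (intro sum.remove) auto
  also have "S 1 = units_mod n" unfolding S_def units_mod_def coprime_iff_gcd_eq_1 by auto
  finally have eq: "(\<Sum>k\<in>units_mod n. ?z k) = (\<Sum>k<n. ?z k) - (\<Sum>d\<in>{d. d dvd n} - {1}. \<Sum>k\<in>S d. ?z k)"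
    by simp
  have "(\<Sum>k\<in>S d. ?z k) \<in> \<rat>" if d: "d \<in> {d. d dvd n} - {1}" for d
  proof -
    obtain m where m: "n = d * m" using d by auto
    have pos: "d > 0" "m > 0" using m less.prems by auto
    have "d > 1" using d pos by auto
    then have "m < n" using m pos by simp
    have "(\<Sum>k\<in>S d. ?z k) = (\<Sum>k\<in>units_mod m. root_unity m ^ (j * k))"
    proof (rule sum.reindex_bij_witness[of _ "\<lambda>k. d * k" "\<lambda>k. k div d"])
      fix k assume k: "k \<in> S d"
      then have "d dvd k" by (auto simp: S_def)
      then obtain l where l: "k = d * l" by auto
      then show "d * (k div d) = k" using pos by simp
      have "gcd (d * l) (d * m) = d" using k l m by (simp add: S_def)
      then have "d * gcd l m = d" by (simp only: gcd_mult_distrib_nat)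
      then have "coprime l m" unfolding coprime_iff_gcd_eq_1 using pos by simp
      moreover have "l < m" using k l m pos by (simp add: S_def)
      ultimately show "k div d \<in> units_mod m" using l pos by (simp add: units_mod_def)
      show "root_unity m ^ (j * (k div d)) = root_unity n ^ (j * k)"
        using root_unity_mult_power[OF pos, of "j * l"] l m pos by (simp add: mult.left_commute)
    next
      fix k assume k: "k \<in> units_mod m"
      then show "d * k div d = k" using pos by simp
      have "gcd k m = 1" using k unfolding units_mod_def coprime_iff_gcd_eq_1 by auto
      then have "gcd (d * k) (d * m) = d" using gcd_mult_distrib_nat[of d k m] by simp
      then show "d * k \<in> S d" using k pos m by (simp add: S_def units_mod_def)
    qed
    then show ?thesis using less.IH[OF \<open>m < n\<close> pos(2)] by simp
  qed
  then have "(\<Sum>d\<in>{d. d dvd n} - {1}. \<Sum>k\<in>S d. ?z k) \<in> \<rat>" by (rule Rats_sum)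
  then show ?case unfolding eq by (rule Rats_diff[OF total])
qed

text \<open>Functions \<open>k \<mapsto> q(\<zeta>\<^sup>k)\<close> with \<open>q\<close> a rational polynomial and \<open>\<zeta> = root_unity n\<close>:
  they encode the Galois orbit of an element of the cyclotomic field without field automorphisms.\<close>

inductive rat_trig :: "nat \<Rightarrow> (nat \<Rightarrow> complex) \<Rightarrow> bool" for n where
  monomial: "r \<in> \<rat> \<Longrightarrow> rat_trig n (\<lambda>k. r * root_unity n ^ (j * k))"
| add: "rat_trig n f \<Longrightarrow> rat_trig n g \<Longrightarrow> rat_trig n (\<lambda>k. f k + g k)"

lemma rat_trig_const: "r \<in> \<rat> \<Longrightarrow> rat_trig n (\<lambda>k. r)"
  using rat_trig.monomial[of r n 0] by simp

lemma rat_trig_mult: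
  assumes "rat_trig n f" "rat_trig n g"
  shows "rat_trig n (\<lambda>k. f k * g k)"
  using assms(1)
proof induction
  case (monomial r i)
  show ?case using assms(2)
  proof induction
    case (monomial s j)
    have "rat_trig n (\<lambda>k. (r * s) * root_unity n ^ ((i + j) * k))"
      using monomial \<open>r \<in> \<rat>\<close> by (intro rat_trig.monomial) simp
    then show ?case by (simp add: power_add algebra_simps)
  next
    case (add f g)
    then show ?case using rat_trig.add[OF add.IH] by (simp add: algebra_simps)
  qed
next
  case (add f1 f2)
  then show ?case using rat_trig.add[OF add.IH] by (simp add: algebra_simps)
qed

lemma rat_trig_sum:
  "(\<And>i. i \<in> I \<Longrightarrow> rat_trig n (f i)) \<Longrightarrow> rat_trig n (\<lambda>k. \<Sum>i\<in>I. f i k)"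
  by (induction I rule: infinite_finite_induct) (auto intro: rat_trig_const rat_trig.add)

lemma rat_trig_sum_units:
  assumes "rat_trig n f" "n > 0"
  shows "(\<Sum>k\<in>units_mod n. f k) \<in> \<rat>"
  using assms(1)
proof induction
  case (monomial r j)
  then show ?case using ramanujan_sum_rational[OF assms(2), of j] by (simp flip: sum_distrib_left)
next
  case (add f g)
  then show ?case by (simp add: sum.distrib)
qed

lemma card_units_mod_pos: "n > 0 \<Longrightarrow> card (units_mod n) > 0"
proof -
  assume n: "n > 0"
  have "1 mod n \<in> units_mod n" using n by (simp add: units_mod_def)
  moreover have "finite (units_mod n)" by (simp add: units_mod_def)
  ultimately show ?thesis by (auto simp: card_gt_0_iff)
qed

text \<open>Galois descent by averaging: an element equal to all its conjugates is their average,
  which is a rational combination of Ramanujan sums.\<close>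

lemma rat_trig_constant_on_units:
  assumes "rat_trig n f" "n > 0" "\<And>k. k \<in> units_mod n \<Longrightarrow> f k = c"
  shows "c \<in> \<rat>"
proof -
  have "of_nat (card (units_mod n)) * c \<in> \<rat>"
    using rat_trig_sum_units[OF assms(1,2)] assms(3) by simp
  then have "(of_nat (card (units_mod n)) * c) / of_nat (card (units_mod n)) \<in> \<rat>" by (rule Rats_divide) simp
  then show ?thesis using card_units_mod_pos[OF assms(2)] by simp
qed

lemma sum_periodic_shift:
  fixes F :: "nat \<Rightarrow> complex"
  assumes "\<And>s. F (s + n) = F s"
  shows "(\<Sum>l<n. F (a + l)) = (\<Sum>l<n. F l)"
proof (induction a)
  case (Suc a)
  have "F a + (\<Sum>l<n. F (Suc a + l)) = (\<Sum>l<Suc n. F (a + l))"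
    by (simp only: sum.lessThan_Suc_shift) simp
  also have "\<dots> = (\<Sum>l<n. F (a + l)) + F a" using assms[of a] by simp
  finally show ?case using Suc by simp
qed simp

lemma common_denominator:
  assumes "finite S" "S \<subseteq> (\<rat> :: real set)"
  shows "\<exists>N::nat. N > 0 \<and> (\<forall>q\<in>S. of_nat N * q \<in> \<int>)"
  using assms
proof (induction S rule: finite_induct)
  case empty
  show ?case by (rule exI[of _ 1]) simp
next
  case (insert q S)
  then obtain N where N: "N > 0" "\<forall>q\<in>S. of_nat N * q \<in> \<int>" by auto
  from insert.prems obtain a b :: int where ab: "b > 0" "q = of_int a / of_int b" by (auto elim!: Rats_cases')
  define N' where "N' = N * nat b"
  have b: "real (nat b) = of_int b" using ab(1) by simp
  have "of_nat N' * x \<in> \<int>" if "x \<in> insert q S" for x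
  proof (cases "x = q")
    case True
    have "of_nat N' * x = of_int (int N * a)" using ab b True by (simp add: N'_def)
    then show ?thesis by (metis Ints_of_int)
  next
    case False
    then have "of_nat N * x \<in> \<int>" using N(2) that by auto
    then have "of_int b * (of_nat N * x) \<in> \<int>" by simp
    then show ?thesis using b by (simp add: N'_def mult_ac)
  qed
  moreover have "N' > 0" using N(1) ab(1) by (simp add: N'_def)
  ultimately show ?case by blast
qed

text \<open>Ratios to a fixed nonzero z0 are rational, z / z0 being z z0 over z0^2; a common
  denominator N gives t = 2 pi N / z0.\<close>

lemma common_period:
  assumes "finite \<Theta>" "\<Theta> \<subseteq> \<real>" "\<And>z z'. z \<in> \<Theta> \<Longrightarrow> z' \<in> \<Theta> \<Longrightarrow> z * z' \<in> \<rat>"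
  shows "\<exists>t::real. t \<noteq> 0 \<and> (\<forall>z\<in>\<Theta>. exp (\<i> * of_real t * z) = 1)"
proof (cases "\<forall>z\<in>\<Theta>. z = 0")
  case True
  then show ?thesis by (intro exI[of _ 1]) auto
next
  case False
  then obtain z0 where z0: "z0 \<in> \<Theta>" "z0 \<noteq> 0" by auto
  have re: "z = of_real (Re z)" if "z \<in> \<Theta>" for z using assms(2) that by (auto simp: of_real_Re)
  have x0: "Re z0 \<noteq> 0" using z0 re by fastforce
  have q: "Re z / Re z0 \<in> \<rat>" if z: "z \<in> \<Theta>" for z
  proof -
    have rr: "Re z * Re z0 \<in> \<rat>" if "z \<in> \<Theta>" for z
    proof -
      have "of_real (Re z * Re z0) = z * z0" using re[OF that] re[OF z0(1)] by (metis of_real_mult)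
      then have "complex_of_real (Re z * Re z0) \<in> \<rat>" using assms(3)[OF that z0(1)] by simp
      then obtain a b :: int where ab: "complex_of_real (Re z * Re z0) = of_int a / of_int b"
        by (auto elim!: Rats_cases')
      have "complex_of_real (Re z * Re z0) = of_real (of_int a / of_int b)" unfolding ab by simp
      then have "Re z * Re z0 = of_int a / of_int b" by (simp only: of_real_eq_iff)
      then show ?thesis by simp
    qed
    show ?thesis using Rats_divide[OF rr[OF z] rr[OF z0(1)]] x0 by simp
  qed
  obtain N :: nat where N: "N > 0" "\<forall>q\<in>(\<lambda>z. Re z / Re z0) ` \<Theta>. of_nat N * q \<in> \<int>"
    using common_denominator[of "(\<lambda>z. Re z / Re z0) ` \<Theta>"] assms(1) q by auto
  define t where "t = 2 * pi * real N / Re z0"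
  have "exp (\<i> * of_real t * z) = 1" if z: "z \<in> \<Theta>" for z
  proof -
    have "exp (\<i> * of_real t * z) = cis (t * Re z)"
      using re[OF z] by (metis cis_conv_exp mult.assoc of_real_mult)
    also have "t * Re z = 2 * pi * (real N * (Re z / Re z0))" by (simp add: t_def)
    also have "cis \<dots> = 1" using N(2) z by (intro cis_multiple_2pi) auto
    finally show ?thesis .
  qed
  moreover have "t \<noteq> 0" using N(1) x0 by (simp add: t_def)
  ultimately show ?thesis by blast
qed

context finite_group
begin

section \<open>Traces of group elements on spectral projections\<close>

definition point :: "'g \<Rightarrow> 'g \<Rightarrow> complex"
  where "point h = (\<lambda>g. if g = h then 1 else 0)"

lemma conv_point: "h \<in> carrier G \<Longrightarrow> g \<in> carrier G \<Longrightarrow> conv (point h) x g = x (inv h \<otimes> g)"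
  by (simp add: conv_def point_def if_distrib[of "\<lambda>c. c * _"] cong: if_cong)

lemma conv_point_point:
  assumes "h \<in> carrier G" "h' \<in> carrier G"
  shows "conv (point h) (point h') = point (h \<otimes> h')"
proof
  fix g
  show "conv (point h) (point h') g = point (h \<otimes> h') g"
  proof (cases "g \<in> carrier G")
    case True
    have "inv h \<otimes> g = h' \<longleftrightarrow> g = h \<otimes> h'"
      using assms True by (metis inv_solve_left)
    then show ?thesis using assms True by (simp add: conv_point) (simp add: point_def)
  next
    case False
    then show ?thesis using assms by (auto simp: conv_def point_def)
  qed
qed

text \<open>The quantity is the trace of g^k on the image of e. Splitting this image into
  eigenspaces of g, with multiplicity \<open>d j\<close> for \<zeta>^j, gives the sum of the
  \<open>d j\<close> times \<zeta>^(jk).\<close>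

lemma trace_power_rat_trig:
  assumes e: "class_fun e" "conv e e = e" and g: "g \<in> carrier G"
  shows "rat_trig expo (\<lambda>k. of_nat (order G) * e (inv (g [^] k)))"
proof -
  let ?n = expo
  define \<zeta> where "\<zeta> = root_unity ?n"
  define c where "c l = of_nat (order G) * e (inv (g [^] l))" for l :: nat
  have z0: "\<zeta> \<noteq> 0" by (simp add: \<zeta>_def)
  have zn: "\<zeta> ^ ?n = 1" by (simp add: \<zeta>_def root_unity_power_n)
  \<comment> \<open>The terms \<zeta>^(-js) g^s, periodic in s; their average \<open>Q j\<close>
    projects onto the eigenvalue \<zeta>^j of translation by g.\<close>
  define F where "F j s = (\<lambda>y. inverse \<zeta> ^ (j * s) * point (g [^] s) y)" for j s :: nat
  have F_per: "F j (s + ?n) = F j s" for j s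
  proof -
    have "inverse \<zeta> ^ (j * (s + ?n)) = inverse \<zeta> ^ (j * s) * (inverse \<zeta> ^ ?n) ^ j"
      by (simp add: distrib_left power_add power_mult[symmetric] mult.commute)
    also have "inverse \<zeta> ^ ?n = 1" by (simp add: power_inverse zn)
    finally have "inverse \<zeta> ^ (j * (s + ?n)) = inverse \<zeta> ^ (j * s)" by simp
    moreover have "g [^] (s + ?n) = g [^] s" by (rule pow_cong_expo[OF g]) (simp add: cong_def)
    ultimately show ?thesis by (simp add: F_def)
  qed
  define Q where "Q j = (\<lambda>y. 1 / of_nat ?n * (\<Sum>l<?n. F j l y))" for j
  have FF: "conv (F j l) (F j l') = F j (l + l')" for j l l'
    unfolding F_def conv_scale_left conv_scale_right
    using g by (simp add: conv_point_point nat_pow_mult distrib_left power_add mult.assoc)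
  have QQ: "conv (Q j) (Q j) = Q j" for j
  proof
    fix y
    have "conv (Q j) (Q j) y = 1 / of_nat ?n * (1 / of_nat ?n * (\<Sum>l<?n. \<Sum>l'<?n. F j (l + l') y))"
      unfolding Q_def conv_scale_left conv_scale_right conv_sum_left conv_sum_right FF
      by simp
    also have "(\<Sum>l<?n. \<Sum>l'<?n. F j (l + l') y) = (\<Sum>l<?n. \<Sum>l'<?n. F j l' y)"
      by (intro sum.cong refl sum_periodic_shift) (simp add: F_per)
    also have "1 / of_nat ?n * (1 / of_nat ?n * \<dots>) = Q j y"
      using expo_pos by (simp add: Q_def)
    finally show "conv (Q j) (Q j) y = Q j y" .
  qed
  \<comment> \<open>Idempotent because the central e commutes with \<open>Q j\<close>; its trace is
    the multiplicity \<open>d j\<close>.\<close>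
  define x where "x j = conv (Q j) e" for j
  have "conv (x j) (x j) = x j" for j
  proof -
    have "conv (x j) (x j) = conv (Q j) (conv (conv e (Q j)) e)" by (simp add: x_def conv_assoc)
    also have "conv e (Q j) = conv (Q j) e" using conv_commute[OF e(1), of "Q j"] by simp
    also have "conv (Q j) (conv (conv (Q j) e) e) = conv (conv (Q j) (Q j)) (conv e e)"
      by (simp add: conv_assoc)
    finally show ?thesis by (simp add: QQ e(2) x_def)
  qed
  then have "\<forall>j. \<exists>d::nat. of_nat (order G) * x j \<one> = of_nat d" using idempotent_trace by blast
  then obtain d :: "nat \<Rightarrow> nat" where d: "\<And>j. of_nat (order G) * x j \<one> = of_nat (d j)" by metis
  have dj: "of_nat (d j) = 1 / of_nat ?n * (\<Sum>l<?n. inverse \<zeta> ^ (j * l) * c l)" for j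
  proof -
    have "conv (F j l) e \<one> = inverse \<zeta> ^ (j * l) * e (inv (g [^] l))" for l
      unfolding F_def conv_scale_left using g by (simp add: conv_point)
    then have "x j \<one> = 1 / of_nat ?n * (\<Sum>l<?n. inverse \<zeta> ^ (j * l) * e (inv (g [^] l)))"
      unfolding x_def Q_def conv_scale_left conv_sum_left by simp
    then show ?thesis unfolding d[symmetric] c_def by (simp add: sum_distrib_left mult_ac)
  qed
  \<comment> \<open>Fourier inversion on the cyclic group of order \<open>expo\<close>.\<close>
  have "c k = (\<Sum>j<?n. of_nat (d j) * \<zeta> ^ (j * k))" for k
  proof -
    have "(\<Sum>j<?n. of_nat (d j) * \<zeta> ^ (j * k))
        = (\<Sum>j<?n. \<Sum>l<?n. 1 / of_nat ?n * c l * ((\<zeta> ^ k * inverse \<zeta> ^ l) ^ j))"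
      unfolding dj sum_distrib_left sum_distrib_right
      by (intro sum.cong refl) (simp add: power_mult_distrib mult_ac flip: power_mult)
    also have "\<dots> = (\<Sum>l<?n. 1 / of_nat ?n * c l * (\<Sum>j<?n. (\<zeta> ^ k * inverse \<zeta> ^ l) ^ j))"
      by (subst sum.swap) (simp add: sum_distrib_left)
    also have "\<dots> = (\<Sum>l<?n. if l = k mod ?n then c l else 0)"
    proof (intro sum.cong refl)
      fix l assume l: "l \<in> {..<?n}"
      have "(\<zeta> ^ k * inverse \<zeta> ^ l) ^ ?n = (\<zeta> ^ ?n) ^ k * inverse ((\<zeta> ^ ?n) ^ l)"
        by (simp add: power_mult_distrib power_inverse flip: power_mult) (simp add: mult.commute)
      then have "(\<Sum>j<?n. (\<zeta> ^ k * inverse \<zeta> ^ l) ^ j) = (if \<zeta> ^ k * inverse \<zeta> ^ l = 1 then of_nat ?n else 0)"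
        by (intro sum_powers_root_of_unity) (simp add: zn)
      also have "\<zeta> ^ k * inverse \<zeta> ^ l = 1 \<longleftrightarrow> \<zeta> ^ k = \<zeta> ^ l"
        using z0 by (simp add: power_inverse field_simps)
      also have "\<dots> \<longleftrightarrow> l = k mod ?n"
        unfolding \<zeta>_def root_unity_power_eq_iff[OF expo_pos] using l by auto
      finally show "1 / of_nat ?n * c l * (\<Sum>j<?n. (\<zeta> ^ k * inverse \<zeta> ^ l) ^ j) = (if l = k mod ?n then c l else 0)"
        using expo_pos by simp
    qed
    also have "\<dots> = c (k mod ?n)" using expo_pos by simp
    also have "\<dots> = c k" unfolding c_def using pow_mod_expo[OF g] by simp
    finally show ?thesis by simp
  qed
  then have "(\<lambda>k. c k) = (\<lambda>k. \<Sum>j<?n. of_nat (d j) * \<zeta> ^ (j * k))" by blast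
  moreover have "rat_trig ?n (\<lambda>k. \<Sum>j<?n. of_nat (d j) * \<zeta> ^ (j * k))"
    unfolding \<zeta>_def by (intro rat_trig_sum rat_trig.monomial) simp
  ultimately show ?thesis unfolding c_def by simp
qed

lemma sum_power_reindex:
  assumes "coprime k expo"
  shows "(\<Sum>g\<in>carrier G. f (g [^] k)) = (\<Sum>g\<in>carrier G. f g)"
proof -
  have inj: "inj_on (\<lambda>g. g [^] k) (carrier G)"
    using pow_inj_coprime[OF assms] by (auto simp: inj_on_def)
  moreover have "(\<lambda>g. g [^] k) ` carrier G \<subseteq> carrier G" by auto
  ultimately have "(\<lambda>g. g [^] k) ` carrier G = carrier G"
    by (intro endo_inj_surj) auto
  then show ?thesis using sum.reindex[OF inj, of f] by simp
qed

text \<open>z times its multiplicity is \<kappa> times \<tau> z, a sum of traces.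
  \<open>M k g\<close> plays the k-th conjugate of \<open>m' g\<close>; conjugating all terms and
  reindexing by the power map multiplies \<tau> z by the sign \<open>s k\<close>, which cancels in a
  product of two. The scalar \<kappa> is not conjugated, and only its square has to be
  rational.\<close>

theorem eigenvalue_product_rational:
  assumes sp: "spectral m \<Theta> e" and z: "z \<in> \<Theta>" "z' \<in> \<Theta>"
    and tw: "\<And>g. g \<in> carrier G \<Longrightarrow> rat_trig expo (\<lambda>k. M k g)"
    and M: "\<And>k g. k \<in> units_mod expo \<Longrightarrow> g \<in> carrier G \<Longrightarrow> M k g = s k * m' (g [^] k)"
    and s: "\<And>k. k \<in> units_mod expo \<Longrightarrow> s k * s k = 1"
    and m: "\<And>g. g \<in> carrier G \<Longrightarrow> m g = \<kappa> * m' g" and \<kappa>: "\<kappa>\<^sup>2 \<in> \<rat>"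
  shows "z * z' \<in> \<rat>"
proof -
  obtain d where d: "\<And>z. z \<in> \<Theta> \<Longrightarrow> of_nat (order G) * e z \<one> = of_nat (d z)" "\<And>z. z \<in> \<Theta> \<Longrightarrow> d z \<noteq> 0"
    using spectral_trace_nat[OF sp] by metis
  define c where "c z g = of_nat (order G) * e z (inv g)" for z g
  define T where "T z k = (\<Sum>g\<in>carrier G. M k g * c z (g [^] k))" for z k
  define \<tau> where "\<tau> z = (\<Sum>g\<in>carrier G. m' g * c z g)" for z
  have T_trig: "rat_trig expo (T z)" if "z \<in> \<Theta>" for z
    unfolding T_def c_def
  proof (rule rat_trig_sum)
    fix g assume g: "g \<in> carrier G"
    then have "rat_trig expo (\<lambda>k. of_nat (order G) * e z (inv (g [^] k)))"
      using sp that by (intro trace_power_rat_trig) (auto simp: spectral_def)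
    then show "rat_trig expo (\<lambda>k. M k g * (of_nat (order G) * e z (inv (g [^] k))))"
      using rat_trig_mult[OF tw[OF g]] by blast
  qed
  have T_unit: "T z k = s k * \<tau> z" if k: "k \<in> units_mod expo" for z k
  proof -
    have "T z k = s k * (\<Sum>g\<in>carrier G. m' (g [^] k) * c z (g [^] k))"
      unfolding T_def by (simp add: M[OF k] sum_distrib_left mult.assoc)
    also have "(\<Sum>g\<in>carrier G. m' (g [^] k) * c z (g [^] k)) = \<tau> z"
      unfolding \<tau>_def using k by (intro sum_power_reindex) (simp add: units_mod_def)
    finally show ?thesis .
  qed
  have zd: "\<kappa> * \<tau> z = z * of_nat (d z)" if z: "z \<in> \<Theta>" for z
  proof -
    have "\<kappa> * \<tau> z = of_nat (order G) * conv m (e z) \<one>"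
      unfolding \<tau>_def c_def by (simp add: conv_def m sum_distrib_left mult_ac)
    also have "conv m (e z) \<one> = z * e z \<one>" using sp z by (simp add: spectral_def)
    finally show ?thesis using d(1)[OF z] by (simp add: mult.left_commute)
  qed
  have "\<tau> z * \<tau> z' \<in> \<rat>"
  proof (rule rat_trig_constant_on_units[OF rat_trig_mult[OF T_trig[OF z(1)] T_trig[OF z(2)]] expo_pos])
    fix k assume k: "k \<in> units_mod expo"
    have "T z k * T z' k = (s k * s k) * (\<tau> z * \<tau> z')" by (simp add: T_unit[OF k] mult_ac)
    then show "T z k * T z' k = \<tau> z * \<tau> z'" by (simp add: s[OF k])
  qed
  then have "\<kappa>\<^sup>2 * (\<tau> z * \<tau> z') \<in> \<rat>" using \<kappa> by simp
  moreover have "\<kappa>\<^sup>2 * (\<tau> z * \<tau> z') = (\<kappa> * \<tau> z) * (\<kappa> * \<tau> z')" by (simp add: power2_eq_square mult_ac)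
  ultimately have "(z * of_nat (d z)) * (z' * of_nat (d z')) \<in> \<rat>" by (simp only: zd[OF z(1)] zd[OF z(2)])
  then have "(z * of_nat (d z)) * (z' * of_nat (d z')) / (of_nat (d z) * of_nat (d z')) \<in> \<rat>"
    by (rule Rats_divide) simp
  then show ?thesis using d(2)[OF z(1)] d(2)[OF z(2)] by simp
qed

end

section \<open>The class condition implies periodicity\<close>

text \<open>The Galois action on \<i> is the character \<open>chi4\<close>.\<close>

lemma i_power_odd: "odd k \<Longrightarrow> \<i> ^ k = of_int (chi4 k) * \<i>"
proof -
  assume "odd k"
  then have "k mod 4 = 1 \<or> k mod 4 = 3" using odd_mod_4[of k] by auto
  moreover have "\<i> ^ k = \<i> ^ (4 * (k div 4) + k mod 4)" by simp
  then have "\<i> ^ k = \<i> ^ (k mod 4)" unfolding power_add power_mult by (simp add: power4_eq_xxxx)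
  ultimately show ?thesis by (auto simp: chi4_def power3_eq_cube)
qed

context mixed_cayley
begin

text \<open>H_\<Delta> has index at most 2 in the units, so one k0 of sign -1 with the right action
  settles every other k of sign -1 as k0 l with l in H_\<Delta>. A k0 is demanded only if some unit
  has sign -1, as a trivial character has none.\<close>

lemma sign_character_from_generator:
  fixes w :: "'g \<Rightarrow> int"
  assumes adm: "admissible_rep expo \<Delta> w0 w' S"
    and H: "\<And>g l. g \<in> carrier G \<Longrightarrow> l \<in> H_set expo \<Delta> \<Longrightarrow> w (g [^] l) = w g"
    and k0: "\<And>k. k \<in> units_mod expo \<Longrightarrow> sgn_char w0 w' S k = -1 \<Longrightarrow>
      \<exists>k0\<in>units_mod expo. sgn_char w0 w' S k0 = -1 \<and> (\<forall>g\<in>carrier G. w (g [^] k0) = - w g)"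
    and g: "g \<in> carrier G" and k: "k \<in> units_mod expo"
  shows "w (g [^] k) = sgn_char w0 w' S k * w g"
proof (cases "sgn_char w0 w' S k = 1")
  case True
  then show ?thesis using H[OF g, of k] k unfolding H_set_eq[OF expo_pos adm] by simp
next
  case False
  then have sk: "sgn_char w0 w' S k = -1" using sgn_char_unit_pm1[OF expo_pos adm k] by blast
  then obtain k0 where k0: "k0 \<in> units_mod expo" "sgn_char w0 w' S k0 = -1"
    "\<forall>g\<in>carrier G. w (g [^] k0) = - w g" using k0[OF k] by blast
  have "coprime k0 expo" using k0(1) by (simp add: units_mod_def)
  then obtain r where r: "[k0 * r = Suc 0] (mod expo)" using cong_solve_coprime_nat by auto
  have cr: "coprime r expo" using r by (metis cong_imp_coprime cong_sym coprime_Suc_0_left coprime_mult_left_iff)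
  define l where "l = k * r mod expo"
  have lu: "l \<in> units_mod expo"
    using k cr by (simp add: l_def units_mod_def)
  have kl: "[k0 * l = k] (mod expo)"
  proof -
    have "[k0 * l = k0 * (k * r)] (mod expo)" unfolding l_def by (intro cong_mult) (simp_all add: cong_def)
    also have "k0 * (k * r) = k0 * r * k" by simp
    also have "[k0 * r * k = Suc 0 * k] (mod expo)" by (intro cong_mult r cong_refl)
    finally show ?thesis by simp
  qed
  have "sgn_char w0 w' S k0 * sgn_char w0 w' S l = sgn_char w0 w' S k"
    using sgn_char_unit_mult[OF expo_pos adm k0(1) lu] sgn_char_cong[OF expo_pos adm kl] by simp
  then have "sgn_char w0 w' S l = 1" using sk k0(2) by simp
  then have lH: "l \<in> H_set expo \<Delta>" unfolding H_set_eq[OF expo_pos adm] using lu by simp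
  have "g [^] k = g [^] (l * k0)" using pow_cong_expo[OF g kl] by (simp add: mult.commute)
  also have "\<dots> = (g [^] l) [^] k0" using g by (simp add: nat_pow_pow)
  finally have "w (g [^] k) = - w (g [^] l)" using k0(3) g by simp
  then show ?thesis using H[OF g lH] sk by simp
qed

lemma H_closed:
  assumes "union_of_classes G \<Delta> C" "g \<in> carrier G" "l \<in> H_set expo \<Delta>"
  shows "g [^] l \<in> C \<longleftrightarrow> g \<in> C"
proof -
  have "Defs.conjugate G (g [^] l) (g [^] l)" unfolding Defs.conjugate_def using assms(2)
    by (intro bexI[of _ \<one>]) auto
  then have "equiv_Delta G \<Delta> (g [^] l) g" unfolding equiv_Delta_def using assms(3) by blast
  then show ?thesis using assms unfolding union_of_classes_def by auto
qed

text \<open>Inversion is the power map for \<open>expo - 1\<close>. It negates \<open>u\<close> by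
  construction and has sign -1 because - D is negative, so it serves as k0; this is why no unit k
  appears in the condition on Ci.\<close>

lemma u_power:
  assumes D: "D > 0" and adm: "admissible_rep expo (- D) w0 w' S" and un: "union_of_classes G (- D) Ci"
    and g: "g \<in> carrier G" and k: "k \<in> units_mod expo"
  shows "u (g [^] k) = sgn_char w0 w' S k * u g"
proof (rule sign_character_from_generator[OF adm _ _ g k])
  fix g l assume g: "g \<in> carrier G" and l: "l \<in> H_set expo (- D)"
  have "g [^] l \<in> inv_set G Ci \<longleftrightarrow> g \<in> inv_set G Ci"
    using g sub H_closed[OF un _ l, of "inv g"] by (simp add: inv_set_iff nat_pow_inv)
  then show "u (g [^] l) = u g" using H_closed[OF un g l] by (simp add: u_def)
next
  have mem: "expo - 1 \<in> units_mod expo"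
    unfolding units_mod_def using expo_pos coprime_diff_one_left_nat[OF expo_pos] by simp
  have inv: "g [^] (expo - 1) = inv g" if g: "g \<in> carrier G" for g
  proof -
    have "g [^] (expo - 1) \<otimes> g = \<one>"
      using pow_expo[OF g] expo_pos by (metis Suc_diff_1 nat_pow_Suc)
    then show ?thesis using g by (simp add: inv_equality)
  qed
  have "sgn_char w0 w' S (expo - 1) = -1"
    using sgn_char_minus_one[OF expo_pos adm] D by simp
  then show "\<exists>k0\<in>units_mod expo. sgn_char w0 w' S k0 = -1 \<and> (\<forall>g\<in>carrier G. u (g [^] k0) = - u g)"
    using mem inv u_inv by (metis (no_types, lifting))
qed

text \<open>The given k0 carries Cm1 to C1. That it also carries C1 to Cm1 follows because k0^2 has
  sign 1, lies in H_D and preserves C1.\<close>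

lemma v_power:
  assumes adm: "admissible_rep expo D w0 w' S"
    and un: "union_of_classes G D C1" "union_of_classes G D Cm1"
    and gen: "D \<noteq> 1 \<longrightarrow> (\<exists>k \<in> units_mod expo - H_set expo D. C1 = pow_set G Cm1 k)"
    and g: "g \<in> carrier G" and k: "k \<in> units_mod expo"
  shows "v (g [^] k) = sgn_char w0 w' S k * v g"
proof (rule sign_character_from_generator[OF adm _ _ g k])
  fix g l assume "g \<in> carrier G" "l \<in> H_set expo D"
  then show "v (g [^] l) = v g" using H_closed[OF un(1)] H_closed[OF un(2)] by (simp add: v_def)
next
  fix k assume k: "k \<in> units_mod expo" "sgn_char w0 w' S k = -1"
  \<comment> \<open>The only representation of 1 is the trivial one, and its character is constantly
    1.\<close>
  have "D \<noteq> 1"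
  proof
    assume "D = 1"
    then have "disc_rep w0 w' S = disc_rep False False {}"
      using adm by (simp add: admissible_rep_iff) (simp add: disc_rep_def)
    moreover have "odd_primes S" using adm odd_prime_divs_odd_primes[OF expo_pos] by (simp add: admissible_rep_iff)
    moreover have "odd_primes {}" by (simp add: odd_primes_def)
    ultimately have "\<not> w0 \<and> \<not> w' \<and> S = {}" using disc_rep_unique by blast
    then show False using k(2) by (simp add: sgn_char_def)
  qed
  then obtain k0 where k0: "k0 \<in> units_mod expo" "k0 \<notin> H_set expo D" "C1 = pow_set G Cm1 k0"
    using gen by blast
  have s0: "sgn_char w0 w' S k0 = -1"
    using k0 sgn_char_unit_pm1[OF expo_pos adm k0(1)] unfolding H_set_eq[OF expo_pos adm] by blast
  define q where "q = k0 * k0 mod expo"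
  have qH: "q \<in> H_set expo D"
  proof -
    have "sgn_char w0 w' S q = sgn_char w0 w' S (k0 * k0)"
      by (rule sgn_char_cong[OF expo_pos adm]) (simp add: q_def cong_def)
    then have "sgn_char w0 w' S q = 1" using sgn_char_unit_mult[OF expo_pos adm k0(1) k0(1)] s0 by simp
    moreover have "q \<in> units_mod expo" unfolding q_def by (rule units_mod_mult[OF expo_pos k0(1) k0(1)])
    ultimately show ?thesis unfolding H_set_eq[OF expo_pos adm] by simp
  qed
  have sq: "(g [^] k0) [^] k0 = g [^] q" if "g \<in> carrier G" for g
    using that pow_mod_expo[OF that, of "k0 * k0"] by (simp add: nat_pow_pow q_def)
  have to_C1: "g [^] k0 \<in> C1 \<longleftrightarrow> g \<in> Cm1" if g: "g \<in> carrier G" for g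
  proof
    assume "g [^] k0 \<in> C1"
    then obtain h where h: "h \<in> Cm1" "g [^] k0 = h [^] k0" using k0(3) by (auto simp: pow_set_def)
    have "g = h" using pow_inj_coprime[of k0 g h] k0(1) g h sub by (auto simp: units_mod_def)
    then show "g \<in> Cm1" using h by simp
  qed (use k0(3) in \<open>auto simp: pow_set_def\<close>)
  have to_Cm1: "g [^] k0 \<in> Cm1 \<longleftrightarrow> g \<in> C1" if g: "g \<in> carrier G" for g
    using to_C1[of "g [^] k0"] sq[OF g] H_closed[OF un(1) g qH] g by simp
  have "v (g [^] k0) = - v g" if "g \<in> carrier G" for g
    using to_C1[OF that] to_Cm1[OF that] by (simp add: v_def)
  then show "\<exists>k0\<in>units_mod expo. sgn_char w0 w' S k0 = -1 \<and> (\<forall>g\<in>carrier G. v (g [^] k0) = - v g)"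
    using k0(1) s0 by blast
qed

lemma periodic_of_products:
  assumes "\<And>\<Theta> e z z'. spectral m \<Theta> e \<Longrightarrow> z \<in> \<Theta> \<Longrightarrow> z' \<in> \<Theta> \<Longrightarrow> z * z' \<in> \<rat>"
  shows "periodic_walk (carrier G) (mixed_cayley_mat G Ci C1 Cm1)"
proof -
  obtain \<Theta> e where sp: "spectral m \<Theta> e" using exists_spectral[OF class_fun_m(3) star_m(3)] by blast
  have "finite \<Theta>" "\<Theta> \<subseteq> \<real>" using sp by (auto simp: spectral_def)
  then have "\<exists>t::real. t \<noteq> 0 \<and> (\<forall>z\<in>\<Theta>. exp (\<i> * of_real t * z) = 1)"
    using common_period assms[OF sp] by blast
  then show ?thesis
    using periodic_iff_spectral[of "mixed_cayley_mat G Ci C1 Cm1" m, OF matrix_eq sp] by blast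
qed

lemma periodic_of_condition:
  assumes "condition D"
  shows "periodic_walk (carrier G) (mixed_cayley_mat G Ci C1 Cm1)"
proof (rule periodic_of_products)
  fix \<Theta> e z z' assume sp: "spectral m \<Theta> e" and z: "z \<in> \<Theta>" "z' \<in> \<Theta>"
  have D: "D > 0" using assms by (simp add: condition_def)
  have u0: "u g = 0" if "\<not> admissible expo (- D)" for g
  proof -
    have "Ci = {}" using assms that by (simp add: condition_def)
    then show ?thesis unfolding u_def inv_set_def by simp
  qed
  have v0: "v g = 0" if "\<not> admissible expo D" for g
  proof -
    have "C1 = {}" "Cm1 = {}" using assms that by (simp_all add: condition_def)
    then show ?thesis unfolding v_def by simp
  qed
  have uQ: "rat_trig expo (\<lambda>k. of_int (u g))" and vQ: "rat_trig expo (\<lambda>k. of_int (v g))" for g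
    by (simp_all add: rat_trig_const)
  have up: "\<exists>w0 w' S. admissible_rep expo (- D) w0 w' S \<and>
      (\<forall>g\<in>carrier G. \<forall>k\<in>units_mod expo. u (g [^] k) = sgn_char w0 w' S k * u g)" if adm: "admissible expo (- D)"
  proof -
    obtain w0 w' S where "admissible_rep expo (- D) w0 w' S" using adm by (auto simp: admissible_def)
    moreover have "union_of_classes G (- D) Ci" using assms adm by (simp add: condition_def)
    ultimately show ?thesis using u_power[OF D] by blast
  qed
  have vp: "\<exists>w0 w' S. admissible_rep expo D w0 w' S \<and>
      (\<forall>g\<in>carrier G. \<forall>k\<in>units_mod expo. v (g [^] k) = sgn_char w0 w' S k * v g)" if adm: "admissible expo D"
  proof -
    obtain w0 w' S where "admissible_rep expo D w0 w' S" using adm by (auto simp: admissible_def)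
    moreover have "union_of_classes G D C1" "union_of_classes G D Cm1"
      "D \<noteq> 1 \<longrightarrow> (\<exists>k \<in> units_mod expo - H_set expo D. C1 = pow_set G Cm1 k)"
      using assms adm by (simp_all add: condition_def)
    ultimately show ?thesis using v_power by blast
  qed
  show "z * z' \<in> \<rat>"
  proof (cases "admissible expo D")
    case adm: True
    then obtain w0 w' S where rep: "admissible_rep expo D w0 w' S"
      and vk: "\<And>g k. g \<in> carrier G \<Longrightarrow> k \<in> units_mod expo \<Longrightarrow> v (g [^] k) = sgn_char w0 w' S k * v g"
      using vp by blast
    define s where "s k = (of_int (sgn_char w0 w' S k) :: complex)" for k
    have ss: "s k * s k = 1" if "k \<in> units_mod expo" for k
      using sgn_char_unit_pm1[OF expo_pos rep that] by (auto simp: s_def)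
    have vs: "of_int (v g) = s k * of_int (v (g [^] k))" if "g \<in> carrier G" "k \<in> units_mod expo" for g k
      using vk[OF that] ss[OF that(2)] by (simp add: s_def flip: mult.assoc)
    show ?thesis
    proof (cases "admissible expo (- D)")
      case True
      then obtain a0 a' T where rep': "admissible_rep expo (- D) a0 a' T"
        and uk: "\<And>g k. g \<in> carrier G \<Longrightarrow> k \<in> units_mod expo \<Longrightarrow> u (g [^] k) = sgn_char a0 a' T k * u g"
        using up by blast
      \<comment> \<open>A change of sign toggles only the parameter for -1. So exactly one of the
        two representations uses it, which forces 4 to divide the exponent, and the characters
        differ by \<open>chi4\<close>.\<close>
      have "disc_rep a0 a' T = disc_rep w0 (\<not> w') S"
      proof -
        have "disc_rep w0 (\<not> w') S = - disc_rep w0 w' S" by (simp add: disc_rep_def)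
        then show ?thesis using rep rep' by (simp add: admissible_rep_iff)
      qed
      moreover have "odd_primes S" "odd_primes T"
        using rep rep' odd_prime_divs_odd_primes[OF expo_pos] by (simp_all add: admissible_rep_iff)
      ultimately have eq: "a0 = w0" "a' = (\<not> w')" "T = S" using disc_rep_unique by blast+
      have four: "4 dvd expo" using rep rep' unfolding eq by (cases w') (auto simp: admissible_rep_iff)
      then obtain c where c: "expo = 4 * c" by auto
      have "c > 0" using c expo_pos by auto
      have i: "root_unity expo ^ c = \<i>"
      proof -
        have "root_unity expo ^ c = cis (pi / 2)"
          using \<open>c > 0\<close> unfolding c root_unity_power by simp
        then show ?thesis by (simp add: cis_pi_half)
      qed
      have sg: "sgn_char a0 a' T k = chi4 k * sgn_char w0 w' S k" for k
        unfolding eq by (auto simp: sgn_char_def chi4_def)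
      \<comment> \<open>The k-th conjugate of \<i> is \<i>^k, that is \<open>chi4 k\<close> times
        \<i>. This absorbs the difference between the characters of \<open>u\<close> and
        \<open>v\<close>, so that m as a whole transforms with the single sign
        \<open>s k\<close>.\<close>
      show ?thesis
      proof (rule eigenvalue_product_rational[OF sp z, where M = "\<lambda>k g. \<i> ^ k * of_int (u g) + of_int (v g)"
            and s = s and m' = m and \<kappa> = 1])
        fix g assume "g \<in> carrier G"
        have "rat_trig expo (\<lambda>k. 1 * root_unity expo ^ (c * k))" by (rule rat_trig.monomial) simp
        then have "rat_trig expo (\<lambda>k. \<i> ^ k)" by (simp add: power_mult i)
        then show "rat_trig expo (\<lambda>k. \<i> ^ k * of_int (u g) + of_int (v g))"
          by (intro rat_trig.add rat_trig_mult uQ vQ)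
      next
        fix k g assume k: "k \<in> units_mod expo" and g: "g \<in> carrier G"
        have "odd k" using admissible_unit_odd[OF expo_pos rep, of k] admissible_unit_odd[OF expo_pos rep', of k] k
          unfolding eq by (auto simp: units_mod_def)
        have "of_int (u g) * of_int (chi4 k) = s k * of_int (u (g [^] k))"
          using uk[OF g k] ss[OF k] unfolding sg s_def by (simp add: mult_ac)
        then have "\<i> ^ k * of_int (u g) = s k * (\<i> * of_int (u (g [^] k)))"
          unfolding i_power_odd[OF \<open>odd k\<close>] by (simp add: mult_ac)
        then show "\<i> ^ k * of_int (u g) + of_int (v g) = s k * m (g [^] k)"
          using vs[OF g k] by (simp add: m_def mi_def mr_def distrib_left)
      qed (use ss in auto)
    next
      case False
      \<comment> \<open>Ci is empty, so m = \<open>mr\<close> has rational values, which are their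
        own conjugates.\<close>
      show ?thesis
      proof (rule eigenvalue_product_rational[OF sp z, where M = "\<lambda>k g. of_int (v g)" and s = s and m' = mr and \<kappa> = 1])
        show "m g = 1 * mr g" for g using u0[OF False] by (simp add: m_def mi_def)
      qed (use ss vs vQ in \<open>auto simp: mr_def\<close>)
    qed
  next
    case nadm: False
    show ?thesis
    proof (cases "admissible expo (- D)")
      case True
      then obtain a0 a' T where rep': "admissible_rep expo (- D) a0 a' T"
        and uk: "\<And>g k. g \<in> carrier G \<Longrightarrow> k \<in> units_mod expo \<Longrightarrow> u (g [^] k) = sgn_char a0 a' T k * u g"
        using up by blast
      define s where "s k = (of_int (sgn_char a0 a' T k) :: complex)" for k
      have ss: "s k * s k = 1" if "k \<in> units_mod expo" for k
        using sgn_char_unit_pm1[OF expo_pos rep' that] by (auto simp: s_def)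
      have us: "of_int (u g) = s k * of_int (u (g [^] k))" if "g \<in> carrier G" "k \<in> units_mod expo" for g k
        using uk[OF that] ss[OF that(2)] by (simp add: s_def flip: mult.assoc)
      \<comment> \<open>C1 and Cm1 are empty. Here \<i> need not be a power of
        \<open>root_unity expo\<close>, so it is split off as \<kappa>, with square -1.\<close>
      show ?thesis
      proof (rule eigenvalue_product_rational[OF sp z, where M = "\<lambda>k g. of_int (u g)" and s = s
            and m' = "\<lambda>g. of_int (u g)" and \<kappa> = "\<i>"])
        show "m g = \<i> * of_int (u g)" for g using v0[OF nadm] by (simp add: m_def mi_def mr_def)
      qed (use ss us uQ in auto)
    next
      case False
      show ?thesis
      proof (rule eigenvalue_product_rational[OF sp z, where M = "\<lambda>k g. 0" and s = "\<lambda>_. 1" and m' = "\<lambda>_. 0" and \<kappa> = 1])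
        show "m g = 1 * 0" for g using v0[OF nadm] u0[OF False] by (simp add: m_def mi_def mr_def)
      qed (auto intro: rat_trig_const)
    qed
  qed
qed

end

theorem theorem10p2:
  fixes G :: "('g, 'b) monoid_scheme" and Ci C1 Cm1 :: "'g set"
  assumes "group G" and "finite (carrier G)"
    and "Ci \<subseteq> carrier G - {\<one>\<^bsub>G\<^esub>}" and "C1 \<subseteq> carrier G - {\<one>\<^bsub>G\<^esub>}"
    and "Cm1 \<subseteq> carrier G - {\<one>\<^bsub>G\<^esub>}"
    and "conj_closed G Ci" and "conj_closed G C1" and "conj_closed G Cm1"
    and "Ci \<inter> inv_set G Ci = {}" and "Ci \<inter> C1 = {}" and "Ci \<inter> Cm1 = {}"
    and "inv_set G Ci \<inter> C1 = {}" and "inv_set G Ci \<inter> Cm1 = {}" and "C1 \<inter> Cm1 = {}"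
    and "inv_set G C1 = C1" and "inv_set G Cm1 = Cm1"
  shows "periodic_walk (carrier G) (mixed_cayley_mat G Ci C1 Cm1) \<longleftrightarrow>
    (\<exists>D::int. D > 0 \<and> squarefree D \<and>
       (if admissible (grp_exponent G) (- D)
        then union_of_classes G (- D) Ci
        else Ci = {}) \<and>
       (if admissible (grp_exponent G) D
        then union_of_classes G D C1 \<and> union_of_classes G D Cm1 \<and>
             (D \<noteq> 1 \<longrightarrow> (\<exists>k \<in> units_mod (grp_exponent G) - H_set (grp_exponent G) D.
                              C1 = pow_set G Cm1 k))
        else C1 = {} \<and> Cm1 = {}))"
proof -
  interpret mixed_cayley G Ci C1 Cm1
    using assms by (simp add: mixed_cayley_def finite_group_def finite_group_axioms_def mixed_cayley_axioms_def)
  show ?thesis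
    using condition_of_periodic periodic_of_condition unfolding condition_def[symmetric] by blast
qed

end
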